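(* For every $\ell \geqslant 2$, there exists a constant $C = C(\ell) > 0$ such that, for every function $p = p(n) \in [0,1]$, with high probability as $n \to \infty$, $$\mathrm{ex}\big(G(n,p), C_{2\ell}\big) \leqslant \begin{cases} C\, n^{1+1/(2\ell-1)} (\log n)^2 & \text{if } p \leqslant n^{-(\ell-1)/(2\ell-1)} (\log n)^{2\ell}, \\ C\, p^{1/\ell} n^{1+1/\ell} & \text{otherwise.}\end{cases}$$
   Context: $G(n,p)$ is the Erdős–Rényi random graph on $n$ vertices in which each edge is present independently with probability $p$. For a graph $\Gamma$, $\mathrm{ex}(\Gamma, C_{2\ell})$ is the maximum number of edges of a $C_{2\ell}$-free subgraph of $\Gamma$, where $C_{2\ell}$ is the cycle of length $2\ell$. "With high probability" means with probability tending to $1$ as $n \to \infty$. *)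

theory Defs
  imports "HOL-Probability.Probability" "HOL-Probability.Product_PMF"
begin

text \<open>A graph is a pair of a vertex set and a set of edges, where the edges of a simple graph are
  two-element sets of vertices.\<close>

type_synonym 'a graph = "'a set \<times> 'a set set"

abbreviation verts :: "'a graph \<Rightarrow> 'a set" where
  "verts \<equiv> fst"

abbreviation edges :: "'a graph \<Rightarrow> 'a set set" where
  "edges \<equiv> snd"

definition all_edges :: "'a set \<Rightarrow> 'a set set" where
  "all_edges V = {e. e \<subseteq> V \<and> card e = 2}"

definition simple_graph :: "'a graph \<Rightarrow> bool" where
  "simple_graph G \<longleftrightarrow> edges G \<subseteq> all_edges (verts G)"

definition subgraph :: "'a graph \<Rightarrow> 'a graph \<Rightarrow> bool" where
  "subgraph H G \<longleftrightarrow> simple_graph H \<and> verts H \<subseteq> verts G \<and> edges H \<subseteq> edges G"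

text \<open>Copies are not required to be induced.\<close>

definition contains_copy :: "'a graph \<Rightarrow> 'b graph \<Rightarrow> bool" where
  "contains_copy G F \<longleftrightarrow>
     (\<exists>f. inj_on f (verts F) \<and> f ` verts F \<subseteq> verts G \<and> (\<forall>e\<in>edges F. f ` e \<in> edges G))"

text \<open>Meaningful for finite \<open>G\<close> and for \<open>F\<close> with at least one edge: the set below is then
  finite and nonempty.\<close>

definition ex_num :: "'a graph \<Rightarrow> 'b graph \<Rightarrow> nat" where
  "ex_num G F = Max {card (edges H) | H. subgraph H G \<and> \<not> contains_copy H F}"

text \<open>The cycle of length \<open>k\<close>, for \<open>k \<ge> 3\<close>.\<close>

definition cycle_graph :: "nat \<Rightarrow> nat graph" where
  "cycle_graph k = ({..<k}, {{i, Suc i mod k} | i. i < k})"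

definition random_graph :: "nat \<Rightarrow> real \<Rightarrow> nat graph pmf" where
  "random_graph n p =
     map_pmf (\<lambda>present. ({..<n}, {e \<in> all_edges {..<n}. present e}))
       (Pi_pmf (all_edges {..<n}) False (\<lambda>_. bernoulli_pmf p))"

end

theory Submission
  imports Defs "HOL-Real_Asymp.Real_Asymp"
begin

text \<open>Cycles are understood to have length \<open>2l\<close>. In an almost regular graph, Cauchy--Schwarz bounds the closed
  \<open>2l\<close>-walks with a repeated vertex by a small fraction of all closed \<open>2l\<close>-walks, so a graph with
  \<open>s\<close> vertices and more than \<open>C s\<^bsup>1+1/l\<^esup>\<close> edges has about \<open>s\<^sup>2\<close> cycles with no edge in more than
  \<open>s\<^bsup>1-1/l\<^esup>\<close> of them. Averaging such cycle families over all vertex sets of size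
  \<open>s \<approx> (n\<^sup>2/e)\<^bsup>l/(l-1)\<^esup>\<close> gives, on any graph with \<open>n\<close> vertices and \<open>e\<close> edges, a weight on the cycles
  with small degrees at every set of edges; this replaces balanced supersaturation in the sense of
  Morris and Saxton. The container method then yields fingerprints, and iterating it from the complete
  graph down to graphs with about \<open>n\<^bsup>1+1/l\<^esup> / p\<^bsup>1-1/l\<^esup>\<close> edges produces a family of edge sets \<open>S\<close>, one of which
  lies in every cycle-free graph with many edges, such that the sum of \<open>p\<^bsup>|S|\<^esup>\<close> tends to 0. Smaller \<open>p\<close>
  are handled by monotonicity in \<open>p\<close>.\<close>


section \<open>Closed walks\<close>

text \<open>A random vertex set of size s keeps about e (s/n)^2 edges. Up to constants, s is the
  least size at which this exceeds C s^(1+1/l), so s^(1-1/l) is about n^2/e. At that scale only the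
  degrees of single edges have to be controlled: j edges forming a proper part of a cycle span at
  least j + 1 vertices, so the sampling itself supplies a factor s/n for each further edge. The
  obstacle is the full cycle, with 2l edges on only 2l vertices. It misses one factor s/n and gains
  1/s^(1-1/l) instead. The resulting condition on the fingerprint size b is that b^(2l-1) is at
  least a constant times n^(2l); this is the origin of n^(1+1/(2l-1)). That term does not shrink as
  the number of edges grows, whereas the other one decays geometrically. With about log n stages,
  stage j being charged j times its fingerprint size, it costs n^(1+1/(2l-1)) (log n)^2. The
  threshold for p is the value at which p^(1/l) n^(1+1/l) equals this cost.\<close>

fun num_walks :: "'a set \<Rightarrow> 'a set set \<Rightarrow> nat \<Rightarrow> 'a \<Rightarrow> 'a \<Rightarrow> real" where
  "num_walks X E 0 x y = of_bool (x = y)"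
| "num_walks X E (Suc j) x y = (\<Sum>z\<in>X. of_bool ({x, z} \<in> E) * num_walks X E j z y)"

definition walks :: "'a set \<Rightarrow> 'a set set \<Rightarrow> nat \<Rightarrow> 'a \<Rightarrow> 'a \<Rightarrow> 'a list set" where
  "walks X E j x y = {xs. length xs = Suc j \<and> hd xs = x \<and> last xs = y \<and> set xs \<subseteq> X \<and>
     successively (\<lambda>u v. {u, v} \<in> E) xs}"

text \<open>The trace of the \<open>2 * j\<close>-th power of the adjacency matrix on
  \<open>X\<close>. The index is half the length, so every value is a squared Frobenius norm, and
  index 0 gives \<open>card X\<close>.\<close>

definition closed_walks :: "'a set \<Rightarrow> 'a set set \<Rightarrow> nat \<Rightarrow> real" where
  "closed_walks X E j = (\<Sum>x\<in>X. num_walks X E (2 * j) x x)"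

lemma num_walks_nonneg [simp]: "num_walks X E j x y \<ge> 0"
  by (induction j arbitrary: x) (auto intro!: sum_nonneg)

lemma num_walks_add:
  assumes "finite X" "x \<in> X"
  shows "num_walks X E (i + j) x y = (\<Sum>z\<in>X. num_walks X E i x z * num_walks X E j z y)"
  using assms(2)
proof (induction i arbitrary: x)
  case 0
  have "(\<Sum>z\<in>X. num_walks X E 0 x z * num_walks X E j z y)
      = (\<Sum>z\<in>X. if z = x then num_walks X E j z y else 0)"
    by (intro sum.cong) auto
  with 0 assms(1) show ?case by simp
next
  case (Suc i)
  have "num_walks X E (Suc i + j) x y
      = (\<Sum>u\<in>X. of_bool ({x, u} \<in> E) * (\<Sum>z\<in>X. num_walks X E i u z * num_walks X E j z y))"
    using Suc.IH by simp
  also have "\<dots> = (\<Sum>z\<in>X. \<Sum>u\<in>X. of_bool ({x, u} \<in> E) * (num_walks X E i u z * num_walks X E j z y))"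
    unfolding sum_distrib_left by (rule sum.swap)
  also have "\<dots> = (\<Sum>z\<in>X. num_walks X E (Suc i) x z * num_walks X E j z y)"
    by (simp add: sum_distrib_right mult.assoc)
  finally show ?case .
qed

lemma num_walks_Suc_right:
  assumes "finite X" "x \<in> X" "y \<in> X"
  shows "num_walks X E (Suc j) x y = (\<Sum>z\<in>X. num_walks X E j x z * of_bool ({z, y} \<in> E))"
proof -
  have "num_walks X E 1 z y = of_bool ({z, y} \<in> E)" for z
  proof -
    have "num_walks X E 1 z y = (\<Sum>u\<in>X. if u = y then of_bool ({z, u} \<in> E) else 0)"
      by (simp, intro sum.cong) auto
    thus ?thesis using assms by simp
  qed
  thus ?thesis
    using num_walks_add[OF assms(1,2), of E j 1 y] by simp
qed

lemma num_walks_sym: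
  assumes "finite X" "x \<in> X" "y \<in> X"
  shows "num_walks X E j x y = num_walks X E j y x"
  using assms(2,3)
proof (induction j arbitrary: x y)
  case 0
  then show ?case by auto
next
  case (Suc j)
  have "num_walks X E (Suc j) x y = (\<Sum>z\<in>X. of_bool ({x, z} \<in> E) * num_walks X E j y z)"
    using Suc by simp
  also have "\<dots> = (\<Sum>z\<in>X. num_walks X E j y z * of_bool ({z, x} \<in> E))"
    by (intro sum.cong refl) (simp add: insert_commute mult.commute)
  also have "\<dots> = num_walks X E (Suc j) y x"
    by (rule num_walks_Suc_right[symmetric]) (use assms Suc in auto)
  finally show ?case .
qed

lemma closed_walks_eq:
  assumes "finite X" "i + j = 2 * k"
  shows "closed_walks X E k = (\<Sum>x\<in>X. \<Sum>y\<in>X. num_walks X E i x y * num_walks X E j x y)"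
proof -
  have "num_walks X E (2 * k) x x = (\<Sum>y\<in>X. num_walks X E i x y * num_walks X E j x y)" if "x \<in> X" for x
    using num_walks_add[OF assms(1) that, of E i j x] num_walks_sym[OF assms(1) _ that, of _ E j] assms(2)
    by simp
  thus ?thesis unfolding closed_walks_def by simp
qed

lemma closed_walks_square:
  assumes "finite X"
  shows "closed_walks X E k = (\<Sum>x\<in>X. \<Sum>y\<in>X. (num_walks X E k x y)\<^sup>2)"
  using closed_walks_eq[OF assms, of k k k E] by (simp add: power2_eq_square mult_2)

text \<open>The trace of A^(2j+2) is the Frobenius product of A^j with A^(j+2), to which
  Cauchy--Schwarz applies.\<close>

lemma closed_walks_log_convex:
  assumes "finite X"
  shows "(closed_walks X E (Suc j))\<^sup>2 \<le> closed_walks X E j * closed_walks X E (Suc (Suc j))"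
proof -
  let ?W = "num_walks X E"
  have "closed_walks X E (Suc j) = (\<Sum>q\<in>X \<times> X. ?W j (fst q) (snd q) * ?W (Suc (Suc j)) (fst q) (snd q))"
    using closed_walks_eq[OF assms, of j "Suc (Suc j)" "Suc j" E]
    by (simp add: sum.cartesian_product case_prod_beta)
  also have "\<dots>\<^sup>2 \<le> (\<Sum>q\<in>X \<times> X. (?W j (fst q) (snd q))\<^sup>2) * (\<Sum>q\<in>X \<times> X. (?W (Suc (Suc j)) (fst q) (snd q))\<^sup>2)"
    by (rule Cauchy_Schwarz_ineq_sum)
  also have "\<dots> = closed_walks X E j * closed_walks X E (Suc (Suc j))"
    unfolding closed_walks_square[OF assms] by (simp add: sum.cartesian_product case_prod_beta)
  finally show ?thesis .
qed

lemma closed_walks_nonneg: "closed_walks X E j \<ge> 0"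
  unfolding closed_walks_def by (intro sum_nonneg) auto

text \<open>By log-convexity the ratios of consecutive values increase, so the value at j is at most
  a weighted geometric mean of those at 0 and j + 1. With j = l - 1, a lower bound on the closed
  walks of length 2l makes those of length 2l - 2 comparatively few.\<close>

lemma closed_walks_power_le:
  assumes "finite X"
  shows "closed_walks X E j ^ Suc j \<le> closed_walks X E 0 * closed_walks X E (Suc j) ^ j"
proof (induction j)
  case 0
  then show ?case by simp
next
  case (Suc j)
  let ?t = "closed_walks X E"
  show ?case
  proof (cases "?t (Suc j) = 0")
    case True
    then show ?thesis by (simp add: closed_walks_nonneg)
  next
    case False
    hence pos: "?t (Suc j) > 0" using closed_walks_nonneg[of X E "Suc j"] by linarith
    have "?t (Suc j) ^ Suc (Suc j) * ?t (Suc j) ^ j = ((?t (Suc j))\<^sup>2) ^ Suc j"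
      by (simp add: power_add[symmetric] power_mult[symmetric] mult_2)
    also have "\<dots> \<le> (?t j * ?t (Suc (Suc j))) ^ Suc j"
      by (intro power_mono closed_walks_log_convex assms) auto
    also have "\<dots> = ?t j ^ Suc j * ?t (Suc (Suc j)) ^ Suc j" by (rule power_mult_distrib)
    also have "\<dots> \<le> (?t 0 * ?t (Suc j) ^ j) * ?t (Suc (Suc j)) ^ Suc j"
      by (intro mult_right_mono Suc.IH) (simp add: closed_walks_nonneg)
    finally have "?t (Suc j) ^ Suc (Suc j) * ?t (Suc j) ^ j
        \<le> (?t 0 * ?t (Suc (Suc j)) ^ Suc j) * ?t (Suc j) ^ j" by (simp only: mult_ac)
    thus ?thesis using pos by (simp only: mult_le_cancel_right zero_less_power)
  qed
qed

text \<open>The left side counts closed walks \<open>x\<^sub>0, \<dots>, x\<^sub>2\<^sub>l = x\<^sub>0\<close> with \<open>x\<^sub>a = x\<^sub>0\<close>. Let \<open>z\<close> be the vertex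
  at position \<open>l + 1\<close>. If there are at most \<open>c\<close> times as many walks of length \<open>l\<close> from \<open>x\<^sub>1\<close> to \<open>z\<close> as walks of
  length \<open>l - 1\<close> from \<open>x\<^sub>0\<close> to \<open>z\<close>, the walk is charged to the first term. Otherwise it is charged to the
  second: the part from \<open>x\<^sub>1\<close> to \<open>z\<close> already determines \<open>x\<^sub>0 = x\<^sub>a\<close>.\<close>

lemma closed_walks_coincidence_le:
  assumes "finite X" "1 \<le> a" "a \<le> l" "c > 0" "l \<ge> 1"
    and deg: "\<And>x. x \<in> X \<Longrightarrow> (\<Sum>y\<in>X. of_bool ({x, y} \<in> E)) \<le> \<Delta>"
  shows "(\<Sum>x\<in>X. num_walks X E a x x * num_walks X E (2 * l - a) x x)
     \<le> c * \<Delta> * closed_walks X E (l - 1) + closed_walks X E l / c"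
proof -
  let ?W = "num_walks X E" and ?a = "\<lambda>x y. of_bool ({x, y} \<in> E) :: real"
  \<comment> \<open>\<open>?q x v z\<close> counts the walks of length l from v to z that are at x
    after a - 1 steps. With v = x_1 and x = x_a these are the positions 1 to l + 1 of the closed
    walk; summing over x gives all walks of length l from v to z.\<close>
  let ?q = "\<lambda>x v z. ?W (a - 1) v x * ?W (l + 1 - a) x z"
  have W: "?W l v z = (\<Sum>x\<in>X. ?q x v z)" if "v \<in> X" for v z
    using num_walks_add[OF assms(1) that, of E "a - 1" "l + 1 - a" z] assms by simp
  have qW: "?q x v z \<le> ?W l v z" if "v \<in> X" "x \<in> X" for x v z
    unfolding W[OF that(1)] using that(2) assms(1)
    by (intro member_le_sum) auto
  have termwise: "?a x v * ?q x v z * ?W (l - 1) z x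
      \<le> c * ?a x v * (?W (l - 1) x z)\<^sup>2 + ?q x v z * ?W l v z / c"
    if "x \<in> X" "v \<in> X" "z \<in> X" for x v z
  proof -
    have s: "?W (l - 1) z x = ?W (l - 1) x z" using num_walks_sym assms that by metis
    show ?thesis
    proof (cases "?W l v z \<le> c * ?W (l - 1) x z")
      case True
      have "?a x v * ?q x v z * ?W (l - 1) z x \<le> ?a x v * (c * ?W (l - 1) x z) * ?W (l - 1) z x"
        using qW[OF that(2,1), of z] True by (intro mult_right_mono mult_left_mono) auto
      also have "\<dots> = c * ?a x v * (?W (l - 1) x z)\<^sup>2" unfolding s by (simp add: power2_eq_square)
      also have "\<dots> \<le> c * ?a x v * (?W (l - 1) x z)\<^sup>2 + ?q x v z * ?W l v z / c"
        using assms(4) by auto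
      finally show ?thesis .
    next
      case False
      hence "?W (l - 1) z x \<le> ?W l v z / c" using assms(4) unfolding s by (simp add: field_simps)
      hence "?q x v z * ?W (l - 1) z x \<le> ?q x v z * (?W l v z / c)"
        by (intro mult_left_mono) auto
      moreover have "?a x v * ?q x v z * ?W (l - 1) z x \<le> ?q x v z * ?W (l - 1) z x"
        by (auto simp: of_bool_def)
      moreover have "c * ?a x v * (?W (l - 1) x z)\<^sup>2 \<ge> 0" using assms(4) by auto
      ultimately show ?thesis by (simp add: field_simps)
    qed
  qed
  have eq: "?W a x x * ?W (2 * l - a) x x = (\<Sum>v\<in>X. \<Sum>z\<in>X. ?a x v * ?q x v z * ?W (l - 1) z x)"
    if "x \<in> X" for x
  proof -
    have "?W a x x = (\<Sum>v\<in>X. ?a x v * ?W (a - 1) v x)"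
      using assms(2) by (cases a) auto
    moreover have "?W (2 * l - a) x x = (\<Sum>z\<in>X. ?W (l + 1 - a) x z * ?W (l - 1) z x)"
    proof -
      have "2 * l - a = (l + 1 - a) + (l - 1)" using assms by linarith
      thus ?thesis using num_walks_add[OF assms(1) that] by metis
    qed
    ultimately show ?thesis by (simp add: sum_product mult_ac)
  qed
  have "(\<Sum>x\<in>X. ?W a x x * ?W (2 * l - a) x x)
      = (\<Sum>x\<in>X. \<Sum>v\<in>X. \<Sum>z\<in>X. ?a x v * ?q x v z * ?W (l - 1) z x)"
    using eq by simp
  also have "\<dots> \<le> (\<Sum>x\<in>X. \<Sum>v\<in>X. \<Sum>z\<in>X. c * ?a x v * (?W (l - 1) x z)\<^sup>2 + ?q x v z * ?W l v z / c)"
    by (intro sum_mono termwise)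
  also have "\<dots> = (\<Sum>x\<in>X. \<Sum>v\<in>X. \<Sum>z\<in>X. c * ?a x v * (?W (l - 1) x z)\<^sup>2)
      + (\<Sum>x\<in>X. \<Sum>v\<in>X. \<Sum>z\<in>X. ?q x v z * ?W l v z / c)"
    by (simp add: sum.distrib)
  also have "(\<Sum>x\<in>X. \<Sum>v\<in>X. \<Sum>z\<in>X. c * ?a x v * (?W (l - 1) x z)\<^sup>2) \<le> c * \<Delta> * closed_walks X E (l - 1)"
  proof -
    have "(\<Sum>x\<in>X. \<Sum>v\<in>X. \<Sum>z\<in>X. c * ?a x v * (?W (l - 1) x z)\<^sup>2)
       = (\<Sum>x\<in>X. (\<Sum>v\<in>X. ?a x v) * (\<Sum>z\<in>X. c * (?W (l - 1) x z)\<^sup>2))"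
      by (simp add: sum_product mult_ac)
    also have "\<dots> \<le> (\<Sum>x\<in>X. \<Delta> * (\<Sum>z\<in>X. c * (?W (l - 1) x z)\<^sup>2))"
      using assms(4) by (intro sum_mono mult_right_mono deg) (auto intro!: mult_nonneg_nonneg sum_nonneg)
    also have "\<dots> = c * \<Delta> * closed_walks X E (l - 1)"
      unfolding closed_walks_square[OF assms(1)] by (simp add: sum_distrib_left mult_ac)
    finally show ?thesis .
  qed
  also have "(\<Sum>x\<in>X. \<Sum>v\<in>X. \<Sum>z\<in>X. ?q x v z * ?W l v z / c) = closed_walks X E l / c"
  proof -
    have "(\<Sum>x\<in>X. \<Sum>v\<in>X. \<Sum>z\<in>X. ?q x v z * ?W l v z / c)
        = (\<Sum>v\<in>X. \<Sum>x\<in>X. \<Sum>z\<in>X. ?q x v z * ?W l v z / c)" by (rule sum.swap)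
    also have "\<dots> = (\<Sum>v\<in>X. \<Sum>z\<in>X. \<Sum>x\<in>X. ?q x v z * ?W l v z / c)"
      by (intro sum.cong refl sum.swap)
    also have "\<dots> = (\<Sum>v\<in>X. \<Sum>z\<in>X. (?W l v z)\<^sup>2 / c)"
      by (intro sum.cong refl) (simp add: W power2_eq_square sum_distrib_right sum_divide_distrib)
    also have "\<dots> = closed_walks X E l / c"
      unfolding closed_walks_square[OF assms(1)] by (simp add: sum_divide_distrib)
    finally show ?thesis .
  qed
  finally show ?thesis by simp
qed

text \<open>Every vertex starts at least P^l walks of length l. Cauchy--Schwarz over the end points
  bounds each row of squares from below at the cost of a factor \<open>card X\<close>, which is
  regained by summing over the rows.\<close>

lemma closed_walks_ge:
  assumes "finite X" "X \<noteq> {}" "P \<ge> 0"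
    and deg: "\<And>x. x \<in> X \<Longrightarrow> (\<Sum>y\<in>X. of_bool ({x, y} \<in> E)) \<ge> P"
  shows "closed_walks X E l \<ge> P ^ (2 * l)"
proof -
  let ?W = "num_walks X E"
  have walks: "(\<Sum>y\<in>X. ?W j x y) \<ge> P ^ j" if "x \<in> X" for j x
    using that
  proof (induction j arbitrary: x)
    case 0
    then show ?case using assms(1) by (simp add: of_bool_def)
  next
    case (Suc j)
    have "P * P ^ j \<le> (\<Sum>z\<in>X. of_bool ({x, z} \<in> E)) * P ^ j"
      using deg[OF Suc.prems] assms by (intro mult_right_mono) auto
    also have "\<dots> \<le> (\<Sum>z\<in>X. of_bool ({x, z} \<in> E) * (\<Sum>y\<in>X. ?W j z y))"
      unfolding sum_distrib_right by (intro sum_mono mult_left_mono Suc.IH) auto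
    also have "\<dots> = (\<Sum>y\<in>X. ?W (Suc j) x y)"
      unfolding sum_distrib_left by (subst sum.swap) simp
    finally show ?case by simp
  qed
  have card_pos: "real (card X) > 0" using assms by (simp add: card_gt_0_iff)
  have row: "(P ^ l)\<^sup>2 / card X \<le> (\<Sum>y\<in>X. (?W l x y)\<^sup>2)" if "x \<in> X" for x
  proof -
    have "(P ^ l)\<^sup>2 \<le> (\<Sum>y\<in>X. ?W l x y * 1)\<^sup>2"
      using walks[OF that, of l] assms by (intro power_mono) auto
    also have "\<dots> \<le> (\<Sum>y\<in>X. (?W l x y)\<^sup>2) * (\<Sum>y\<in>X. 1\<^sup>2)"
      by (rule Cauchy_Schwarz_ineq_sum)
    finally show ?thesis using card_pos by (simp add: field_simps)
  qed
  have "P ^ (2 * l) = (\<Sum>x\<in>X. (P ^ l)\<^sup>2 / card X)"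
    using card_pos by (simp add: power_mult[symmetric] mult.commute)
  also have "\<dots> \<le> closed_walks X E l"
    unfolding closed_walks_square[OF assms(1)] by (intro sum_mono row)
  finally show ?thesis .
qed

section \<open>Walks as vertex lists, and the cycles among closed walks\<close>

lemma finite_walks: "finite X \<Longrightarrow> finite (walks X E j x y)"
  by (rule finite_subset[OF _ finite_lists_length_eq[of X "Suc j"]]) (auto simp: walks_def)

lemma walks_0: "x \<in> X \<Longrightarrow> walks X E 0 x y = (if x = y then {[x]} else {})"
  by (auto simp: walks_def length_Suc_conv)

lemma walks_Suc:
  assumes "x \<in> X"
  shows "walks X E (Suc j) x y = (\<Union>z\<in>{z \<in> X. {x, z} \<in> E}. (#) x ` walks X E j z y)"
proof (intro equalityI subsetI)
  fix ws assume ws: "ws \<in> walks X E (Suc j) x y"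
  then obtain us where us: "ws = x # us" "length us = Suc j"
    by (auto simp: walks_def length_Suc_conv)
  hence "us \<noteq> []" by auto
  hence "hd us \<in> set us" by simp
  with ws us \<open>us \<noteq> []\<close> have "us \<in> walks X E j (hd us) y" "{x, hd us} \<in> E" "hd us \<in> X"
    by (auto simp: walks_def successively_Cons)
  with us show "ws \<in> (\<Union>z\<in>{z \<in> X. {x, z} \<in> E}. (#) x ` walks X E j z y)" by blast
next
  fix ws assume "ws \<in> (\<Union>z\<in>{z \<in> X. {x, z} \<in> E}. (#) x ` walks X E j z y)"
  then show "ws \<in> walks X E (Suc j) x y" using assms
    by (auto simp: walks_def successively_Cons)
qed

lemma card_walks:
  assumes "finite X" "x \<in> X"
  shows "real (card (walks X E j x y)) = num_walks X E j x y"
  using assms(2)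
proof (induction j arbitrary: x)
  case 0
  then show ?case by (simp add: walks_0)
next
  case (Suc j)
  have "card (walks X E (Suc j) x y) = (\<Sum>z\<in>{z \<in> X. {x, z} \<in> E}. card ((#) x ` walks X E j z y))"
    unfolding walks_Suc[OF Suc.prems]
    by (rule card_UN_disjoint) (use assms(1) in \<open>auto simp: finite_walks, auto simp: walks_def\<close>)
  also have "\<dots> = (\<Sum>z\<in>{z \<in> X. {x, z} \<in> E}. card (walks X E j z y))"
    by (intro sum.cong refl card_image) auto
  finally have "real (card (walks X E (Suc j) x y))
      = (\<Sum>z\<in>{z \<in> X. {x, z} \<in> E}. num_walks X E j z y)"
    using Suc.IH by simp
  also have "\<dots> = (\<Sum>z\<in>X. if {x, z} \<in> E then num_walks X E j z y else 0)"
    by (rule sum.inter_filter) (rule assms)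
  also have "\<dots> = num_walks X E (Suc j) x y"
    by (auto intro!: sum.cong)
  finally show ?case .
qed

lemma walks_split:
  assumes "ws \<in> walks X E (i + j) x y"
  shows "take (Suc i) ws \<in> walks X E i x (ws ! i)" "drop i ws \<in> walks X E j (ws ! i) y"
proof -
  have len: "length ws = Suc (i + j)" and S: "set ws \<subseteq> X" "hd ws = x" "last ws = y"
    and su: "successively (\<lambda>u v. {u, v} \<in> E) ws"
    using assms by (auto simp: walks_def)
  have "successively (\<lambda>u v. {u, v} \<in> E) (take (Suc i) ws @ drop (Suc i) ws)" using su by simp
  hence su1: "successively (\<lambda>u v. {u, v} \<in> E) (take (Suc i) ws)"
    unfolding successively_append_iff by blast
  have "successively (\<lambda>u v. {u, v} \<in> E) (take i ws @ drop i ws)" using su by simp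
  hence su2: "successively (\<lambda>u v. {u, v} \<in> E) (drop i ws)"
    unfolding successively_append_iff by blast
  have "last (take (Suc i) ws) = ws ! i"
    using len by (subst last_conv_nth) (auto simp: min_def)
  moreover have "hd (take (Suc i) ws) = x"
    using S len by (cases ws) auto
  ultimately show "take (Suc i) ws \<in> walks X E i x (ws ! i)"
    using len su1 S set_take_subset[of "Suc i" ws] by (auto simp: walks_def)
  have "hd (drop i ws) = ws ! i" using len by (simp add: hd_drop_conv_nth)
  moreover have "last (drop i ws) = y" using S len by simp
  ultimately show "drop i ws \<in> walks X E j (ws ! i) y"
    using len su2 S set_drop_subset[of i ws] by (auto simp: walks_def)
qed

text \<open>The walk is cut at positions i and i + a. The middle piece is closed at the repeated
  vertex v, and the outer pieces, joined at the start vertex x, form a closed walk of length i + j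
  at v. The bound therefore depends only on the total length and on the distance a between the
  coinciding positions.\<close>

lemma card_coincident_walks_le:
  assumes "finite X"
  shows "real (card {ws \<in> (\<Union>x\<in>X. walks X E (i + a + j) x x). ws ! i = ws ! (i + a)})
    \<le> (\<Sum>v\<in>X. num_walks X E a v v * num_walks X E (i + j) v v)"
proof -
  let ?S = "{ws \<in> (\<Union>x\<in>X. walks X E (i + a + j) x x). ws ! i = ws ! (i + a)}"
  let ?g = "\<lambda>ws. (take (Suc i) ws, take (Suc a) (drop i ws), drop a (drop i ws))"
  let ?P = "\<lambda>x v. walks X E i x v \<times> walks X E a v v \<times> walks X E j v x"
  have sub: "?g ` ?S \<subseteq> (\<Union>x\<in>X. \<Union>v\<in>X. ?P x v)"
  proof
    fix t assume "t \<in> ?g ` ?S"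
    then obtain x ws where ws: "t = ?g ws" "x \<in> X" "ws \<in> walks X E (i + a + j) x x" "ws ! i = ws ! (i + a)"
      by auto
    have 1: "take (Suc i) ws \<in> walks X E i x (ws ! i)" "drop i ws \<in> walks X E (a + j) (ws ! i) x"
      using walks_split[of ws X E i "a + j" x x] ws by (auto simp: add.assoc)
    have len: "length ws = Suc (i + a + j)" using ws by (auto simp: walks_def)
    have "drop i ws ! a = ws ! i" using ws(4) len by simp
    with walks_split[OF 1(2)] have
      "take (Suc a) (drop i ws) \<in> walks X E a (ws ! i) (ws ! i)"
      "drop a (drop i ws) \<in> walks X E j (ws ! i) x" by simp_all
    moreover have "ws ! i \<in> X"
    proof -
      have "ws ! i \<in> set ws" using len by simp
      thus ?thesis using ws by (auto simp: walks_def)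
    qed
    ultimately show "t \<in> (\<Union>x\<in>X. \<Union>v\<in>X. ?P x v)" using 1 ws by blast
  qed
  have inj: "inj_on ?g ?S"
  proof (rule inj_onI)
    fix u w assume uw: "u \<in> ?S" "w \<in> ?S" "?g u = ?g w"
    have "take (Suc i) u = take (Suc i) w" using uw(3) by simp
    hence "take i (take (Suc i) u) = take i (take (Suc i) w)" by simp
    hence "take i u = take i w" by (simp add: min_def)
    moreover have "drop i u = drop i w"
    proof -
      have "take (Suc a) (drop i u) = take (Suc a) (drop i w)" using uw(3) by simp
      hence "take a (take (Suc a) (drop i u)) = take a (take (Suc a) (drop i w))" by simp
      hence "take a (drop i u) = take a (drop i w)" by (simp add: min_def)
      moreover have "drop a (drop i u) = drop a (drop i w)" using uw(3) by simp
      ultimately show ?thesis by (metis append_take_drop_id)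
    qed
    ultimately show "u = w" by (metis append_take_drop_id)
  qed
  have fin: "finite (\<Union>x\<in>X. \<Union>v\<in>X. ?P x v)" using assms by (auto intro!: finite_walks)
  have "card ?S = card (?g ` ?S)" by (rule card_image[OF inj, symmetric])
  also have "\<dots> \<le> card (\<Union>x\<in>X. \<Union>v\<in>X. ?P x v)" by (rule card_mono[OF fin sub])
  also have "\<dots> \<le> (\<Sum>x\<in>X. card (\<Union>v\<in>X. ?P x v))" by (rule card_UN_le[OF assms])
  also have "\<dots> \<le> (\<Sum>x\<in>X. \<Sum>v\<in>X. card (?P x v))"
    by (intro sum_mono card_UN_le[OF assms])
  finally have "real (card ?S) \<le> real (\<Sum>x\<in>X. \<Sum>v\<in>X. card (?P x v))" by linarith
  also have "\<dots> = (\<Sum>x\<in>X. \<Sum>v\<in>X. num_walks X E i x v * (num_walks X E a v v * num_walks X E j v x))"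
    using card_walks[OF assms] by (simp add: card_cartesian_product)
  also have "\<dots> = (\<Sum>v\<in>X. num_walks X E a v v * (\<Sum>x\<in>X. num_walks X E j v x * num_walks X E i x v))"
    by (subst sum.swap) (simp add: sum_distrib_left mult_ac)
  also have "\<dots> = (\<Sum>v\<in>X. num_walks X E a v v * num_walks X E (i + j) v v)"
    using num_walks_add[OF assms, of _ E j i] by (simp add: add.commute)
  finally show ?thesis .
qed

text \<open>The list is cyclic and, unlike a closed walk, does not repeat its first vertex at the
  end. Indices modulo the length match the edges of \<open>cycle_graph\<close>.\<close>

definition cycle_edges :: "'a list \<Rightarrow> 'a set set" where
  "cycle_edges xs = {{xs ! i, xs ! (Suc i mod length xs)} | i. i < length xs}"

lemma closed_walk_cycle:
  assumes "ws \<in> walks X E m x x" "m > 0" "\<And>i j. i < j \<Longrightarrow> j < m \<Longrightarrow> ws ! i \<noteq> ws ! j"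
  shows "distinct (butlast ws)" "length (butlast ws) = m" "set (butlast ws) \<subseteq> X"
    "cycle_edges (butlast ws) \<subseteq> E" "ws = butlast ws @ [hd (butlast ws)]"
proof -
  let ?xs = "butlast ws"
  have len: "length ws = Suc m" and S: "set ws \<subseteq> X" "hd ws = x" "last ws = x"
    and su: "successively (\<lambda>u v. {u, v} \<in> E) ws"
    using assms by (auto simp: walks_def)
  show l: "length ?xs = m" using len by simp
  have nth: "?xs ! i = ws ! i" if "i < m" for i using that len by (simp add: nth_butlast)
  show "distinct ?xs" unfolding distinct_conv_nth l using assms(3) nth
    by (metis linorder_neqE_nat)
  show "set ?xs \<subseteq> X" using S by (meson in_set_butlastD subset_iff)
  have "ws \<noteq> []" using len by auto
  have h: "hd ?xs = x" using S nth[of 0] len assms(2) l by (metis hd_conv_nth length_greater_0_conv \<open>ws \<noteq> []\<close>)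
  show app: "ws = ?xs @ [hd ?xs]" using S h \<open>ws \<noteq> []\<close> by (metis append_butlast_last_id)
  show "cycle_edges ?xs \<subseteq> E"
  proof
    fix e assume "e \<in> cycle_edges ?xs"
    then obtain i where i: "i < m" "e = {?xs ! i, ?xs ! (Suc i mod m)}"
      by (auto simp: cycle_edges_def len)
    have "?xs ! (Suc i mod m) = ws ! Suc i"
    proof (cases "Suc i = m")
      case True
      have "ws ! m = x" using S len \<open>ws \<noteq> []\<close> by (simp add: last_conv_nth)
      moreover have "?xs ! 0 = x" using h l assms(2) by (metis hd_conv_nth length_greater_0_conv)
      ultimately show ?thesis using True by simp
    next
      case False
      thus ?thesis using i nth[of "Suc i"] by simp
    qed
    moreover have "{ws ! i, ws ! Suc i} \<in> E"
      using su len i by (simp add: successively_conv_nth)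
    ultimately show "e \<in> E" using i nth by simp
  qed
qed

text \<open>A closed walk of length 2l without coincidence among its first 2l positions is a cycle.
  There are at most (2l)^2 pairs of positions, and each pair spoils at most the fraction 1/(2
  (2l)^2) of all closed walks, so half of them survive. In \<open>small\<close>, P^2 is required to
  exceed a constant times \<Delta> by the factor |X|^(1/l); this makes \<Delta> times the number of
  closed walks of length 2l - 2 negligible.\<close>

lemma num_cycles_ge:
  fixes P \<Delta> :: real
  assumes "finite X" "X \<noteq> {}" "l \<ge> 1" "P > 0"
    and lower: "\<And>x. x \<in> X \<Longrightarrow> P \<le> card {y \<in> X. {x, y} \<in> E}"
    and upper: "\<And>x. x \<in> X \<Longrightarrow> card {y \<in> X. {x, y} \<in> E} \<le> \<Delta>"
    and small: "(16 * (2 * real l) ^ 4 * \<Delta>) ^ l * card X \<le> P ^ (2 * l)"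
  shows "P ^ (2 * l) / 2
    \<le> card {xs. distinct xs \<and> length xs = 2 * l \<and> set xs \<subseteq> X \<and> cycle_edges xs \<subseteq> E}"
proof -
  let ?C = "{xs. distinct xs \<and> length xs = 2 * l \<and> set xs \<subseteq> X \<and> cycle_edges xs \<subseteq> E}"
  let ?A = "\<Union>x\<in>X. walks X E (2 * l) x x"
  let ?I = "{(i, j). i < j \<and> j < 2 * l}"
  let ?B = "\<lambda>q. {ws \<in> ?A. ws ! fst q = ws ! snd q}"
  let ?t = "closed_walks X E"
  \<comment> \<open>With this c the second term of \<open>closed_walks_coincidence_le\<close> is
    \<open>?t l\<close> divided by 4 (2l)^2, and \<open>t'\<close> below brings the first term under
    the same bound.\<close>
  define c where "c = 4 * (2 * real l)\<^sup>2"
  have c: "c > 0" using assms(3) by (simp add: c_def)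
  have deg: "(\<Sum>y\<in>X. of_bool ({x, y} \<in> E)) = real (card {y \<in> X. {x, y} \<in> E})" for x
    using assms(1) by (simp add: of_bool_def sum.If_cases Int_def)
  have finA: "finite ?A" using assms(1) by (auto intro: finite_walks)
  have t: "?t l \<ge> P ^ (2 * l)"
    using closed_walks_ge[OF assms(1,2), of P E l] lower assms(4) by (simp add: deg)
  hence tpos: "?t l > 0" using assms(4) zero_less_power[of P "2 * l"] by linarith
  have \<Delta>: "\<Delta> > 0"
  proof -
    obtain x where "x \<in> X" using assms(2) by blast
    with lower[of x] upper[of x] assms(4) show ?thesis by linarith
  qed
  have cardA: "real (card ?A) = ?t l"
  proof -
    have "card ?A = (\<Sum>x\<in>X. card (walks X E (2 * l) x x))"
      by (rule card_UN_disjoint) (use assms(1) in \<open>auto simp: finite_walks, auto simp: walks_def\<close>)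
    thus ?thesis using card_walks[OF assms(1)] by (simp add: closed_walks_def)
  qed
  \<comment> \<open>In l-th powers, log-convexity gives (d t_(l-1))^l <= d^l t_0 t_l^(l-1). Here t_0
    is \<open>card X\<close>, and \<open>small\<close> bounds d^l t_0 by P^(2l), hence by
    t_l.\<close>
  have t': "4 * (2 * real l)\<^sup>2 * c * \<Delta> * ?t (l - 1) \<le> ?t l"
  proof -
    let ?d = "4 * (2 * real l)\<^sup>2 * c * \<Delta>"
    have d: "?d = 16 * (2 * real l) ^ 4 * \<Delta>" unfolding c_def by (simp add: power2_eq_square power4_eq_xxxx)
    have t0: "?t 0 = card X" by (simp add: closed_walks_def)
    have "(?d * ?t (l - 1)) ^ l = ?d ^ l * ?t (l - 1) ^ Suc (l - 1)"
      using assms(3) by (simp add: power_mult_distrib)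
    also have "\<dots> \<le> ?d ^ l * (?t 0 * ?t (Suc (l - 1)) ^ (l - 1))"
      using closed_walks_power_le[OF assms(1), of E "l - 1"] c \<Delta> by (intro mult_left_mono) auto
    also have "\<dots> = (?d ^ l * card X) * ?t l ^ (l - 1)" using assms(3) by (simp add: t0)
    also have "\<dots> \<le> P ^ (2 * l) * ?t l ^ (l - 1)"
      using small tpos unfolding d by (intro mult_right_mono) auto
    also have "\<dots> \<le> ?t l * ?t l ^ (l - 1)" using t tpos by (intro mult_right_mono) auto
    also have "\<dots> = ?t l ^ l" using assms(3) by (metis Suc_diff_1 less_eq_Suc_le One_nat_def power_Suc)
    finally show ?thesis
      using assms(3) tpos by (subst (asm) power_mono_iff) (auto simp: closed_walks_nonneg c \<Delta> less_imp_le)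
  qed
  have B: "real (card (?B q)) \<le> ?t l / (2 * (2 * real l)\<^sup>2)" if "q \<in> ?I" for q
  proof -
    obtain i j where q: "q = (i, j)" "i < j" "j < 2 * l" using \<open>q \<in> ?I\<close> by auto
    define a where "a = j - i"
    have *: "i + a + (2 * l - j) = 2 * l" "i + a = j" "i + (2 * l - j) = 2 * l - a" "a \<ge> 1" "a < 2 * l"
      using q by (auto simp: a_def)
    have "real (card (?B q)) \<le> (\<Sum>v\<in>X. num_walks X E a v v * num_walks X E (2 * l - a) v v)"
      using card_coincident_walks_le[OF assms(1), of E i a "2 * l - j"] q * by simp
    also have "\<dots> \<le> c * \<Delta> * ?t (l - 1) + ?t l / c"
    \<comment> \<open>The product is symmetric under exchanging a with 2l - a, so the shorter of the
      two closed parts may be taken.\<close>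
    proof (cases "a \<le> l")
      case True
      show ?thesis
        using closed_walks_coincidence_le[OF assms(1) _ True c assms(3), of E \<Delta>] * upper
        by (simp add: deg)
    next
      case False
      have "2 * l - (2 * l - a) = a" using * by simp
      thus ?thesis
        using closed_walks_coincidence_le[OF assms(1) _ _ c assms(3), of "2 * l - a" E \<Delta>] * upper False
        by (simp add: deg mult.commute)
    qed
    also have "\<dots> \<le> ?t l / (4 * (2 * real l)\<^sup>2) + ?t l / (4 * (2 * real l)\<^sup>2)"
      using t' assms(3) by (intro add_mono) (auto simp: c_def field_simps)
    also have "\<dots> = ?t l / (2 * (2 * real l)\<^sup>2)" by (simp add: field_simps)
    finally show ?thesis .
  qed
  have sub: "butlast ` (?A - (\<Union>q\<in>?I. ?B q)) \<subseteq> ?C"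
  proof
    fix xs assume "xs \<in> butlast ` (?A - (\<Union>q\<in>?I. ?B q))"
    then obtain ws x where ws: "xs = butlast ws" "ws \<in> walks X E (2 * l) x x" "x \<in> X" "ws \<notin> (\<Union>q\<in>?I. ?B q)"
      by auto
    have "ws ! i \<noteq> ws ! j" if "i < j" "j < 2 * l" for i j using ws that by fastforce
    from closed_walk_cycle[OF ws(2) _ this] assms(3) ws(1) show "xs \<in> ?C" by auto
  qed
  have inj: "inj_on butlast (?A - (\<Union>q\<in>?I. ?B q))"
  proof (rule inj_onI)
    fix u w assume uw: "u \<in> ?A - (\<Union>q\<in>?I. ?B q)" "w \<in> ?A - (\<Union>q\<in>?I. ?B q)" "butlast u = butlast w"
    have *: "ws = butlast ws @ [hd (butlast ws)]" if "ws \<in> ?A - (\<Union>q\<in>?I. ?B q)" for ws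
    proof -
      obtain x where x: "ws \<in> walks X E (2 * l) x x" using \<open>ws \<in> ?A - _\<close> by auto
      have "ws ! i \<noteq> ws ! j" if "i < j" "j < 2 * l" for i j
        using \<open>ws \<in> ?A - _\<close> that by fastforce
      from closed_walk_cycle(5)[OF x _ this] assms(3) show ?thesis by auto
    qed
    show "u = w" using *[OF uw(1)] *[OF uw(2)] uw(3) by metis
  qed
  have finC: "finite ?C"
    by (rule finite_subset[OF _ finite_lists_length_eq[OF assms(1), of "2 * l"]]) auto
  have finI: "finite ?I" by (rule finite_subset[of _ "{..<2*l} \<times> {..<2*l}"]) auto
  have cardI: "card ?I \<le> (2 * l)\<^sup>2"
  proof -
    have "?I \<subseteq> {..<2*l} \<times> {..<2*l}" by auto
    from card_mono[OF _ this] show ?thesis by (simp add: power2_eq_square)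
  qed
  have "card ?A = card ((?A - (\<Union>q\<in>?I. ?B q)) \<union> (\<Union>q\<in>?I. ?B q))"
    by (rule arg_cong[where f = card]) blast
  also have "\<dots> \<le> card (?A - (\<Union>q\<in>?I. ?B q)) + card (\<Union>q\<in>?I. ?B q)" by (rule card_Un_le)
  also have "card (?A - (\<Union>q\<in>?I. ?B q)) = card (butlast ` (?A - (\<Union>q\<in>?I. ?B q)))"
    using card_image[OF inj] by simp
  also have "\<dots> \<le> card ?C" by (rule card_mono[OF finC sub])
  also have "card (\<Union>q\<in>?I. ?B q) \<le> (\<Sum>q\<in>?I. card (?B q))" by (rule card_UN_le[OF finI])
  finally have "?t l \<le> real (card ?C) + (\<Sum>q\<in>?I. real (card (?B q)))"
    unfolding cardA[symmetric] by (simp only: of_nat_sum[symmetric] of_nat_add[symmetric] of_nat_le_iff)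
  also have "(\<Sum>q\<in>?I. real (card (?B q))) \<le> (\<Sum>q\<in>?I. ?t l / (2 * (2 * real l)\<^sup>2))"
    by (intro sum_mono B)
  also have "\<dots> = card ?I * (?t l / (2 * (2 * real l)\<^sup>2))" by simp
  also have "\<dots> \<le> ((2 * l)\<^sup>2)  * (?t l / (2 * (2 * real l)\<^sup>2))"
    using cardI tpos by (intro mult_right_mono) (auto simp del: of_nat_power)
  also have "\<dots> = ?t l / 2" using assms(3) by (simp add: field_simps)
  finally show ?thesis using t by simp
qed

section \<open>Almost regular subgraphs\<close>

text \<open>Ordered pairs are counted, so the two sets may overlap, the count is additive in each of
  them, and in a loopless graph \<open>adj E W W\<close> is twice the number of edges inside
  W.\<close>

definition adj :: "'a set set \<Rightarrow> 'a set \<Rightarrow> 'a set \<Rightarrow> real" where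
  "adj E X Y = (\<Sum>x\<in>X. \<Sum>y\<in>Y. of_bool ({x, y} \<in> E))"

lemma adj_nonneg: "adj E X Y \<ge> 0"
  unfolding adj_def by (intro sum_nonneg) auto

lemma adj_commute: "adj E X Y = adj E Y X"
  unfolding adj_def by (subst sum.swap) (simp add: insert_commute)

lemma adj_mono: "finite X' \<Longrightarrow> finite Y' \<Longrightarrow> X \<subseteq> X' \<Longrightarrow> Y \<subseteq> Y' \<Longrightarrow> adj E X Y \<le> adj E X' Y'"
  unfolding adj_def
  by (rule order_trans[OF sum_mono[OF sum_mono2] sum_mono2]) (auto intro!: sum_nonneg)

lemma adj_diff_left: "finite X \<Longrightarrow> Z \<subseteq> X \<Longrightarrow> adj E (X - Z) Y = adj E X Y - adj E Z Y"
  unfolding adj_def by (rule sum_diff)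

lemma adj_diff_right: "finite Y \<Longrightarrow> Z \<subseteq> Y \<Longrightarrow> adj E X (Y - Z) = adj E X Y - adj E X Z"
  using adj_diff_left[of Y Z E X] by (simp add: adj_commute)

lemma adj_singleton: "finite Y \<Longrightarrow> adj E {x} Y = card {y \<in> Y. {x, y} \<in> E}"
  by (simp add: adj_def of_bool_def sum.If_cases Int_def)

lemma adj_eq_sum_left: "adj E X Y = (\<Sum>x\<in>X. adj E {x} Y)"
  by (simp add: adj_def)

lemma exists_max_on_finite:
  fixes f :: "'b \<Rightarrow> real"
  assumes "finite S" "S \<noteq> {}"
  obtains x where "x \<in> S" "\<And>y. y \<in> S \<Longrightarrow> f y \<le> f x"
proof -
  have "Max (f ` S) \<in> f ` S" using assms by (intro Max_in) auto
  then obtain x where "x \<in> S" "f x = Max (f ` S)" by auto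
  with assms that show ?thesis by auto
qed

text \<open>Removing an element of smallest value never lowers the average, so repeated removal down
  to size a yields the subset.\<close>

lemma exists_subset_above_average:
  fixes g :: "'b \<Rightarrow> real"
  assumes "finite W" "a \<le> card W"
  shows "\<exists>P\<subseteq>W. card P = a \<and> real a * sum g W \<le> real (card W) * sum g P"
  using assms
proof (induction "card W" arbitrary: W)
  case 0
  then show ?case by (intro exI[of _ "{}"]) auto
next
  case (Suc n)
  show ?case
  proof (cases "a = Suc n")
    case True
    thus ?thesis using Suc.hyps by (intro exI[of _ W]) auto
  next
    case False
    have "W \<noteq> {}" using Suc.hyps by auto
    then obtain v where v: "v \<in> W" "\<And>y. y \<in> W \<Longrightarrow> - g y \<le> - g v"
      using exists_max_on_finite[OF Suc.prems(1), of "\<lambda>x. - g x"] by blast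
    have n: "n = card (W - {v})" using Suc v by simp
    moreover have "a \<le> n" using False Suc by simp
    ultimately obtain P where P: "P \<subseteq> W - {v}" "card P = a" "real a * sum g (W - {v}) \<le> n * sum g P"
      using Suc.hyps(1)[of "W - {v}"] Suc.prems(1) by auto
    have rest: "sum g (W - {v}) = sum g W - g v" using v Suc.prems by (simp add: sum_diff1)
    have "real (card P) * g v \<le> sum g P"
      using v(2) P(1) sum_mono[of P "\<lambda>_. g v" g] by auto
    hence "real a * g v \<le> sum g P" using P by simp
    moreover have "real a * sum g W = real a * sum g (W - {v}) + real a * g v"
      unfolding rest by (simp add: algebra_simps)
    ultimately have "real a * sum g W \<le> real n * sum g P + sum g P" using P(3) by linarith
    also have "\<dots> = real (card W) * sum g P" using Suc.hyps(2) by (metis of_nat_Suc distrib_right mult_1 add.commute)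
    finally show ?thesis using P by blast
  qed
qed

text \<open>The induced subgraph \<open>W\<close> maximizing \<open>adj E W W / |W|\<^bsup>1 + \<eta>\<^esup>\<close> cannot have many edges at its set \<open>B\<close> of
  vertices of large degree: adding to \<open>B\<close> the \<open>|B|\<close> best neighbours would give a denser subgraph.\<close>

lemma almost_regular_subgraph:
  assumes "finite V" "V \<noteq> {}" "0 < \<eta>" "\<eta> \<le> 1" and loopless: "\<And>x. {x} \<notin> E" and pos: "adj E V V > 0"
  obtains X P M where "X \<subseteq> V" "X \<noteq> {}" "P > 0" "card X \<le> M" "M \<le> card V" "M > 0"
    "\<And>x. x \<in> X \<Longrightarrow> P \<le> adj E {x} X" "\<And>x. x \<in> X \<Longrightarrow> adj E {x} X \<le> 16 * 16 powr (1 / \<eta>) * P"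
    "adj E V V * real M powr \<eta> \<le> 8 * real (card V) powr (1 + \<eta>) * P"
proof -
  let ?f = "\<lambda>W. adj E W W / real (card W) powr (1 + \<eta>)"
  have "finite (Pow V - {{}})" "Pow V - {{}} \<noteq> {}" using assms by auto
  from exists_max_on_finite[OF this, of ?f]
  obtain W where W: "W \<subseteq> V" "W \<noteq> {}" and Wmax: "\<And>Y. Y \<subseteq> V \<Longrightarrow> Y \<noteq> {} \<Longrightarrow> ?f Y \<le> ?f W"
    by (metis DiffE DiffI Pow_iff empty_iff insert_iff)
  define M where "M = card W"
  \<comment> \<open>Chosen so that (2/K)^\<eta> = 1/16, on which the estimate \<open>Z\<close>
    rests. A degree in W is large if it exceeds K times the average e/M.\<close>
  define K where "K = 2 * 16 powr (1 / \<eta>)"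
  define e where "e = adj E W W"
  have K: "K > 0" by (simp add: K_def)
  have finW: "finite W" using W assms finite_subset by blast
  have M: "M > 0" using W finW by (simp add: M_def card_gt_0_iff)
  have cV: "card V > 0" using assms by (simp add: card_gt_0_iff)
  have fW: "adj E V V / real (card V) powr (1 + \<eta>) \<le> e / real M powr (1 + \<eta>)"
    using Wmax[of V] assms by (simp add: e_def M_def)
  moreover have "adj E V V / real (card V) powr (1 + \<eta>) > 0" using pos cV by simp
  ultimately have "e / real M powr (1 + \<eta>) > 0" by linarith
  hence e: "e > 0" using M by (simp add: zero_less_divide_iff)
  have emax: "adj E Y Y \<le> e * (r / M) powr (1 + \<eta>)" if "Y \<subseteq> V" "Y \<noteq> {}" "card Y \<le> r" for Y and r :: real
  proof -
    have "finite Y" using that assms finite_subset by blast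
    hence c: "card Y > 0" using that by (simp add: card_gt_0_iff)
    have "adj E Y Y \<le> e / real M powr (1 + \<eta>) * real (card Y) powr (1 + \<eta>)"
      using Wmax[OF that(1,2)] c M by (simp add: e_def M_def field_simps)
    also have "\<dots> \<le> e / real M powr (1 + \<eta>) * r powr (1 + \<eta>)"
      using that(3) e assms by (intro mult_left_mono powr_mono2) auto
    also have "\<dots> = e * (r / M) powr (1 + \<eta>)"
      using that(3) c M by (subst powr_divide) auto
    finally show ?thesis .
  qed
  define B where "B = {v \<in> W. adj E {v} W > K * e / M}"
  have B: "B \<subseteq> W" "finite B" using finW by (auto simp: B_def)
  have cB: "card B \<le> M / K"
  proof -
    have "card B * (K * e / M) \<le> (\<Sum>v\<in>B. adj E {v} W)"
      using sum_mono[of B "\<lambda>_. K * e / M" "\<lambda>v. adj E {v} W"] by (auto simp: B_def)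
    also have "\<dots> \<le> e" unfolding e_def adj_eq_sum_left[symmetric] using B finW
      by (intro adj_mono) auto
    finally show ?thesis using e M K by (simp add: field_simps)
  qed
  \<comment> \<open>P consists of a = |B| vertices of W with at least average adjacency to B, so it
    receives at least the share a/M of the pairs between W and B. But B and P together have at most
    2a vertices, and maximality of W allows them only e (2a/M)^(1+\<eta>) pairs.\<close>
  have Z: "adj E B W \<le> e / 8"
  proof (cases "B = {}")
    case True
    then show ?thesis using e by (simp add: adj_def)
  next
    case False
    define a where "a = card B"
    have a: "a > 0" using False B by (simp add: a_def card_gt_0_iff)
    have "a \<le> card W" unfolding a_def using B finW by (intro card_mono) auto
    then obtain P where P: "P \<subseteq> W" "card P = a"
      "real a * (\<Sum>v\<in>W. adj E {v} B) \<le> real M * (\<Sum>v\<in>P. adj E {v} B)"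
      using exists_subset_above_average[OF finW, of a "\<lambda>v. adj E {v} B"] unfolding M_def by blast
    have "real a * adj E B W \<le> real M * adj E P B"
      using P(3) unfolding adj_eq_sum_left[symmetric] by (simp add: adj_commute)
    also have "\<dots> \<le> M * adj E (B \<union> P) (B \<union> P)"
      using finite_subset[OF P(1) finW] B by (intro mult_left_mono adj_mono) auto
    also have "\<dots> \<le> M * (e * (2 * real a / M) powr (1 + \<eta>))"
    proof (intro mult_left_mono emax)
      show "real (card (B \<union> P)) \<le> 2 * real a" using card_Un_le[of B P] P(2) by (simp add: a_def)
    qed (use B P W False in auto)
    also have "(2 * real a / M) powr (1 + \<eta>) = (2 * real a / M) * (2 * real a / M) powr \<eta>"
      using a M by (simp add: powr_add)
    also have "(2 * real a / M) powr \<eta> \<le> (2 / K) powr \<eta>"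
      using cB assms M K unfolding a_def[symmetric] by (intro powr_mono2) (auto simp: field_simps)
    also have "(2 / K) powr \<eta> = 1 / 16"
    proof -
      have "2 / K = 1 / 16 powr (1 / \<eta>)" by (simp add: K_def)
      thus ?thesis using assms by (simp add: powr_divide powr_powr)
    qed
    finally have "real a * adj E B W \<le> real a * (e / 8)" using M e a by (simp add: field_simps mult_left_mono)
    thus ?thesis using a by simp
  qed
  define U where "U = W - B"
  have eU: "adj E U U \<ge> 3 / 4 * e"
  proof -
    have "adj E U U = adj E W W - adj E B W - adj E U B"
      unfolding U_def using B finW by (simp add: adj_diff_left adj_diff_right)
    moreover have "adj E U B \<le> adj E W B" using B finW by (intro adj_mono) (auto simp: U_def)
    moreover have "adj E W B = adj E B W" by (rule adj_commute)
    ultimately show ?thesis using Z unfolding e_def by simp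
  qed
  \<comment> \<open>Each vertex is penalized by e/(4M). Deleting a vertex loses twice its degree, so
    in a maximizer every degree is at least e/(8M), which will be P. The total penalty is at most
    e/4, so the maximizer is nonempty.\<close>
  let ?g = "\<lambda>X. adj E X X - e / (4 * M) * card X"
  have finU: "finite U" using finW by (simp add: U_def)
  have "finite (Pow U)" "Pow U \<noteq> {}" using finU by auto
  from exists_max_on_finite[OF this, of ?g] obtain X where X: "X \<subseteq> U" "\<And>Y. Y \<subseteq> U \<Longrightarrow> ?g Y \<le> ?g X"
    by (metis Pow_iff)
  have finX: "finite X" using X finU finite_subset by blast
  have XW: "X \<subseteq> W" using X by (auto simp: U_def)
  have "e / (4 * M) * card U \<le> e / 4"
  proof -
    have "card U \<le> M" unfolding M_def U_def using finW by (intro card_mono) auto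
    thus ?thesis using M e by (simp add: field_simps)
  qed
  hence "?g X > 0" using X(2)[of U] eU e by simp
  hence "X \<noteq> {}" by (auto simp: adj_def)
  define P where "P = e / (8 * M)"
  show ?thesis
  proof
    show "X \<subseteq> V" using XW W by auto
    show "X \<noteq> {}" by fact
    show "P > 0" using e M by (simp add: P_def)
    show "card X \<le> M" unfolding M_def using XW finW by (rule card_mono[rotated])
    show "M > 0" by fact
    show "M \<le> card V" unfolding M_def using W assms by (intro card_mono) auto
  next
    fix x assume x: "x \<in> X"
    have "?g (X - {x}) \<le> ?g X" by (rule X(2)) (use X(1) in auto)
    moreover have "adj E (X - {x}) (X - {x}) = adj E X X - 2 * adj E {x} X"
    proof -
      have "adj E {x} {x} = 0" using loopless[of x] by (simp add: adj_def)
      thus ?thesis using x finX by (simp add: adj_diff_left adj_diff_right adj_commute[of E X "{x}"])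
    qed
    moreover have "real (card (X - {x})) = real (card X) - 1"
      using card_Suc_Diff1[OF finX x] by linarith
    ultimately have "e / (4 * M) \<le> 2 * adj E {x} X" by (simp add: right_diff_distrib)
    thus "P \<le> adj E {x} X" by (simp add: P_def)
    have "adj E {x} X \<le> adj E {x} W" using XW finW by (intro adj_mono) auto
    also have "\<dots> \<le> K * e / M" using x X by (auto simp: U_def B_def)
    also have "\<dots> = 16 * 16 powr (1 / \<eta>) * P" by (simp add: K_def P_def)
    finally show "adj E {x} X \<le> 16 * 16 powr (1 / \<eta>) * P" .
  next
    have "adj E V V * real M powr (1 + \<eta>) \<le> e * real (card V) powr (1 + \<eta>)"
      using fW M cV by (simp add: field_simps)
    moreover have "real M powr (1 + \<eta>) = M * real M powr \<eta>" using M by (simp add: powr_add)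
    ultimately have "M * (adj E V V * real M powr \<eta>) \<le> M * (8 * real (card V) powr (1 + \<eta>) * P)"
      using M by (simp add: P_def mult_ac)
    thus "adj E V V * real M powr \<eta> \<le> 8 * real (card V) powr (1 + \<eta>) * P" using M by simp
  qed
qed

section \<open>Balanced supersaturation\<close>

text \<open>Cycles are represented by edge sets because they become hyperedges on the vertex set E;
  the many lists tracing the same cycle are identified.\<close>

definition cycles_in :: "nat \<Rightarrow> 'a set \<Rightarrow> 'a set set \<Rightarrow> 'a set set set" where
  "cycles_in l V E = {cycle_edges xs | xs. distinct xs \<and> length xs = 2 * l \<and> set xs \<subseteq> V \<and> cycle_edges xs \<subseteq> E}"

lemma cycles_in_mono: "V \<subseteq> V' \<Longrightarrow> E \<subseteq> E' \<Longrightarrow> cycles_in l V E \<subseteq> cycles_in l V' E'"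
  unfolding cycles_in_def by blast

lemma cycles_in_subset_Pow: "cycles_in l V E \<subseteq> Pow E"
  unfolding cycles_in_def by blast

lemma finite_cycles_in: "finite E \<Longrightarrow> finite (cycles_in l V E)"
  by (rule finite_subset[OF cycles_in_subset_Pow]) simp

lemma Union_cycle_edges: "\<Union> (cycle_edges xs) = set xs"
proof
  show "\<Union> (cycle_edges xs) \<subseteq> set xs"
  proof
    fix v assume "v \<in> \<Union> (cycle_edges xs)"
    then obtain i where "i < length xs" "v = xs ! i \<or> v = xs ! (Suc i mod length xs)"
      unfolding cycle_edges_def by auto
    moreover from this have "Suc i mod length xs < length xs" by (intro mod_less_divisor) auto
    ultimately show "v \<in> set xs" by auto
  qed
  show "set xs \<subseteq> \<Union> (cycle_edges xs)"
  proof
    fix v assume "v \<in> set xs"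
    then obtain i where "i < length xs" "v = xs ! i" by (auto simp: in_set_conv_nth)
    hence "{xs ! i, xs ! (Suc i mod length xs)} \<in> cycle_edges xs" "v \<in> {xs ! i, xs ! (Suc i mod length xs)}"
      unfolding cycle_edges_def by blast+
    thus "v \<in> \<Union> (cycle_edges xs)" by (rule UnionI)
  qed
qed

lemma adj_eq_card:
  assumes "finite X" "finite Y"
  shows "adj E X Y = card {q \<in> X \<times> Y. {fst q, snd q} \<in> E}"
proof -
  have "adj E X Y = (\<Sum>q\<in>X \<times> Y. of_bool ({fst q, snd q} \<in> E))"
    unfolding adj_def by (simp add: sum.cartesian_product case_prod_beta)
  also have "\<dots> = card {q \<in> X \<times> Y. {fst q, snd q} \<in> E}"
    using assms by (simp add: of_bool_def sum.If_cases Int_def)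
  finally show ?thesis .
qed

lemma card_edges_le_adj:
  assumes "finite V" "E \<subseteq> all_edges V"
  shows "real (card E) \<le> adj E V V"
proof -
  let ?D = "{q \<in> V \<times> V. {fst q, snd q} \<in> E}"
  have fin: "finite ?D" using assms by auto
  have "E \<subseteq> (\<lambda>q. {fst q, snd q}) ` ?D"
  proof
    fix e assume e: "e \<in> E"
    then obtain x y where "e = {x, y}" "x \<in> V" "y \<in> V"
      using assms(2) unfolding all_edges_def by (force simp: card_2_iff)
    with e have "(x, y) \<in> ?D" "e = (\<lambda>q. {fst q, snd q}) (x, y)" by auto
    thus "e \<in> (\<lambda>q. {fst q, snd q}) ` ?D" by (rule rev_image_eqI)
  qed
  hence "card E \<le> card ?D" using surj_card_le[OF fin] by blast
  thus ?thesis using adj_eq_card[OF assms(1) assms(1)] by simp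
qed

lemma finite_all_edges: "finite V \<Longrightarrow> finite (all_edges V)"
  unfolding all_edges_def by (rule finite_subset[of _ "Pow V"]) auto

text \<open>The edge set of a cycle determines its 2l vertices, and only (2l)^(2l) lists of length
  2l can be written with these.\<close>

lemma card_cycle_lists_le:
  assumes "finite V" "finite E"
  shows "card {xs. distinct xs \<and> length xs = 2 * l \<and> set xs \<subseteq> V \<and> cycle_edges xs \<subseteq> E}
    \<le> (2 * l) ^ (2 * l) * card (cycles_in l V E)"
proof -
  let ?L = "{xs. distinct xs \<and> length xs = 2 * l \<and> set xs \<subseteq> V \<and> cycle_edges xs \<subseteq> E}"
  let ?l = "\<lambda>S. {xs. set xs \<subseteq> \<Union>S \<and> length xs = 2 * l}"
  have S: "finite (\<Union>S) \<and> card (\<Union>S) = 2 * l" if "S \<in> cycles_in l V E" for S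
    using that unfolding cycles_in_def by (auto simp: Union_cycle_edges distinct_card)
  have sub: "?L \<subseteq> (\<Union>S\<in>cycles_in l V E. ?l S)"
    unfolding cycles_in_def using Union_cycle_edges by fastforce
  have "card ?L \<le> card (\<Union>S\<in>cycles_in l V E. ?l S)"
    using sub S finite_cycles_in[OF assms(2)] by (intro card_mono) (auto intro!: finite_lists_length_eq)
  also have "\<dots> \<le> (\<Sum>S\<in>cycles_in l V E. card (?l S))"
    by (rule card_UN_le[OF finite_cycles_in[OF assms(2)]])
  also have "\<dots> = (\<Sum>S\<in>cycles_in l V E. (2 * l) ^ (2 * l))"
    using S by (intro sum.cong refl) (simp add: card_lists_length_eq)
  finally show ?thesis by (simp add: mult.commute)
qed

text \<open>Each cycle is charged to the edge joining the first two entries of its list. The degrees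
  are those in the larger family H, so that one family serves for all vertex subsets.\<close>

lemma card_cycles_in_le:
  assumes "finite V" "finite E" "l \<ge> 1" "finite H" "cycles_in l V E \<subseteq> H"
    and deg: "\<And>e. e \<in> E \<Longrightarrow> card {S \<in> H. e \<in> S} \<le> D"
  shows "card (cycles_in l V E) \<le> adj E V V * D"
proof -
  let ?Q = "{q \<in> V \<times> V. {fst q, snd q} \<in> E}"
  have fin: "finite ?Q" using assms by auto
  have "cycles_in l V E \<subseteq> (\<Union>q\<in>?Q. {S \<in> H. {fst q, snd q} \<in> S})"
  proof
    fix S assume S: "S \<in> cycles_in l V E"
    then obtain xs where xs: "length xs = 2 * l" "set xs \<subseteq> V" "cycle_edges xs \<subseteq> E" "S = cycle_edges xs"
      by (auto simp: cycles_in_def)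
    let ?q = "(xs ! 0, xs ! (Suc 0 mod length xs))"
    have "{fst ?q, snd ?q} \<in> S" unfolding xs(4) cycle_edges_def using xs(1) assms(3) by auto
    moreover have "?q \<in> V \<times> V" using xs assms(3) by auto
    ultimately show "S \<in> (\<Union>q\<in>?Q. {S \<in> H. {fst q, snd q} \<in> S})" using S xs assms(5) by blast
  qed
  hence "card (cycles_in l V E) \<le> card (\<Union>q\<in>?Q. {S \<in> H. {fst q, snd q} \<in> S})"
    using fin assms by (intro card_mono) auto
  also have "\<dots> \<le> (\<Sum>q\<in>?Q. card {S \<in> H. {fst q, snd q} \<in> S})" by (rule card_UN_le[OF fin])
  also have "\<dots> \<le> (\<Sum>q\<in>?Q. D)" by (intro sum_mono deg) auto
  finally have "card (cycles_in l V E) \<le> card ?Q * D" by simp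
  hence "real (card (cycles_in l V E)) \<le> real (card ?Q) * real D"
    by (simp only: of_nat_mult[symmetric] of_nat_le_iff)
  thus ?thesis using adj_eq_card[OF assms(1) assms(1)] by simp
qed

text \<open>Double counting in an almost regular subgraph of degree about P on at most M vertices:
  it has at least const P^(2l) cycles, while the degree cap permits only const M P s^(1-1/l), where
  s = |V|. H may exceed the set of cycles of E because the bound will be applied to what is left of
  a graph after removal of saturated edges.\<close>

lemma dense_graph_many_cycles:
  fixes l :: nat
  assumes "l \<ge> 2"
  shows "\<exists>C\<ge>1. \<forall>(V :: 'a set) E H. finite V \<longrightarrow> E \<subseteq> all_edges V \<longrightarrow> finite H \<longrightarrow> cycles_in l V E \<subseteq> H \<longrightarrow>
    (\<forall>e\<in>E. card {S \<in> H. e \<in> S} \<le> real (card V) powr (1 - 1 / l)) \<longrightarrow>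
    card E \<le> C * real (card V) powr (1 + 1 / l)"
proof -
  \<comment> \<open>With this exponent P is at least const s^(1/l-\<eta>) M^\<eta>, whose (2l-1)-th
    power is const s^(1-1/l) M. The upper bound on P^(2l-1) has the same dependence on s and M, so a
    large C gives a contradiction although M is unknown.\<close>
  define \<eta> where "\<eta> = 1 / (2 * real l - 1)"
  define K where "K = 16 * 16 powr (1 / \<eta>)"
  define c where "c = 16 * (2 * real l) ^ 4"
  define L where "L = 2 * (2 * real l) ^ (2 * l) * K"
  define C where "C = 8 * (1 + c * K + L)"
  have \<eta>: "0 < \<eta>" "\<eta> \<le> 1" "\<eta> \<le> 1 / l" using assms by (auto simp: \<eta>_def field_simps)
  have K: "K > 0" by (simp add: K_def)
  have c: "c > 0" using assms by (simp add: c_def)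
  have L: "L > 0" using assms K by (simp add: L_def)
  have "c * K > 0" using c K by simp
  hence CL: "C / 8 > L" "C / 8 \<ge> c * K" "C / 8 \<ge> 1" "C \<ge> 1" using L by (auto simp: C_def)
  show ?thesis
  proof (rule exI[of _ C], intro conjI allI impI)
    show "C \<ge> 1" by fact
    fix V :: "'a set" and E H
    assume V: "finite V" and E: "E \<subseteq> all_edges V" and H: "finite H" "cycles_in l V E \<subseteq> H"
      and deg: "\<forall>e\<in>E. card {S \<in> H. e \<in> S} \<le> real (card V) powr (1 - 1 / l)"
    define s where "s = real (card V)"
    define D where "D = nat \<lfloor>s powr (1 - 1 / l)\<rfloor>"
    have D: "real D \<le> s powr (1 - 1 / l)" by (simp add: D_def)
    have degD: "card {S \<in> H. e \<in> S} \<le> D" if "e \<in> E" for e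
      using deg that unfolding D_def s_def by (simp add: le_nat_floor)
    have finE: "finite E" using E finite_all_edges[OF V] finite_subset by blast
    show "card E \<le> C * real (card V) powr (1 + 1 / l)"
    proof (rule ccontr)
      assume "\<not> ?thesis"
      hence big: "card E > C * s powr (1 + 1 / l)" by (simp add: s_def)
      have "C * s powr (1 + 1 / l) \<ge> 0" using CL by simp
      hence "E \<noteq> {}" using big by auto
      hence Vne: "V \<noteq> {}" using E by (fastforce simp: all_edges_def)
      hence s: "s \<ge> 1" using V by (simp add: s_def Suc_leI card_gt_0_iff)
      have adjbig: "adj E V V > C * s powr (1 + 1 / l)"
        using card_edges_le_adj[OF V E] big by linarith
      hence adjpos: "adj E V V > 0" using \<open>C * s powr (1 + 1 / l) \<ge> 0\<close> by linarith
      have loopless: "{x} \<notin> E" for x using E by (auto simp: all_edges_def)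
      obtain X P M where X: "X \<subseteq> V" "X \<noteq> {}" "P > 0" "card X \<le> M" "M \<le> card V" "M > 0"
        "\<And>x. x \<in> X \<Longrightarrow> P \<le> adj E {x} X" "\<And>x. x \<in> X \<Longrightarrow> adj E {x} X \<le> K * P"
        and PM: "adj E V V * real M powr \<eta> \<le> 8 * s powr (1 + \<eta>) * P"
        using almost_regular_subgraph[OF V Vne \<eta>(1,2) loopless adjpos, folded K_def, folded s_def] by blast
      have finX: "finite X" using X V finite_subset by blast
      have Plower: "P \<ge> C / 8 * s powr (1 / l - \<eta>) * M powr \<eta>"
      proof -
        have "C * s powr (1 + 1 / l) * M powr \<eta> \<le> 8 * s powr (1 + \<eta>) * P"
          using adjbig PM mult_right_mono[of "C * s powr (1 + 1 / l)" "adj E V V" "M powr \<eta>"] by simp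
        moreover have "s powr (1 + 1 / l) = s powr (1 + \<eta>) * s powr (1 / l - \<eta>)"
          by (simp add: powr_add[symmetric])
        ultimately have "s powr (1 + \<eta>) * (C * s powr (1 / l - \<eta>) * M powr \<eta>) \<le> s powr (1 + \<eta>) * (8 * P)"
          by (simp add: mult_ac)
        moreover have "s powr (1 + \<eta>) > 0" using s by simp
        ultimately show ?thesis by simp
      qed
      \<comment> \<open>The l-th power of this, multiplied by P^l, is the hypothesis
        \<open>small\<close> of \<open>num_cycles_ge\<close> with \<Delta> = K P. It rests on M <= s
        and \<eta> <= 1/l.\<close>
      have "P \<ge> c * K * M powr (1 / l)"
      proof -
        have "M powr (1 / l) = M powr (1 / l - \<eta>) * M powr \<eta>" by (simp add: powr_add[symmetric])
        also have "\<dots> \<le> s powr (1 / l - \<eta>) * M powr \<eta>"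
          using X \<eta> by (intro mult_right_mono powr_mono2) (auto simp: s_def)
        finally have "c * K * M powr (1 / l) \<le> C / 8 * (s powr (1 / l - \<eta>) * M powr \<eta>)"
          using CL c K by (intro mult_mono) auto
        thus ?thesis using Plower by (simp add: mult.assoc)
      qed
      hence "(c * K * M powr (1 / l)) ^ l \<le> P ^ l" using c K by (intro power_mono) auto
      moreover have "(M powr (1 / l)) ^ l = M"
        using assms X by (simp add: powr_realpow[symmetric] powr_powr)
      ultimately have "(c * K) ^ l * M \<le> P ^ l" by (simp add: power_mult_distrib)
      hence "P ^ l * ((c * K) ^ l * M) \<le> P ^ l * P ^ l" using X by (intro mult_left_mono) auto
      moreover have "P ^ (2 * l) = P ^ l * P ^ l" by (simp add: mult_2 power_add)
      ultimately have "(c * (K * P)) ^ l * M \<le> P ^ (2 * l)"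
        by (simp add: power_mult_distrib mult_ac)
      moreover have "(c * (K * P)) ^ l * card X \<le> (c * (K * P)) ^ l * M"
        using X c K by (intro mult_left_mono) auto
      ultimately have small: "(c * (K * P)) ^ l * card X \<le> P ^ (2 * l)" by linarith
      have "P ^ (2 * l) / 2
          \<le> card {xs. distinct xs \<and> length xs = 2 * l \<and> set xs \<subseteq> X \<and> cycle_edges xs \<subseteq> E}"
      proof (rule num_cycles_ge[OF finX X(2) _ X(3)])
        show "P \<le> card {y \<in> X. {x, y} \<in> E}" if "x \<in> X" for x
          using X(7)[OF that] finX by (simp add: adj_singleton)
        show "card {y \<in> X. {x, y} \<in> E} \<le> K * P" if "x \<in> X" for x
          using X(8)[OF that] finX by (simp add: adj_singleton)
        show "(16 * (2 * real l) ^ 4 * (K * P)) ^ l * real (card X) \<le> P ^ (2 * l)"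
          using small by (simp add: c_def)
      qed (use assms in simp)
      also have "real (card {xs. distinct xs \<and> length xs = 2 * l \<and> set xs \<subseteq> X \<and> cycle_edges xs \<subseteq> E})
          \<le> real ((2 * l) ^ (2 * l) * card (cycles_in l X E))"
        by (simp only: of_nat_le_iff card_cycle_lists_le[OF finX finE])
      also have "\<dots> = (2 * real l) ^ (2 * l) * real (card (cycles_in l X E))" by simp
      also have "real (card (cycles_in l X E)) \<le> adj E X X * D"
      proof (rule card_cycles_in_le[OF finX finE _ H(1)])
        show "cycles_in l X E \<subseteq> H" using cycles_in_mono[OF X(1) subset_refl] H(2) by (rule order_trans)
        show "card {S \<in> H. e \<in> S} \<le> D" if "e \<in> E" for e by (rule degD[OF that])
      qed (use assms in simp)
      also have "adj E X X * D \<le> M * (K * P) * s powr (1 - 1 / l)"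
      proof (intro mult_mono)
        have "adj E X X \<le> (\<Sum>x\<in>X. K * P)" unfolding adj_eq_sum_left[of E X X] by (intro sum_mono X)
        also have "\<dots> \<le> M * (K * P)" using X K by (simp add: mult_right_mono)
        finally show "adj E X X \<le> M * (K * P)" .
      qed (use D X K in \<open>auto simp: adj_nonneg\<close>)
      finally have "P ^ (2 * l) / 2 \<le> (2 * real l) ^ (2 * l) * (M * (K * P) * s powr (1 - 1 / l))"
        using assms by (simp add: mult_left_mono)
      hence "P ^ Suc (2 * l - 1) \<le> P * (L * M * s powr (1 - 1 / l))"
        using assms by (simp add: L_def mult_ac)
      hence upper: "P ^ (2 * l - 1) \<le> L * (M * s powr (1 - 1 / l))" using X by (simp add: mult.assoc)
      have "C / 8 * (M * s powr (1 - 1 / l)) \<le> P ^ (2 * l - 1)"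
      proof -
        have r: "real (2 * l - 1) = 2 * real l - 1" using assms by (simp add: of_nat_diff)
        have e1: "(M powr \<eta>) ^ (2 * l - 1) = M"
          using X assms by (simp add: powr_realpow[symmetric] powr_powr r \<eta>_def)
        have "(1 / real l - \<eta>) * (2 * real l - 1) = 1 - 1 / l" using assms by (simp add: \<eta>_def field_simps)
        hence e2: "(s powr (1 / l - \<eta>)) ^ (2 * l - 1) = s powr (1 - 1 / l)"
          using s by (simp add: powr_realpow[symmetric] powr_powr r del: One_nat_def)
        have "C / 8 * (M * s powr (1 - 1 / l)) \<le> (C / 8) ^ (2 * l - 1) * (M * s powr (1 - 1 / l))"
          using CL assms by (intro mult_right_mono self_le_power) auto
        also have "\<dots> = (C / 8 * s powr (1 / l - \<eta>) * M powr \<eta>) ^ (2 * l - 1)"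
          by (simp only: power_mult_distrib e1 e2) (simp only: mult_ac)
        also have "\<dots> \<le> P ^ (2 * l - 1)" using Plower CL by (intro power_mono) auto
        finally show ?thesis .
      qed
      hence "C / 8 * (M * s powr (1 - 1 / l)) \<le> L * (M * s powr (1 - 1 / l))" using upper by linarith
      moreover have "M * s powr (1 - 1 / l) > 0" using X s by simp
      ultimately have "C / 8 \<le> L" by (rule mult_right_le_imp_le)
      thus False using CL by simp
    qed
  qed
qed

text \<open>H is a largest family respecting the degree cap. A cycle without saturated edges could
  be added to it, so all such cycles already lie in H and \<open>dense_graph_many_cycles\<close>
  bounds the number of unsaturated edges. The remaining edges attain the cap, and each member of H
  contributes at most 2l to the sum of degrees.\<close>

lemma spread_cycle_family:
  fixes l :: nat
  assumes "l \<ge> 2"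
  shows "\<exists>C\<ge>1. \<forall>(V :: 'a set) E. finite V \<longrightarrow> E \<subseteq> all_edges V \<longrightarrow>
    (\<exists>H \<subseteq> cycles_in l V E. (\<forall>e\<in>E. card {S \<in> H. e \<in> S} \<le> nat \<lfloor>real (card V) powr (1 - 1 / l)\<rfloor>) \<and>
      nat \<lfloor>real (card V) powr (1 - 1 / l)\<rfloor> * (card E - C * real (card V) powr (1 + 1 / l)) \<le> 2 * l * card H)"
proof -
  obtain C where C: "C \<ge> 1" and dense: "\<And>(V :: 'a set) E H. finite V \<Longrightarrow> E \<subseteq> all_edges V \<Longrightarrow>
    finite H \<Longrightarrow> cycles_in l V E \<subseteq> H \<Longrightarrow>
    (\<forall>e\<in>E. card {S \<in> H. e \<in> S} \<le> real (card V) powr (1 - 1 / l)) \<Longrightarrow>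
    card E \<le> C * real (card V) powr (1 + 1 / l)"
    using dense_graph_many_cycles[OF assms, where 'a = 'a] by blast
  show ?thesis
  proof (rule exI[of _ C], intro conjI allI impI)
    show "C \<ge> 1" by fact
    fix V :: "'a set" and E
    assume V: "finite V" and E: "E \<subseteq> all_edges V"
    define D where "D = nat \<lfloor>real (card V) powr (1 - 1 / l)\<rfloor>"
    let ?F = "{H. H \<subseteq> cycles_in l V E \<and> (\<forall>e\<in>E. card {S \<in> H. e \<in> S} \<le> D)}"
    have finE: "finite E" using E finite_all_edges[OF V] finite_subset by blast
    have finC: "finite (cycles_in l V E)" by (rule finite_cycles_in[OF finE])
    have "finite ?F" by (rule finite_subset[of _ "Pow (cycles_in l V E)"]) (use finC in auto)
    moreover have "{} \<in> ?F" by auto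
    ultimately obtain H where H: "H \<in> ?F" and max: "\<And>H'. H' \<in> ?F \<Longrightarrow> real (card H') \<le> card H"
      using exists_max_on_finite[of ?F "\<lambda>H. real (card H)"] by blast
    have finH: "finite H" using H finC finite_subset by blast
    define sat where "sat = {e \<in> E. card {S \<in> H. e \<in> S} = D}"
    have lt: "card {S \<in> H. e \<in> S} < D" if "e \<in> E - sat" for e
      using that H by (force simp: sat_def le_less)
    have "cycles_in l V (E - sat) \<subseteq> H"
    proof (rule ccontr)
      assume "\<not> ?thesis"
      then obtain S where S: "S \<in> cycles_in l V (E - sat)" "S \<notin> H" by blast
      have SE: "S \<subseteq> E - sat" using S cycles_in_subset_Pow by blast
      have "card {T \<in> insert S H. e \<in> T} \<le> D" if e: "e \<in> E" for e
      proof (cases "e \<in> S")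
        case True
        hence "{T \<in> insert S H. e \<in> T} = insert S {T \<in> H. e \<in> T}" by auto
        hence "card {T \<in> insert S H. e \<in> T} \<le> Suc (card {T \<in> H. e \<in> T})" by (simp add: card_insert_le_m1 card_insert_if)
        thus ?thesis using lt[of e] True SE by fastforce
      next
        case False
        hence "{T \<in> insert S H. e \<in> T} = {T \<in> H. e \<in> T}" by auto
        thus ?thesis using H e by auto
      qed
      moreover have "S \<in> cycles_in l V E" using S cycles_in_mono[of V V "E - sat" E] by auto
      ultimately have "insert S H \<in> ?F" using H by auto
      from max[OF this] show False using S finH by simp
    qed
    moreover have "E - sat \<subseteq> all_edges V" using E by auto
    moreover have "\<forall>e\<in>E - sat. card {S \<in> H. e \<in> S} \<le> real (card V) powr (1 - 1 / l)"
    proof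
      fix e assume "e \<in> E - sat"
      with lt have "real (card {S \<in> H. e \<in> S}) \<le> D" by fastforce
      also have "\<dots> \<le> real (card V) powr (1 - 1 / l)" by (simp add: D_def)
      finally show "card {S \<in> H. e \<in> S} \<le> real (card V) powr (1 - 1 / l)" .
    qed
    ultimately have "card (E - sat) \<le> C * real (card V) powr (1 + 1 / l)"
      using dense[OF V _ finH] by blast
    moreover have "card E = card (E - sat) + card sat"
      using finE by (subst card_Un_disjoint[symmetric]) (auto simp: sat_def intro!: arg_cong[where f = card])
    ultimately have sat: "real (card sat) \<ge> card E - C * real (card V) powr (1 + 1 / l)" by linarith
    have "(\<Sum>e\<in>E. card {S \<in> H. e \<in> S}) = (\<Sum>S\<in>H. card S)"
    proof (rule sum_multicount_gen[OF finE finH], rule ballI, rule arg_cong[where f = card])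
      fix S assume "S \<in> H"
      hence "S \<subseteq> E" using H cycles_in_subset_Pow[of l V E] by auto
      thus "{e \<in> E. e \<in> S} = S" by auto
    qed
    also have "\<dots> \<le> (\<Sum>S\<in>H. 2 * l)"
    proof (intro sum_mono)
      fix S assume "S \<in> H"
      then obtain xs where "S = cycle_edges xs" "length xs = 2 * l" using H by (auto simp: cycles_in_def)
      moreover have "cycle_edges xs = (\<lambda>i. {xs ! i, xs ! (Suc i mod length xs)}) ` {..<length xs}"
        by (auto simp: cycle_edges_def)
      ultimately show "card S \<le> 2 * l" using card_image_le[of "{..<2 * l}"] by simp
    qed
    finally have "(\<Sum>e\<in>E. card {S \<in> H. e \<in> S}) \<le> 2 * l * card H" by (simp add: mult.commute)
    moreover have "card sat * D \<le> (\<Sum>e\<in>E. card {S \<in> H. e \<in> S})"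
    proof -
      have "card sat * D = (\<Sum>e\<in>sat. card {S \<in> H. e \<in> S})" by (simp add: sat_def)
      also have "\<dots> \<le> (\<Sum>e\<in>E. card {S \<in> H. e \<in> S})" by (rule sum_mono2) (use finE in \<open>auto simp: sat_def\<close>)
      finally show ?thesis .
    qed
    ultimately have "card sat * D \<le> 2 * l * card H" by linarith
    hence "real D * card sat \<le> 2 * l * card H"
      by (simp only: of_nat_mult[symmetric] of_nat_le_iff mult.commute[of D])
    moreover have "real D * (card E - C * real (card V) powr (1 + 1 / l)) \<le> real D * card sat"
      using sat by (intro mult_left_mono) auto
    ultimately have "real D * (card E - C * real (card V) powr (1 + 1 / l)) \<le> 2 * l * card H" by linarith
    with H show "\<exists>H \<subseteq> cycles_in l V E. (\<forall>e\<in>E. card {S \<in> H. e \<in> S} \<le> nat \<lfloor>real (card V) powr (1 - 1 / l)\<rfloor>) \<and>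
      nat \<lfloor>real (card V) powr (1 - 1 / l)\<rfloor> * (card E - C * real (card V) powr (1 + 1 / l)) \<le> 2 * l * card H"
      unfolding D_def[symmetric] by auto
  qed
qed

section \<open>Parts of a cycle, and random vertex sets of fixed size\<close>

lemma card_cycle_edges:
  assumes "distinct xs" "length xs \<ge> 3"
  shows "card (cycle_edges xs) = length xs"
proof -
  let ?m = "length xs"
  have "inj_on (\<lambda>i. {xs ! i, xs ! (Suc i mod ?m)}) {..<?m}"
  proof (rule inj_onI)
    fix i j assume ij: "i \<in> {..<?m}" "j \<in> {..<?m}"
      "{xs ! i, xs ! (Suc i mod ?m)} = {xs ! j, xs ! (Suc j mod ?m)}"
    have lt: "Suc i mod ?m < ?m" "Suc j mod ?m < ?m" using assms by (auto intro: mod_less_divisor)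
    \<comment> \<open>Equal doubletons may also be swapped; then i would be its own second successor
      modulo the length, impossible from length 3 on.\<close>
    from ij(3) have "i = j \<or> i = Suc j mod ?m \<and> j = Suc i mod ?m"
      using assms(1) ij(1,2) lt by (auto simp: doubleton_eq_iff nth_eq_iff_index_eq)
    thus "i = j" using ij(1,2) assms(2) by (auto simp: mod_Suc split: if_splits)
  qed
  moreover have "cycle_edges xs = (\<lambda>i. {xs ! i, xs ! (Suc i mod ?m)}) ` {..<?m}"
    by (auto simp: cycle_edges_def)
  ultimately show ?thesis by (simp add: card_image)
qed

text \<open>A set of indices modulo \<open>m\<close> that does not grow when its successors are added is closed under
  successor, hence everything.\<close>

lemma card_Union_cycle_edges_gt:
  assumes "distinct xs" "\<sigma> \<subseteq> cycle_edges xs" "\<sigma> \<noteq> {}" "\<sigma> \<noteq> cycle_edges xs"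
  shows "card \<sigma> < card (\<Union>\<sigma>)"
proof (rule ccontr)
  assume "\<not> ?thesis"
  hence le: "card (\<Union>\<sigma>) \<le> card \<sigma>" by simp
  let ?m = "length xs"
  let ?e = "\<lambda>i. {xs ! i, xs ! (Suc i mod ?m)}"
  define J where "J = {i. i < ?m \<and> ?e i \<in> \<sigma>}"
  have finJ: "finite J" by (simp add: J_def)
  have \<sigma>: "\<sigma> = ?e ` J" using assms(2) by (auto simp: J_def cycle_edges_def)
  define s where "s = (\<lambda>i. Suc i mod ?m)"
  have slt: "s i < ?m" if "i \<in> J" for i
  proof -
    have "0 < ?m" using that by (auto simp: J_def)
    thus ?thesis by (simp add: s_def)
  qed
  have inj: "inj_on ((!) xs) (J \<union> s ` J)"
    using assms(1) slt by (intro inj_on_subset[OF inj_on_nth[of xs "{..<?m}"]]) (auto simp: J_def)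
  have "\<Union>\<sigma> = (!) xs ` (J \<union> s ` J)" unfolding \<sigma> s_def by auto
  hence "card (J \<union> s ` J) = card (\<Union>\<sigma>)" using card_image[OF inj] by simp
  also have "\<dots> \<le> card J" using le card_image_le[OF finJ, of ?e] unfolding \<sigma> by linarith
  finally have "J = J \<union> s ` J" using finJ by (intro card_seteq) auto
  hence closed: "s i \<in> J" if "i \<in> J" for i using that by blast
  obtain j where j: "j \<in> J" using assms(3) \<sigma> by auto
  have all: "(j + k) mod ?m \<in> J" for k
  proof (induction k)
    case 0
    then show ?case using j by (simp add: J_def)
  next
    case (Suc k)
    from closed[OF this] show ?case by (simp add: s_def mod_Suc_eq)
  qed
  have "i \<in> J" if "i < ?m" for i
  proof -
    have "j < ?m" using j by (simp add: J_def)
    hence "(j + (?m - j + i)) mod ?m = i" using that by simp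
    thus ?thesis using all[of "?m - j + i"] by simp
  qed
  hence "\<sigma> = cycle_edges xs" using assms(2) by (auto simp: J_def cycle_edges_def)
  with assms(4) show False by simp
qed

text \<open>A random s-subset of n elements contains z given ones with probability the product of (s
  - i)/(n - i) over i < z, and each factor is at most s/n. Denominators are cleared to stay in the
  natural numbers.\<close>

lemma binomial_diff_le:
  assumes "z \<le> s" "s \<le> n"
  shows "(n - z choose (s - z)) * n ^ z \<le> (n choose s) * s ^ z"
  using assms(1)
proof (induction z)
  case 0
  then show ?case by simp
next
  case (Suc z)
  have pos: "0 < n - z" using Suc.prems assms by simp
  have "(s - z) * (n - z choose (s - z)) = (n - z) * (n - z - 1 choose (s - z - 1))"
    using Suc.prems by (intro times_binomial_minus1_eq) simp
  hence absorb: "(n - z) * (n - Suc z choose (s - Suc z)) = (s - z) * (n - z choose (s - z))"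
    by simp
  have "n * (s - z) \<le> s * (n - z)" using assms(2) by (simp add: diff_mult_distrib2 mult.commute diff_le_mono2)
  have "(n - z) * ((n - Suc z choose (s - Suc z)) * n ^ Suc z)
      = (n * (s - z)) * ((n - z choose (s - z)) * n ^ z)"
    using absorb by (simp add: mult_ac)
  also have "\<dots> \<le> (s * (n - z)) * ((n choose s) * s ^ z)"
    by (intro mult_le_mono \<open>n * (s - z) \<le> s * (n - z)\<close> Suc.IH) (use Suc.prems in simp)
  also have "\<dots> = (n - z) * ((n choose s) * s ^ Suc z)" by (simp add: mult_ac)
  finally show ?case using pos by simp
qed

lemma card_supersets:
  assumes "finite V" "Z \<subseteq> V" "card Z \<le> s"
  shows "card {U. Z \<subseteq> U \<and> U \<subseteq> V \<and> card U = s} = (card V - card Z choose (s - card Z))"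
proof -
  have finZ: "finite Z" using assms finite_subset by blast
  let ?A = "{U. Z \<subseteq> U \<and> U \<subseteq> V \<and> card U = s}" and ?B = "{U. U \<subseteq> V - Z \<and> card U = s - card Z}"
  have "bij_betw (\<lambda>U. U - Z) ?A ?B"
  proof (rule bij_betw_byWitness[where f' = "\<lambda>U. U \<union> Z"])
    show "(\<lambda>U. U - Z) ` ?A \<subseteq> ?B" using finZ by (auto simp: card_Diff_subset)
    show "(\<lambda>U. U \<union> Z) ` ?B \<subseteq> ?A"
    proof
      fix T assume "T \<in> (\<lambda>U. U \<union> Z) ` ?B"
      then obtain U where U: "T = U \<union> Z" "U \<subseteq> V - Z" "card U = s - card Z" by auto
      moreover have "card (U \<union> Z) = card U + card Z"
        using U finZ assms(1) by (intro card_Un_disjoint) (auto intro: finite_subset)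
      ultimately show "T \<in> ?A" using assms by auto
    qed
  qed auto
  hence "card ?A = card ?B" by (rule bij_betw_same_card)
  also have "\<dots> = (card (V - Z) choose (s - card Z))" using assms by (intro n_subsets) auto
  finally show ?thesis using assms finZ by (simp add: card_Diff_subset)
qed

lemma card_supersets_le:
  assumes "finite V" "Z \<subseteq> V" "s \<le> card V" "V \<noteq> {}"
  shows "real (card {U. Z \<subseteq> U \<and> U \<subseteq> V \<and> card U = s}) \<le> (card V choose s) * (s / card V) ^ card Z"
proof (cases "card Z \<le> s")
  case True
  have n: "real (card V) > 0" using assms by (simp add: card_gt_0_iff)
  have "real ((card V - card Z choose (s - card Z)) * card V ^ card Z) \<le> real ((card V choose s) * s ^ card Z)"
    using binomial_diff_le[OF True assms(3)] by (simp only: of_nat_le_iff)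
  thus ?thesis using n unfolding card_supersets[OF assms(1,2) True] by (simp add: power_divide field_simps)
next
  case False
  have "\<not> (Z \<subseteq> U \<and> U \<subseteq> V \<and> card U = s)" for U
    using False assms(1) card_mono[of U Z] finite_subset[of U V] by auto
  hence empty: "{U. Z \<subseteq> U \<and> U \<subseteq> V \<and> card U = s} = {}" by blast
  show ?thesis unfolding empty by simp
qed

text \<open>The exact probability is s (s - 1) / (n (n - 1)), and s - 1 is at least s/2. For edges
  this yields the expected number of edges in a random s-set.\<close>

lemma card_supersets_pair_ge:
  assumes "finite V" "Z \<subseteq> V" "2 \<le> s" "s \<le> card V" "card Z = 2"
  shows "real (card {U. Z \<subseteq> U \<and> U \<subseteq> V \<and> card U = s}) \<ge> (card V choose s) * (s / card V)\<^sup>2 / 2"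
proof -
  let ?n = "card V"
  have "s * (?n choose s) = ?n * (?n - 1 choose (s - 1))"
    using assms by (intro times_binomial_minus1_eq) simp
  moreover have "(s - 1) * (?n - 1 choose (s - 1)) = (?n - 1) * (?n - 1 - 1 choose (s - 1 - 1))"
    using assms by (intro times_binomial_minus1_eq) simp
  ultimately have "s * (s - 1) * (?n choose s) = ?n * (?n - 1) * (?n - 2 choose (s - 2))"
    by (metis (no_types, lifting) diff_diff_left mult.assoc mult.left_commute one_add_one)
  hence "real s * real (s - 1) * real (?n choose s) = real ?n * real (?n - 1) * real (?n - 2 choose (s - 2))"
    by (simp only: of_nat_mult[symmetric])
  moreover have "real (s - 1) \<ge> real s / 2" using assms by (simp add: of_nat_diff)
  hence "real s * (real s / 2) * real (?n choose s) \<le> real s * real (s - 1) * real (?n choose s)"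
    by (intro mult_right_mono mult_left_mono) auto
  moreover have "real ?n * real (?n - 1) * real (?n - 2 choose (s - 2)) \<le> real ?n * real ?n * real (?n - 2 choose (s - 2))"
    by (intro mult_right_mono mult_left_mono) auto
  ultimately have "real s * (real s / 2) * real (?n choose s) \<le> real ?n * real ?n * real (?n - 2 choose (s - 2))"
    by linarith
  moreover have "real ?n > 0" using assms by simp
  ultimately show ?thesis using card_supersets[OF assms(1,2), of s] assms
    by (simp add: power2_eq_square field_simps)
qed

text \<open>The weight of a cycle is proportional to the number of s-sets U whose family
  \<open>H U\<close> contains it. By the density hypothesis the subtracted term C s^(1+1/l) is at
  most half of the lower bound for the expected number of edges in U, so the families are large on
  average. A nonempty \<sigma> lies below members of \<open>H U\<close> only if U contains its
  vertices, and then below at most D of them. A full cycle is treated apart: it lies below itself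
  only, but spans one vertex fewer than the pattern |\<sigma>| + 1.\<close>

lemma spread_cycle_weights:
  fixes l :: nat
  assumes "l \<ge> 2"
  shows "\<exists>C\<ge>1. \<forall>(V :: 'a set) E s. finite V \<longrightarrow> E \<subseteq> all_edges V \<longrightarrow> 2 \<le> s \<longrightarrow> s \<le> card V \<longrightarrow> E \<noteq> {} \<longrightarrow>
    4 * C * (real (card V))\<^sup>2 \<le> real s powr (1 - 1 / l) * card E \<longrightarrow>
    (\<exists>w. (\<forall>S. w S \<ge> (0 :: real)) \<and> (\<forall>S. w S \<noteq> 0 \<longrightarrow> S \<in> cycles_in l V E) \<and> sum w (Pow E) \<ge> 1 \<and>
      (\<forall>\<sigma>. \<sigma> \<noteq> {} \<longrightarrow> \<sigma> \<subseteq> E \<longrightarrow> card \<sigma> < 2 * l \<longrightarrow>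
         sum w {S \<in> Pow E. \<sigma> \<subseteq> S} \<le> 8 * l * (s / card V) ^ (card \<sigma> - 1) / card E) \<and>
      (\<forall>\<sigma>. \<sigma> \<subseteq> E \<longrightarrow> card \<sigma> = 2 * l \<longrightarrow>
         sum w {S \<in> Pow E. \<sigma> \<subseteq> S} \<le> 8 * l * (s / card V) ^ (2 * l - 2)
           / (card E * real (nat \<lfloor>real s powr (1 - 1 / l)\<rfloor>))))"
proof -
  obtain C where C: "C \<ge> 1" and in_subset: "\<And>(V :: 'a set) E. finite V \<Longrightarrow> E \<subseteq> all_edges V \<Longrightarrow>
    \<exists>H \<subseteq> cycles_in l V E. (\<forall>e\<in>E. card {S \<in> H. e \<in> S} \<le> nat \<lfloor>real (card V) powr (1 - 1 / l)\<rfloor>) \<and>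
      nat \<lfloor>real (card V) powr (1 - 1 / l)\<rfloor> * (card E - C * real (card V) powr (1 + 1 / l)) \<le> 2 * l * card H"
    using spread_cycle_family[OF assms, where 'a = 'a] by blast
  show ?thesis
  proof (rule exI[of _ C], intro conjI allI impI)
    show "C \<ge> 1" by fact
    fix V :: "'a set" and E and s :: nat
    assume V: "finite V" and E: "E \<subseteq> all_edges V" and s: "2 \<le> s" "s \<le> card V" and Ene: "E \<noteq> {}"
      and dense: "4 * C * (real (card V))\<^sup>2 \<le> real s powr (1 - 1 / l) * card E"
    define n where "n = card V"
    define D where "D = nat \<lfloor>real s powr (1 - 1 / l)\<rfloor>"
    have n: "n > 0" using s by (simp add: n_def)
    have Vne: "V \<noteq> {}" using n by (auto simp: n_def)
    have D: "D \<ge> 1"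
    proof -
      have "real s powr (1 - 1 / l) \<ge> 1" using s assms by (intro ge_one_powr_ge_zero) auto
      thus ?thesis by (simp add: D_def le_nat_floor)
    qed
    have finE: "finite E" using E finite_all_edges[OF V] finite_subset by blast
    have cE: "card E > 0" using finE Ene by (simp add: card_gt_0_iff)
    define \<U> where "\<U> = {U. U \<subseteq> V \<and> card U = s}"
    have fin\<U>: "finite \<U>" unfolding \<U>_def by (rule finite_subset[of _ "Pow V"]) (use V in auto)
    have card\<U>: "card \<U> = (n choose s)" unfolding \<U>_def n_def using n_subsets[OF V] by simp
    have binpos: "real (n choose s) > 0" using s by (simp add: n_def)
    have "\<forall>U\<in>\<U>. \<exists>H \<subseteq> cycles_in l U (E \<inter> all_edges U). (\<forall>e\<in>E \<inter> all_edges U. card {S \<in> H. e \<in> S} \<le> D) \<and>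
      D * (card (E \<inter> all_edges U) - C * real s powr (1 + 1 / l)) \<le> 2 * l * card H"
    proof
      fix U assume "U \<in> \<U>"
      hence "finite U" "card U = s" using V finite_subset by (auto simp: \<U>_def)
      with in_subset[of U "E \<inter> all_edges U"] show "\<exists>H \<subseteq> cycles_in l U (E \<inter> all_edges U). (\<forall>e\<in>E \<inter> all_edges U. card {S \<in> H. e \<in> S} \<le> D) \<and>
      D * (card (E \<inter> all_edges U) - C * real s powr (1 + 1 / l)) \<le> 2 * l * card H"
        unfolding D_def by auto
    qed
    from bchoice[OF this] obtain H where HH: "\<forall>U\<in>\<U>. H U \<subseteq> cycles_in l U (E \<inter> all_edges U) \<and>
      (\<forall>e\<in>E \<inter> all_edges U. card {S \<in> H U. e \<in> S} \<le> D) \<and>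
      D * (card (E \<inter> all_edges U) - C * real s powr (1 + 1 / l)) \<le> 2 * l * card (H U)" ..
    have H: "H U \<subseteq> cycles_in l U (E \<inter> all_edges U)"
      and Hdeg: "\<And>e. e \<in> E \<inter> all_edges U \<Longrightarrow> card {S \<in> H U. e \<in> S} \<le> D"
      and Hcard: "D * (card (E \<inter> all_edges U) - C * real s powr (1 + 1 / l)) \<le> 2 * l * card (H U)"
      if "U \<in> \<U>" for U
      using bspec[OF HH that] by simp_all
    have HE: "S \<subseteq> E" "S \<subseteq> all_edges U" "S \<in> cycles_in l V E" if "U \<in> \<U>" "S \<in> H U" for U S
    proof -
      have "S \<in> cycles_in l U (E \<inter> all_edges U)" using H that by auto
      thus "S \<subseteq> E" "S \<subseteq> all_edges U" using cycles_in_subset_Pow[of l U "E \<inter> all_edges U"] by auto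
      show "S \<in> cycles_in l V E"
        using \<open>S \<in> cycles_in l U _\<close> cycles_in_mono[of U V "E \<inter> all_edges U" E] that by (auto simp: \<U>_def)
    qed
    have finH: "finite (H U)" if "U \<in> \<U>" for U
      by (rule finite_subset[OF H[OF that] finite_cycles_in]) (use finE in simp)
    \<comment> \<open>A lower bound for the sum of all \<open>card (H U)\<close>: on average at
      least |E| (s/n)^2 / 4 edges of U are saturated, each lies in D cycles, and each cycle is
      counted at most 2l times.\<close>
    define m where "m = real (n choose s) * D * (s / n)\<^sup>2 * card E / (8 * l)"
    have m: "m > 0" using binpos D n s cE assms by (simp add: m_def)
    define w where "w = (\<lambda>S. real (card {U \<in> \<U>. S \<in> H U}) / m)"
    have rearrange: "N * (q * t) * d = (N * d * q * e / k) * (k * t / e)"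
      if "e \<noteq> 0" "k \<noteq> 0" for N q t d e k :: real
      using that by simp
    have rearrange': "N * (q * t) = (N * d * q * e / k) * (k * t / (e * d))"
      if "e \<noteq> 0" "k \<noteq> 0" "d \<noteq> 0" for N q t d e k :: real
      using that by simp
    have wsum: "sum w {S \<in> Pow E. \<sigma> \<subseteq> S} = (\<Sum>U\<in>\<U>. real (card {S \<in> H U. \<sigma> \<subseteq> S})) / m" for \<sigma>
    proof -
      have "(\<Sum>S\<in>{S \<in> Pow E. \<sigma> \<subseteq> S}. card {U \<in> \<U>. S \<in> H U}) = (\<Sum>U\<in>\<U>. card {S \<in> H U. \<sigma> \<subseteq> S})"
      proof (rule sum_multicount_gen, goal_cases)
        case 3
        show ?case
        proof (rule ballI, rule arg_cong[where f = card])
          fix U assume "U \<in> \<U>"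
          from HE(1)[OF this] show "{S \<in> {S \<in> Pow E. \<sigma> \<subseteq> S}. S \<in> H U} = {S \<in> H U. \<sigma> \<subseteq> S}" by blast
        qed
      qed (use finE fin\<U> in auto)
      hence "(\<Sum>S\<in>{S \<in> Pow E. \<sigma> \<subseteq> S}. real (card {U \<in> \<U>. S \<in> H U}))
          = (\<Sum>U\<in>\<U>. real (card {S \<in> H U. \<sigma> \<subseteq> S}))"
        by (simp only: of_nat_sum[symmetric])
      thus ?thesis unfolding w_def sum_divide_distrib[symmetric] by simp
    qed
    have degle: "real (card {S \<in> H U. \<sigma> \<subseteq> S}) \<le> D" if "U \<in> \<U>" "\<sigma> \<noteq> {}" for U \<sigma>
    proof -
      obtain e where e: "e \<in> \<sigma>" using \<open>\<sigma> \<noteq> {}\<close> by auto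
      have sub: "card {S \<in> H U. \<sigma> \<subseteq> S} \<le> card {S \<in> H U. e \<in> S}"
        using e finH[OF that(1)] by (intro card_mono) auto
      show ?thesis
      proof (cases "e \<in> E \<inter> all_edges U")
        case True
        thus ?thesis using sub Hdeg[OF that(1) True] by simp
      next
        case False
        hence "{S \<in> H U. e \<in> S} = {}" using HE(1,2)[OF that(1)] by blast
        hence "card {S \<in> H U. e \<in> S} = 0" by (simp only: card.empty)
        thus ?thesis using sub by linarith
      qed
    qed
    have zero: "card {S \<in> H U. \<sigma> \<subseteq> S} = 0" if "U \<in> \<U>" "\<not> \<Union>\<sigma> \<subseteq> U" for U \<sigma>
    proof -
      have "{S \<in> H U. \<sigma> \<subseteq> S} = {}"
      proof (rule ccontr)
        assume "\<not> ?thesis"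
        then obtain S where "S \<in> H U" "\<sigma> \<subseteq> S" by auto
        hence "\<sigma> \<subseteq> all_edges U" using HE(2)[OF that(1)] by blast
        thus False using that by (auto simp: all_edges_def)
      qed
      thus ?thesis by (simp only: card.empty)
    qed
    have bound: "(\<Sum>U\<in>\<U>. real (card {S \<in> H U. \<sigma> \<subseteq> S})) \<le> (n choose s) * (s / n) ^ card (\<Union>\<sigma>) * b"
      if "b \<ge> 0" "\<sigma> \<subseteq> E" "\<And>U. U \<in> \<U> \<Longrightarrow> real (card {S \<in> H U. \<sigma> \<subseteq> S}) \<le> b" for b \<sigma>
    proof -
      have "(\<Sum>U\<in>\<U>. real (card {S \<in> H U. \<sigma> \<subseteq> S})) \<le> (\<Sum>U\<in>\<U>. if \<Union>\<sigma> \<subseteq> U then b else 0)"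
      proof (rule sum_mono)
        fix U assume "U \<in> \<U>"
        thus "real (card {S \<in> H U. \<sigma> \<subseteq> S}) \<le> (if \<Union>\<sigma> \<subseteq> U then b else 0)"
          using that(3)[of U] zero[of U \<sigma>] by (cases "\<Union>\<sigma> \<subseteq> U") (simp_all del: card_eq_0_iff)
      qed
      also have "\<dots> = (\<Sum>U\<in>{U \<in> \<U>. \<Union>\<sigma> \<subseteq> U}. b)" by (rule sum.inter_filter[OF fin\<U>, symmetric])
      also have "{U \<in> \<U>. \<Union>\<sigma> \<subseteq> U} = {U. \<Union>\<sigma> \<subseteq> U \<and> U \<subseteq> V \<and> card U = s}" by (auto simp: \<U>_def)
      also have "(\<Sum>U\<in>\<dots>. b) = real (card {U. \<Union>\<sigma> \<subseteq> U \<and> U \<subseteq> V \<and> card U = s}) * b" by simp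
      also have "\<dots> \<le> (n choose s) * (s / n) ^ card (\<Union>\<sigma>) * b"
      proof (rule mult_right_mono)
        have "\<Union>\<sigma> \<subseteq> V" using that(2) E by (fastforce simp: all_edges_def)
        from card_supersets_le[OF V this s(2) Vne]
        show "real (card {U. \<Union>\<sigma> \<subseteq> U \<and> U \<subseteq> V \<and> card U = s}) \<le> (n choose s) * (s / n) ^ card (\<Union>\<sigma>)"
          by (simp only: n_def)
      qed (rule that(1))
      finally show ?thesis .
    qed
    show "\<exists>w. (\<forall>S. w S \<ge> (0 :: real)) \<and> (\<forall>S. w S \<noteq> 0 \<longrightarrow> S \<in> cycles_in l V E) \<and> sum w (Pow E) \<ge> 1 \<and>
      (\<forall>\<sigma>. \<sigma> \<noteq> {} \<longrightarrow> \<sigma> \<subseteq> E \<longrightarrow> card \<sigma> < 2 * l \<longrightarrow>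
         sum w {S \<in> Pow E. \<sigma> \<subseteq> S} \<le> 8 * l * (s / card V) ^ (card \<sigma> - 1) / card E) \<and>
      (\<forall>\<sigma>. \<sigma> \<subseteq> E \<longrightarrow> card \<sigma> = 2 * l \<longrightarrow>
         sum w {S \<in> Pow E. \<sigma> \<subseteq> S} \<le> 8 * l * (s / card V) ^ (2 * l - 2)
           / (card E * real (nat \<lfloor>real s powr (1 - 1 / l)\<rfloor>)))"
      unfolding n_def[symmetric] D_def[symmetric]
    proof (rule exI[of _ w], intro conjI allI impI)
      show "w S \<ge> 0" for S using m by (simp add: w_def)
    next
      fix S assume "w S \<noteq> 0"
      show "S \<in> cycles_in l V E"
      proof (rule ccontr)
        assume "S \<notin> cycles_in l V E"
        hence "{U \<in> \<U>. S \<in> H U} = {}" using HE(3) by blast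
        hence "w S = 0" unfolding w_def by (simp only: card.empty of_nat_0 div_0)
        with \<open>w S \<noteq> 0\<close> show False by simp
      qed
    next
      have "(\<Sum>U\<in>\<U>. card (E \<inter> all_edges U)) = (\<Sum>e\<in>E. card {U \<in> \<U>. e \<in> all_edges U})"
        unfolding Int_def by (rule sum_multicount_gen[OF fin\<U> finE]) simp
      hence edges: "(\<Sum>U\<in>\<U>. real (card (E \<inter> all_edges U))) = (\<Sum>e\<in>E. real (card {U \<in> \<U>. e \<in> all_edges U}))"
        by (simp only: of_nat_sum[symmetric])
      have "(\<Sum>e\<in>E. (n choose s) * (s / n)\<^sup>2 / 2) \<le> (\<Sum>e\<in>E. real (card {U \<in> \<U>. e \<in> all_edges U}))"
      proof (intro sum_mono)
        fix e assume "e \<in> E"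
        hence e: "e \<subseteq> V" "card e = 2" using E by (auto simp: all_edges_def)
        hence sup: "{U \<in> \<U>. e \<in> all_edges U} = {U. e \<subseteq> U \<and> U \<subseteq> V \<and> card U = s}"
          by (auto simp: \<U>_def all_edges_def)
        show "(n choose s) * (s / n)\<^sup>2 / 2 \<le> card {U \<in> \<U>. e \<in> all_edges U}"
          unfolding sup n_def by (rule card_supersets_pair_ge[OF V e(1) s e(2)])
      qed
      hence edges_ge: "(\<Sum>U\<in>\<U>. real (card (E \<inter> all_edges U))) \<ge> card E * ((n choose s) * (s / n)\<^sup>2 / 2)"
        unfolding edges by simp
      have small: "C * real s powr (1 + 1 / l) \<le> card E * (s / n)\<^sup>2 / 4"
      proof -
        have "real s powr (1 + 1 / l) * real s powr (1 - 1 / l) = (real s)\<^sup>2"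
          using s by (simp add: powr_add[symmetric] powr_numeral)
        hence "real s powr (1 + 1 / l) * (4 * C * (real n)\<^sup>2) \<le> (real s)\<^sup>2 * card E"
          using mult_left_mono[OF dense, of "real s powr (1 + 1 / l)"] unfolding n_def
          by (simp only: mult.assoc[symmetric] powr_ge_zero)
        hence "(C * real s powr (1 + 1 / l)) * (4 * (real n)\<^sup>2) \<le> (real s)\<^sup>2 * card E"
          by (simp only: mult_ac)
        hence "C * real s powr (1 + 1 / l) \<le> (real s)\<^sup>2 * card E / (4 * (real n)\<^sup>2)"
          using n by (subst pos_le_divide_eq) auto
        also have "\<dots> = card E * (s / n)\<^sup>2 / 4" by (simp add: power_divide mult_ac)
        finally show ?thesis .
      qed
      define x where "x = C * real s powr (1 + 1 / l)"
      define y where "y = card E * (s / n)\<^sup>2"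
      have "y / 4 \<le> y / 2 - x" using small unfolding x_def[symmetric] y_def[symmetric] by linarith
      hence "real D * (n choose s) * (y / 4) \<le> real D * (n choose s) * (y / 2 - x)"
        by (rule mult_left_mono) simp
      also have "\<dots> = D * (card E * ((n choose s) * (s / n)\<^sup>2 / 2) - (n choose s) * x)"
        unfolding y_def by (simp add: right_diff_distrib)
      also have "\<dots> \<le> D * ((\<Sum>U\<in>\<U>. real (card (E \<inter> all_edges U))) - card \<U> * x)"
        unfolding card\<U> by (rule mult_left_mono[OF diff_right_mono[OF edges_ge]]) simp
      also have "\<dots> = (\<Sum>U\<in>\<U>. D * (card (E \<inter> all_edges U) - x))"
        by (simp only: sum_distrib_left[symmetric] sum_subtractf sum_constant)
      also have "\<dots> \<le> (\<Sum>U\<in>\<U>. 2 * l * real (card (H U)))"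
        unfolding x_def by (rule sum_mono, drule Hcard) simp
      also have "\<dots> = (\<Sum>U\<in>\<U>. real (card (H U))) * (2 * l)"
        by (simp add: sum_distrib_left mult.commute)
      finally have "real D * (n choose s) * (y / 4) / (2 * l) \<le> (\<Sum>U\<in>\<U>. real (card (H U)))"
        using assms by (subst pos_divide_le_eq) auto
      moreover have "m = real D * (n choose s) * (y / 4) / (2 * l)" by (simp add: m_def y_def)
      ultimately have "m \<le> (\<Sum>U\<in>\<U>. real (card (H U)))" by simp
      moreover have "sum w (Pow E) = (\<Sum>U\<in>\<U>. real (card (H U))) / m"
        using wsum[of "{}"] by (simp only: empty_subsetI simp_thms Collect_mem_eq)
      ultimately show "sum w (Pow E) \<ge> 1" using m by simp
    next
      fix \<sigma> assume \<sigma>: "\<sigma> \<noteq> {}" "\<sigma> \<subseteq> E" "card \<sigma> < 2 * l"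
      have b: "(\<Sum>U\<in>\<U>. real (card {S \<in> H U. \<sigma> \<subseteq> S})) \<le> (n choose s) * (s / n) ^ (card \<sigma> + 1) * D"
      \<comment> \<open>An arbitrary \<sigma> may span few vertices, for instance if it contains a
        shorter cycle. It is then below no 2l-cycle and the sum vanishes; only a proper part of a
        2l-cycle is sure to span |\<sigma>| + 1 vertices.\<close>
      proof (cases "\<exists>U\<in>\<U>. {S \<in> H U. \<sigma> \<subseteq> S} \<noteq> {}")
        case True
        then obtain U S where US: "U \<in> \<U>" "S \<in> H U" "\<sigma> \<subseteq> S" by auto
        then obtain xs where xs: "distinct xs" "length xs = 2 * l" "S = cycle_edges xs"
          using HE(3)[OF US(1,2)] by (auto simp: cycles_in_def)
        have "card (cycle_edges xs) = 2 * l" using card_cycle_edges[OF xs(1)] xs(2) assms by simp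
        hence "\<sigma> \<noteq> cycle_edges xs" using \<sigma>(3) by (metis less_irrefl)
        hence "card \<sigma> + 1 \<le> card (\<Union>\<sigma>)"
          using card_Union_cycle_edges_gt[OF xs(1) _ \<sigma>(1)] US(3) xs(3) by simp
        hence "(real s / n) ^ card (\<Union>\<sigma>) \<le> (real s / n) ^ (card \<sigma> + 1)"
          using s n by (intro power_decreasing) (auto simp: n_def)
        hence "(n choose s) * (real s / n) ^ card (\<Union>\<sigma>) * D \<le> (n choose s) * (s / n) ^ (card \<sigma> + 1) * D"
          by (rule mult_right_mono[OF mult_left_mono]) simp_all
        moreover have "(\<Sum>U\<in>\<U>. real (card {S \<in> H U. \<sigma> \<subseteq> S})) \<le> (n choose s) * (s / n) ^ card (\<Union>\<sigma>) * D"
          by (rule bound[OF _ \<sigma>(2) degle[OF _ \<sigma>(1)]]) simp_all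
        ultimately show ?thesis by linarith
      next
        case False
        have "real (card {S \<in> H U. \<sigma> \<subseteq> S}) = 0" if "U \<in> \<U>" for U
        proof -
          have "{S \<in> H U. \<sigma> \<subseteq> S} = {}" using False that by blast
          thus ?thesis by (simp only: card.empty of_nat_0)
        qed
        hence "(\<Sum>U\<in>\<U>. real (card {S \<in> H U. \<sigma> \<subseteq> S})) = 0" by (rule sum.neutral[OF ballI])
        thus ?thesis by simp
      qed
      have "card \<sigma> > 0" using \<sigma>(1) finite_subset[OF \<sigma>(2) finE] by (simp add: card_gt_0_iff)
      hence "card \<sigma> + 1 = 2 + (card \<sigma> - 1)" by linarith
      hence "(real s / n) ^ (card \<sigma> + 1) = (real s / n)\<^sup>2 * (real s / n) ^ (card \<sigma> - 1)" by (simp only: power_add)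
      hence "(n choose s) * (s / n) ^ (card \<sigma> + 1) * D = m * (8 * l * (s / n) ^ (card \<sigma> - 1) / card E)"
        unfolding m_def by (simp only:) (rule rearrange, use cE assms in simp_all)
      with b show "sum w {S \<in> Pow E. \<sigma> \<subseteq> S} \<le> 8 * l * (s / n) ^ (card \<sigma> - 1) / card E"
        unfolding wsum using m by (simp only: pos_divide_le_eq mult.commute[of _ m])
    next
      fix \<sigma> assume \<sigma>: "\<sigma> \<subseteq> E" "card \<sigma> = 2 * l"
      have S: "S = \<sigma> \<and> card (\<Union>\<sigma>) = 2 * l" if US: "U \<in> \<U>" "S \<in> H U" "\<sigma> \<subseteq> S" for U S
      proof -
        obtain xs where xs: "distinct xs" "length xs = 2 * l" "S = cycle_edges xs"
          using HE(3)[OF US(1,2)] by (auto simp: cycles_in_def)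
        have "card S = 2 * l" using card_cycle_edges[OF xs(1)] xs assms by simp
        moreover have "finite S" using HE(1)[OF US(1,2)] finE finite_subset by blast
        ultimately have "\<sigma> = S" using \<sigma> US(3) card_subset_eq by metis
        moreover have "card (\<Union>S) = 2 * l" using xs by (simp add: Union_cycle_edges distinct_card)
        ultimately show ?thesis by simp
      qed
      have b: "(\<Sum>U\<in>\<U>. real (card {S \<in> H U. \<sigma> \<subseteq> S})) \<le> (n choose s) * (s / n) ^ (2 * l)"
      proof (cases "\<exists>U\<in>\<U>. {S \<in> H U. \<sigma> \<subseteq> S} \<noteq> {}")
        case True
        hence "card (\<Union>\<sigma>) = 2 * l" using S by blast
        moreover have "real (card {S \<in> H U. \<sigma> \<subseteq> S}) \<le> 1" if "U \<in> \<U>" for U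
        proof -
          have "{S \<in> H U. \<sigma> \<subseteq> S} \<subseteq> {\<sigma>}" using S[OF that] by auto
          from card_mono[OF _ this] show ?thesis by simp
        qed
        ultimately show ?thesis using bound[of 1 \<sigma>] \<sigma>(1) by (simp only: mult_1_right zero_le_one)
      next
        case False
        have "real (card {S \<in> H U. \<sigma> \<subseteq> S}) = 0" if "U \<in> \<U>" for U
        proof -
          have "{S \<in> H U. \<sigma> \<subseteq> S} = {}" using False that by blast
          thus ?thesis by (simp only: card.empty of_nat_0)
        qed
        hence "(\<Sum>U\<in>\<U>. real (card {S \<in> H U. \<sigma> \<subseteq> S})) = 0" by (rule sum.neutral[OF ballI])
        thus ?thesis by simp
      qed
      have "2 * l = 2 + (2 * l - 2)" using assms by simp
      hence "(real s / n) ^ (2 * l) = (real s / n)\<^sup>2 * (real s / n) ^ (2 * l - 2)" by (metis power_add)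
      hence "(n choose s) * (s / n) ^ (2 * l) = m * (8 * l * (s / n) ^ (2 * l - 2) / (card E * real D))"
        unfolding m_def by (simp only:) (rule rearrange', use cE assms D in simp_all)
      with b show "sum w {S \<in> Pow E. \<sigma> \<subseteq> S} \<le> 8 * l * (s / n) ^ (2 * l - 2) / (card E * real D)"
        unfolding wsum using m by (simp only: pos_divide_le_eq mult.commute[of _ m])
    qed
  qed
qed

section \<open>Hypergraph containers\<close>

definition weight_degree :: "'b set \<Rightarrow> ('b set \<Rightarrow> real) \<Rightarrow> 'b set \<Rightarrow> real" where
  "weight_degree V w \<sigma> = sum w {S \<in> Pow V. \<sigma> \<subseteq> S}"

text \<open>The co-degree condition of the container method, normalized to total weight at least 1.
  The quotient \<open>b / card V\<close> is the density of the fingerprint of one stage; the bound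
  on the degree of \<sigma> falls by this factor with each further element.\<close>

definition spread_weight :: "'b set \<Rightarrow> nat \<Rightarrow> nat \<Rightarrow> real \<Rightarrow> ('b set \<Rightarrow> real) \<Rightarrow> bool" where
  "spread_weight V b r D w \<longleftrightarrow> (\<forall>S. 0 \<le> w S) \<and> (\<forall>S. w S \<noteq> 0 \<longrightarrow> S \<subseteq> V \<and> card S = r) \<and> 1 \<le> sum w (Pow V) \<and>
     (\<forall>\<sigma>. \<sigma> \<noteq> {} \<longrightarrow> \<sigma> \<subseteq> V \<longrightarrow> card \<sigma> \<le> r \<longrightarrow>
        weight_degree V w \<sigma> \<le> D * (b / card V) ^ (card \<sigma> - 1) / card V)"

text \<open>The containing property is demanded for every \<open>T'\<close> between the fingerprint \<open>T\<close> and \<open>I\<close>. This makes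
  fingerprints found in successive stages composable: their union serves for each of the stages.\<close>

definition has_containers :: "'b set \<Rightarrow> 'b set \<Rightarrow> nat \<Rightarrow> real \<Rightarrow> ('b set \<Rightarrow> bool) \<Rightarrow> bool" where
  "has_containers V U t \<delta> indep \<longleftrightarrow> (\<exists>F. (\<forall>T. F T \<subseteq> V \<and> real (card (F T)) \<le> (1 - \<delta>) * real (card V)) \<and>
     (\<forall>I\<subseteq>V. indep I \<longrightarrow> (\<exists>T\<subseteq>I. card T \<le> t \<and> (\<forall>T'. T \<subseteq> T' \<longrightarrow> T' \<subseteq> I \<longrightarrow> I \<inter> U \<subseteq> F T' \<union> T'))))"

lemma has_containers_mono:
  assumes "has_containers V U t \<delta> indep" "U' \<subseteq> U" "t \<le> t'" "\<delta>' \<le> \<delta>" "\<And>I. I \<subseteq> V \<Longrightarrow> indep' I \<Longrightarrow> indep I"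
  shows "has_containers V U' t' \<delta>' indep'"
proof -
  obtain F where FI: "(\<forall>T. F T \<subseteq> V \<and> real (card (F T)) \<le> (1 - \<delta>) * real (card V)) \<and>
     (\<forall>I\<subseteq>V. indep I \<longrightarrow> (\<exists>T\<subseteq>I. card T \<le> t \<and> (\<forall>T'. T \<subseteq> T' \<longrightarrow> T' \<subseteq> I \<longrightarrow> I \<inter> U \<subseteq> F T' \<union> T')))"
    using assms(1) unfolding has_containers_def ..
  hence F: "F T \<subseteq> V" "card (F T) \<le> (1 - \<delta>) * card V" for T by simp_all
  have I: "\<exists>T\<subseteq>I. card T \<le> t \<and> (\<forall>T'. T \<subseteq> T' \<longrightarrow> T' \<subseteq> I \<longrightarrow> I \<inter> U \<subseteq> F T' \<union> T')"
    if "I \<subseteq> V" "indep I" for I using FI that by simp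
  have "(1 - \<delta>) * card V \<le> (1 - \<delta>') * card V" using assms(4) by (intro mult_right_mono) auto
  hence "card (F T) \<le> (1 - \<delta>') * card V" for T using F(2)[of T] by linarith
  moreover have "\<exists>T\<subseteq>I. card T \<le> t' \<and> (\<forall>T'. T \<subseteq> T' \<longrightarrow> T' \<subseteq> I \<longrightarrow> I \<inter> U' \<subseteq> F T' \<union> T')"
    if indep': "I \<subseteq> V" "indep' I" for I
  proof -
    obtain T where T: "T \<subseteq> I" "card T \<le> t" and T': "\<forall>T'. T \<subseteq> T' \<longrightarrow> T' \<subseteq> I \<longrightarrow> I \<inter> U \<subseteq> F T' \<union> T'"
      using I[OF indep'(1) assms(5)[OF indep']] by (elim exE conjE)
    have "I \<inter> U' \<subseteq> F T' \<union> T'" if "T \<subseteq> T'" "T' \<subseteq> I" for T'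
      using T' that assms(2) by blast
    thus ?thesis using T assms(3) by (meson order_trans)
  qed
  ultimately show ?thesis unfolding has_containers_def
    by (intro exI[of _ F] conjI allI impI F(1))
qed

text \<open>The answer to the query \<open>v \<in> I\<close> has to be readable from the
  fingerprint. On yes, v is put into it at the price of one unit of budget. On no, v lies outside
  every T' contained in I, so the test \<open>v \<in> T'\<close> is still correct. Afterwards v
  needs no container: it belongs to T' or is missing from I.\<close>

lemma has_containers_query:
  assumes no: "has_containers V (U - {v}) t \<delta> (\<lambda>I. indep I \<and> v \<notin> I)"
    and yes: "has_containers V (U - {v}) (t - 1) \<delta> (\<lambda>I. indep I \<and> v \<in> I)"
    and t: "t \<ge> 1"
  shows "has_containers V U t \<delta> indep"
proof -
  obtain F0 where FI0: "(\<forall>T. F0 T \<subseteq> V \<and> real (card (F0 T)) \<le> (1 - \<delta>) * real (card V)) \<and>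
     (\<forall>I\<subseteq>V. indep I \<and> v \<notin> I \<longrightarrow> (\<exists>T\<subseteq>I. card T \<le> t \<and>
       (\<forall>T'. T \<subseteq> T' \<longrightarrow> T' \<subseteq> I \<longrightarrow> I \<inter> (U - {v}) \<subseteq> F0 T' \<union> T')))"
    using no unfolding has_containers_def ..
  hence F0: "F0 T \<subseteq> V \<and> card (F0 T) \<le> (1 - \<delta>) * card V" for T by simp
  have I0: "\<exists>T\<subseteq>I. card T \<le> t \<and> (\<forall>T'. T \<subseteq> T' \<longrightarrow> T' \<subseteq> I \<longrightarrow> I \<inter> (U - {v}) \<subseteq> F0 T' \<union> T')"
    if "I \<subseteq> V" "indep I" "v \<notin> I" for I using FI0 that by simp
  obtain F1 where FI1: "(\<forall>T. F1 T \<subseteq> V \<and> real (card (F1 T)) \<le> (1 - \<delta>) * real (card V)) \<and>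
     (\<forall>I\<subseteq>V. indep I \<and> v \<in> I \<longrightarrow> (\<exists>T\<subseteq>I. card T \<le> t - 1 \<and>
       (\<forall>T'. T \<subseteq> T' \<longrightarrow> T' \<subseteq> I \<longrightarrow> I \<inter> (U - {v}) \<subseteq> F1 T' \<union> T')))"
    using yes unfolding has_containers_def ..
  hence F1: "F1 T \<subseteq> V \<and> card (F1 T) \<le> (1 - \<delta>) * card V" for T by simp
  have I1: "\<exists>T\<subseteq>I. card T \<le> t - 1 \<and> (\<forall>T'. T \<subseteq> T' \<longrightarrow> T' \<subseteq> I \<longrightarrow> I \<inter> (U - {v}) \<subseteq> F1 T' \<union> T')"
    if "I \<subseteq> V" "indep I" "v \<in> I" for I using FI1 that by simp
  let ?F = "\<lambda>T. if v \<in> T then F1 T else F0 T"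
  have "\<exists>T\<subseteq>I. card T \<le> t \<and> (\<forall>T'. T \<subseteq> T' \<longrightarrow> T' \<subseteq> I \<longrightarrow> I \<inter> U \<subseteq> ?F T' \<union> T')" if I: "I \<subseteq> V" "indep I" for I
  proof (cases "v \<in> I")
    case True
    obtain T where T: "T \<subseteq> I" "card T \<le> t - 1"
      and T': "\<forall>T'. T \<subseteq> T' \<longrightarrow> T' \<subseteq> I \<longrightarrow> I \<inter> (U - {v}) \<subseteq> F1 T' \<union> T'"
      using I1[OF I True] by (elim exE conjE)
    have "card (insert v T) \<le> t" using card_insert_le_m1[of t T v] T t by simp
    moreover have "I \<inter> U \<subseteq> ?F T' \<union> T'" if "insert v T \<subseteq> T'" "T' \<subseteq> I" for T'
    proof -
      have "I \<inter> (U - {v}) \<subseteq> F1 T' \<union> T'" using T' that by blast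
      thus ?thesis using that by auto
    qed
    ultimately show ?thesis using T True by (intro exI[of _ "insert v T"]) auto
  next
    case False
    obtain T where T: "T \<subseteq> I" "card T \<le> t"
      and T': "\<forall>T'. T \<subseteq> T' \<longrightarrow> T' \<subseteq> I \<longrightarrow> I \<inter> (U - {v}) \<subseteq> F0 T' \<union> T'"
      using I0[OF I False] by (elim exE conjE)
    have "I \<inter> U \<subseteq> ?F T' \<union> T'" if "T \<subseteq> T'" "T' \<subseteq> I" for T'
    proof -
      have "I \<inter> (U - {v}) \<subseteq> F0 T' \<union> T'" using T' that by blast
      thus ?thesis using that False by auto
    qed
    thus ?thesis using T by blast
  qed
  moreover have "?F T \<subseteq> V \<and> card (?F T) \<le> (1 - \<delta>) * card V" for T using F0[of T] F1[of T] by simp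
  ultimately show ?thesis unfolding has_containers_def
    by (intro exI[of _ ?F] conjI[OF allI allI[OF impI[OF impI]]])
qed

lemma sum_le_sum_cover:
  fixes h :: "'b \<Rightarrow> real"
  assumes "finite A" "finite P" "\<And>S. h S \<ge> 0" "\<And>S. S \<in> P \<Longrightarrow> h S \<noteq> 0 \<Longrightarrow> \<exists>a\<in>A. R a S"
  shows "sum h P \<le> (\<Sum>a\<in>A. sum h {S \<in> P. R a S})"
proof -
  have "h S \<le> (\<Sum>a\<in>A. if R a S then h S else 0)" if S: "S \<in> P" for S
  proof (cases "h S = 0")
    case True
    then show ?thesis using assms(3) by (simp add: sum_nonneg)
  next
    case False
    then obtain a where a: "a \<in> A" "R a S" using assms(4)[OF S] by blast
    have "(if R a S then h S else 0) \<le> (\<Sum>a\<in>A. if R a S then h S else 0)"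
      by (rule member_le_sum) (use a assms in auto)
    thus ?thesis using a by simp
  qed
  hence "sum h P \<le> (\<Sum>S\<in>P. \<Sum>a\<in>A. if R a S then h S else 0)" by (rule sum_mono)
  also have "\<dots> = (\<Sum>a\<in>A. \<Sum>S\<in>P. if R a S then h S else 0)" by (rule sum.swap)
  also have "\<dots> = (\<Sum>a\<in>A. sum h {S \<in> P. R a S})"
    by (intro sum.cong refl sum.inter_filter[OF assms(2), symmetric])
  finally show ?thesis .
qed

lemma sum_link:
  fixes h :: "'b set \<Rightarrow> real"
  assumes "finite V" "v \<in> V" "v \<notin> \<sigma>"
  shows "(\<Sum>f\<in>{f \<in> Pow V. \<sigma> \<subseteq> f}. if v \<notin> f then h (insert v f) else 0) = sum h {S \<in> Pow V. insert v \<sigma> \<subseteq> S}"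
    (is "?lhs = _")
proof -
  have "?lhs = (\<Sum>f\<in>{f \<in> {f \<in> Pow V. \<sigma> \<subseteq> f}. v \<notin> f}. h (insert v f))"
    by (rule sum.inter_filter[symmetric]) (use assms in simp)
  also have "\<dots> = sum h {S \<in> Pow V. insert v \<sigma> \<subseteq> S}"
    by (rule sum.reindex_bij_witness[where i = "\<lambda>S. S - {v}" and j = "insert v"]) (use assms in auto)
  finally show ?thesis .
qed

text \<open>A hyperedge of size q is counted once for each of its subsets. Applied to the saturated
  sets, this bounds their total degree without control of their number.\<close>

lemma sum_weight_degree_le:
  assumes "finite V" "\<And>S. 0 \<le> w S" "\<And>S. w S \<noteq> 0 \<Longrightarrow> S \<subseteq> V \<and> card S = q" "A \<subseteq> Pow V"
  shows "(\<Sum>\<sigma>\<in>A. weight_degree V w \<sigma>) \<le> 2 ^ q * sum w (Pow V)"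
proof -
  have "(\<Sum>\<sigma>\<in>A. weight_degree V w \<sigma>) \<le> (\<Sum>\<sigma>\<in>Pow V. weight_degree V w \<sigma>)"
    using assms by (intro sum_mono2) (auto simp: weight_degree_def intro!: sum_nonneg)
  also have "\<dots> = (\<Sum>\<sigma>\<in>Pow V. \<Sum>S\<in>Pow V. if \<sigma> \<subseteq> S then w S else 0)"
    unfolding weight_degree_def using assms(1) by (intro sum.cong refl sum.inter_filter) auto
  also have "\<dots> = (\<Sum>S\<in>Pow V. \<Sum>\<sigma>\<in>Pow V. if \<sigma> \<subseteq> S then w S else 0)" by (rule sum.swap)
  also have "\<dots> = (\<Sum>S\<in>Pow V. 2 ^ q * w S)"
  proof (intro sum.cong refl)
    fix S assume S: "S \<in> Pow V"
    have "(\<Sum>\<sigma>\<in>Pow V. if \<sigma> \<subseteq> S then w S else 0) = (\<Sum>\<sigma>\<in>{\<sigma> \<in> Pow V. \<sigma> \<subseteq> S}. w S)"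
      by (rule sum.inter_filter[symmetric]) (use assms in simp)
    also have "{\<sigma> \<in> Pow V. \<sigma> \<subseteq> S} = Pow S" using S by auto
    also have "(\<Sum>\<sigma>\<in>Pow S. w S) = 2 ^ card S * w S"
      using S finite_subset[OF _ assms(1), of S] by (simp add: card_Pow)
    also have "\<dots> = 2 ^ q * w S" using assms(3)[of S] by (cases "w S = 0") auto
    finally show "(\<Sum>\<sigma>\<in>Pow V. if \<sigma> \<subseteq> S then w S else 0) = 2 ^ q * w S" .
  qed
  also have "\<dots> = 2 ^ q * sum w (Pow V)" by (simp add: sum_distrib_left)
  finally show ?thesis .
qed

text \<open>One stage of the algorithm: vertices of large degree in the part of \<open>w\<close> that is still available are
  queried, and the links of those that belong to the independent set are collected in a weight \<open>u\<close> of
  uniformity one less. A set \<open>S\<close> is available if it has no queried vertex and no subset whose degree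
  in \<open>u\<close> has reached the threshold \<open>L D (b / N)\<^bsup>|\<sigma>|\<^esup> / N\<close>.\<close>

lemma container_round:
  fixes w :: "'b set \<Rightarrow> real"
  assumes V: "finite V" "V \<noteq> {}" and b: "b \<ge> 1" and D: "D \<ge> 1" and w: "spread_weight V b (Suc q) D w"
    and lam: "L = 4 * 2 ^ Suc q * D" and \<delta>: "\<delta> \<le> 1 / (4 * D)"
    and last: "\<And>u. spread_weight V b q (2 * (L + 1) * D) u \<Longrightarrow>
      has_containers V V (q * b) \<delta> (\<lambda>I. \<forall>S\<subseteq>I. u S = 0)"
    and "U \<subseteq> V" "j \<le> b"
    and "\<And>S. 0 \<le> u S" "\<And>S. u S \<noteq> 0 \<Longrightarrow> S \<subseteq> V \<and> card S = q"
    and "\<And>\<sigma>. \<sigma> \<noteq> {} \<Longrightarrow> \<sigma> \<subseteq> V \<Longrightarrow> card \<sigma> \<le> q \<Longrightarrow>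
       weight_degree V u \<sigma> \<le> (L + 1) * D * (b / card V) ^ card \<sigma> / card V"
    and "(real b - real j) / (2 * card V) \<le> sum u (Pow V)"
    and "sum u (Pow V) \<le> (real b - real j) * D / card V"
  shows "has_containers V U (j + q * b) \<delta> (\<lambda>I. (\<forall>S\<subseteq>I. w S = 0) \<and> (\<forall>S\<subseteq>I. u S = 0))"
  using assms(9-15)
proof (induction "card U" arbitrary: U j u rule: less_induct)
  case less
  note U = less.prems(1) and j = less.prems(2) and u0 = less.prems(3) and usupp = less.prems(4)
    and udeg = less.prems(5) and umass_ge = less.prems(6) and umass_le = less.prems(7)
  define N where "N = real (card V)"
  define \<tau> where "\<tau> = b / N"
  have N: "N > 0" using V by (simp add: N_def card_gt_0_iff)
  have \<tau>: "\<tau> > 0" using b N by (simp add: \<tau>_def)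
  have L: "L > 0" using D by (simp add: lam)
  have finU: "finite U" using U V finite_subset by blast
  have w0: "0 \<le> w S" for S using w by (simp add: spread_weight_def)
  have wsupp: "S \<subseteq> V \<and> card S = Suc q" if "w S \<noteq> 0" for S using w that by (simp add: spread_weight_def)
  have wmass: "1 \<le> sum w (Pow V)" using w by (simp add: spread_weight_def)
  have wdeg: "weight_degree V w \<sigma> \<le> D * \<tau> ^ (card \<sigma> - 1) / N" if "\<sigma> \<noteq> {}" "\<sigma> \<subseteq> V" "card \<sigma> \<le> Suc q" for \<sigma>
    using w that by (simp add: spread_weight_def \<tau>_def N_def)
  define sat where "sat = {\<sigma> \<in> Pow V. \<sigma> \<noteq> {} \<and> card \<sigma> \<le> q \<and> L * D * \<tau> ^ card \<sigma> / N \<le> weight_degree V u \<sigma>}"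
  define h where "h = (\<lambda>S. if S \<subseteq> U \<and> (\<forall>\<sigma>\<in>sat. \<not> \<sigma> \<subseteq> S) then w S else 0)"
  have h: "0 \<le> h S" "h S \<le> w S" for S using w0 by (auto simp: h_def)
  show ?case
  proof (cases "j = 0")
    case True
    \<comment> \<open>The budget is spent: u has weight at least b/(2N) = \<tau>/2. Rescaling by
      2/\<tau> normalizes it and also turns the exponent |\<sigma>| into |\<sigma>| - 1, as
      \<open>spread_weight\<close> demands.\<close>
    define u' where "u' = (\<lambda>S. 2 / \<tau> * u S)"
    have deg_u': "weight_degree V u' \<sigma> = 2 / \<tau> * weight_degree V u \<sigma>" for \<sigma>
      by (simp add: weight_degree_def u'_def sum_distrib_left)
    have "spread_weight V b q (2 * (L + 1) * D) u'"
      unfolding spread_weight_def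
    proof (intro conjI allI impI)
      show "0 \<le> u' S" for S using u0 \<tau> by (simp add: u'_def)
      show "S \<subseteq> V" "card S = q" if "u' S \<noteq> 0" for S using usupp[of S] that by (auto simp: u'_def)
      have "1 = 2 / \<tau> * ((real b - real j) / (2 * card V))"
        using True b N by (simp add: \<tau>_def N_def)
      also have "\<dots> \<le> 2 / \<tau> * sum u (Pow V)" using umass_ge \<tau> by (intro mult_left_mono) auto
      finally show "1 \<le> sum u' (Pow V)" by (simp add: u'_def sum_distrib_left)
    next
      fix \<sigma> assume \<sigma>: "\<sigma> \<noteq> {}" "\<sigma> \<subseteq> V" "card \<sigma> \<le> q"
      have "card \<sigma> = Suc (card \<sigma> - 1)"
        using \<sigma> V finite_subset[of \<sigma> V] by (simp add: card_gt_0_iff)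
      hence pow: "\<tau> ^ card \<sigma> = \<tau> * \<tau> ^ (card \<sigma> - 1)" by (metis power_Suc)
      have "weight_degree V u' \<sigma> \<le> 2 / \<tau> * ((L + 1) * D * \<tau> ^ card \<sigma> / N)"
        unfolding deg_u' using udeg[OF \<sigma>] \<tau> by (intro mult_left_mono) (auto simp: \<tau>_def N_def)
      also have "\<dots> = 2 * (L + 1) * D * \<tau> ^ (card \<sigma> - 1) / N" unfolding pow using \<tau> by simp
      finally show "weight_degree V u' \<sigma> \<le> 2 * (L + 1) * D * (b / card V) ^ (card \<sigma> - 1) / card V"
        by (simp add: \<tau>_def N_def)
    qed
    from last[OF this] show ?thesis
      by (rule has_containers_mono) (use U in \<open>auto simp: u'_def\<close>)
  next
    case j0: False
    show ?thesis
    \<comment> \<open>The threshold is such that, if all available degrees are below it, the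
      available weight is at most 1/2.\<close>
    proof (cases "\<exists>v\<in>U. 1 / (2 * N) \<le> weight_degree V h {v}")
      case True
      then obtain v where v: "v \<in> U" "1 / (2 * N) \<le> weight_degree V h {v}" by blast
      have vV: "v \<in> V" using v U by auto
      have smaller: "card (U - {v}) < card U" using v finU by (intro psubset_card_mono) auto
      define g where "g = (\<lambda>f. if v \<notin> f then h (insert v f) else 0)"
      define u' where "u' = (\<lambda>f. u f + g f)"
      have deg_u': "weight_degree V u' \<sigma> = weight_degree V u \<sigma> + weight_degree V g \<sigma>" for \<sigma>
        by (simp add: weight_degree_def u'_def sum.distrib)
      have deg_g: "weight_degree V g \<sigma> = weight_degree V h (insert v \<sigma>)" if "v \<notin> \<sigma>" for \<sigma>
        using sum_link[OF V(1) vV that, of h] unfolding weight_degree_def g_def .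
      have mass_eq: "sum f (Pow V) = weight_degree V f {}" for f by (simp add: weight_degree_def Pow_def)
      have deg_h: "weight_degree V h \<sigma> \<le> weight_degree V w \<sigma>" for \<sigma>
        unfolding weight_degree_def using h by (intro sum_mono) auto
      have mass_u': "sum u' (Pow V) = sum u (Pow V) + weight_degree V h {v}"
        unfolding mass_eq deg_u' using deg_g[of "{}"] by simp
      have jr: "real b - real (j - 1) = real b - real j + 1" using j0 by (simp add: of_nat_diff)
      show ?thesis
      proof (rule has_containers_query)
        show "has_containers V (U - {v}) (j + q * b) \<delta> (\<lambda>I. ((\<forall>S\<subseteq>I. w S = 0) \<and> (\<forall>S\<subseteq>I. u S = 0)) \<and> v \<notin> I)"
          by (rule has_containers_mono[OF less.hyps[OF smaller _ j u0 usupp udeg umass_ge umass_le]])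
             (use U in auto)
        have "has_containers V (U - {v}) (j - 1 + q * b) \<delta> (\<lambda>I. (\<forall>S\<subseteq>I. w S = 0) \<and> (\<forall>S\<subseteq>I. u' S = 0))"
        proof (rule less.hyps[OF smaller])
          show "U - {v} \<subseteq> V" "j - 1 \<le> b" using U j by auto
          show "0 \<le> u' S" for S using u0 h by (simp add: u'_def g_def)
          show "S \<subseteq> V \<and> card S = q" if "u' S \<noteq> 0" for S
          proof (cases "u S = 0")
            case True
            hence "v \<notin> S" "h (insert v S) \<noteq> 0" using that by (auto simp: u'_def g_def split: if_splits)
            hence "w (insert v S) \<noteq> 0" by (auto simp: h_def split: if_splits)
            from wsupp[OF this] \<open>v \<notin> S\<close> V show ?thesis
              using finite_subset[of "insert v S" V] by auto
          qed (use usupp in blast)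
          have "(real b - real j) / (2 * card V) + 1 / (2 * N) \<le> sum u' (Pow V)"
            unfolding mass_u' using umass_ge v(2) by linarith
          thus "(real b - real (j - 1)) / (2 * card V) \<le> sum u' (Pow V)"
            unfolding jr N_def by (simp add: add_divide_distrib)
          have "weight_degree V h {v} \<le> D / N"
            using deg_h[of "{v}"] wdeg[of "{v}"] vV by simp
          hence "sum u' (Pow V) \<le> (real b - real j) * D / card V + D / N"
            unfolding mass_u' using umass_le by linarith
          thus "sum u' (Pow V) \<le> (real b - real (j - 1)) * D / card V"
            unfolding jr N_def by (simp add: add_divide_distrib distrib_right)
        next
          fix \<sigma> assume \<sigma>: "\<sigma> \<noteq> {}" "\<sigma> \<subseteq> V" "card \<sigma> \<le> q"
          have finS: "finite \<sigma>" using \<sigma> V finite_subset by blast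
          have "weight_degree V u' \<sigma> \<le> (L + 1) * D * \<tau> ^ card \<sigma> / N"
          \<comment> \<open>The new link adds nothing above \<sigma> if \<sigma> contains v or is
            saturated. Otherwise the degree was below the threshold with factor L, and one link adds
            at most one further unit; hence L + 1 in the invariant.\<close>
          proof (cases "v \<in> \<sigma> \<or> \<sigma> \<in> sat")
            case True
            have "weight_degree V g \<sigma> = 0"
              unfolding weight_degree_def using True by (intro sum.neutral) (auto simp: g_def h_def)
            thus ?thesis unfolding deg_u' using udeg[OF \<sigma>] by (simp add: \<tau>_def N_def)
          next
            case False
            hence "weight_degree V u \<sigma> \<le> L * D * \<tau> ^ card \<sigma> / N" using \<sigma> by (auto simp: sat_def)
            moreover have "weight_degree V h (insert v \<sigma>) \<le> D * \<tau> ^ card \<sigma> / N"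
              using deg_h[of "insert v \<sigma>"] wdeg[of "insert v \<sigma>"] \<sigma> False vV finS by simp
            ultimately show ?thesis unfolding deg_u' using False
              by (simp add: deg_g distrib_right add_divide_distrib)
          qed
          thus "weight_degree V u' \<sigma> \<le> (L + 1) * D * (b / card V) ^ card \<sigma> / card V"
            by (simp add: \<tau>_def N_def)
        qed
        thus "has_containers V (U - {v}) (j + q * b - 1) \<delta> (\<lambda>I. ((\<forall>S\<subseteq>I. w S = 0) \<and> (\<forall>S\<subseteq>I. u S = 0)) \<and> v \<in> I)"
          by (rule has_containers_mono) (use j0 in \<open>auto simp: u'_def g_def h_def\<close>)
        show "1 \<le> j + q * b" using j0 by simp
      qed
    next
      case False
      \<comment> \<open>The weight is split into available hyperedges, hyperedges with a queried
        vertex, and hyperedges above a saturated set. The first and third parts are at most 3/4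
        together, so at least N/(4D) vertices have been removed from U, and U itself serves as
        container with empty fingerprint.\<close>
      have "1 \<le> sum w (Pow V)" by (rule wmass)
      also have "\<dots> \<le> (\<Sum>S\<in>Pow V. h S + (if S \<subseteq> U then 0 else w S) + (if \<exists>\<sigma>\<in>sat. \<sigma> \<subseteq> S then w S else 0))"
        using w0 by (intro sum_mono) (auto simp: h_def)
      also have "\<dots> = sum h (Pow V) + (\<Sum>S\<in>Pow V. if S \<subseteq> U then 0 else w S)
          + (\<Sum>S\<in>Pow V. if \<exists>\<sigma>\<in>sat. \<sigma> \<subseteq> S then w S else 0)"
        by (simp add: sum.distrib)
      also have "sum h (Pow V) \<le> 1 / 2"
      proof -
        have "sum h (Pow V) \<le> (\<Sum>v\<in>U. sum h {S \<in> Pow V. {v} \<subseteq> S})"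
        proof (rule sum_le_sum_cover[OF finU])
          fix S assume "h S \<noteq> 0"
          hence "w S \<noteq> 0" "S \<subseteq> U" by (auto simp: h_def split: if_splits)
          moreover from this have "S \<noteq> {}" using wsupp[of S] by auto
          ultimately show "\<exists>v\<in>U. {v} \<subseteq> S" by auto
        qed (use V h in auto)
        also have "\<dots> \<le> (\<Sum>v\<in>U. 1 / (2 * N))"
          using False by (intro sum_mono) (auto simp: weight_degree_def)
        also have "\<dots> \<le> N * (1 / (2 * N))"
          using card_mono[OF V(1) U] N by (simp add: N_def divide_right_mono)
        finally show ?thesis using N by simp
      qed
      also have "(\<Sum>S\<in>Pow V. if S \<subseteq> U then 0 else w S) \<le> card (V - U) * (D / N)"
      proof -
        let ?k = "\<lambda>S. if S \<subseteq> U then 0 else w S"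
        have "sum ?k (Pow V) \<le> (\<Sum>v\<in>V - U. sum ?k {S \<in> Pow V. {v} \<subseteq> S})"
        proof (rule sum_le_sum_cover)
          fix S assume "S \<in> Pow V" "?k S \<noteq> 0"
          hence "\<not> S \<subseteq> U" "S \<subseteq> V" by (auto split: if_splits)
          thus "\<exists>v\<in>V - U. {v} \<subseteq> S" by blast
        qed (use V w0 in auto)
        also have "\<dots> \<le> (\<Sum>v\<in>V - U. D / N)"
        proof (rule sum_mono)
          fix v assume v: "v \<in> V - U"
          have "sum ?k {S \<in> Pow V. {v} \<subseteq> S} \<le> weight_degree V w {v}"
            unfolding weight_degree_def using w0 by (intro sum_mono) auto
          also have "\<dots> \<le> D / N" using wdeg[of "{v}"] v by simp
          finally show "sum ?k {S \<in> Pow V. {v} \<subseteq> S} \<le> D / N" .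
        qed
        finally show ?thesis by simp
      qed
      \<comment> \<open>A saturated \<sigma> has degree in u at least L \<tau> times the cap on its
        degree in w. The lost weight is thus at most the total u-degree of saturated sets divided by
        L \<tau>, which is at most 2^q D / L; this determines L.\<close>
      also have "(\<Sum>S\<in>Pow V. if \<exists>\<sigma>\<in>sat. \<sigma> \<subseteq> S then w S else 0) \<le> 1 / 4"
      proof -
        let ?k = "\<lambda>S. if \<exists>\<sigma>\<in>sat. \<sigma> \<subseteq> S then w S else 0"
        have fin: "finite sat" unfolding sat_def using V by simp
        have "sum ?k (Pow V) \<le> (\<Sum>\<sigma>\<in>sat. sum ?k {S \<in> Pow V. \<sigma> \<subseteq> S})"
          by (rule sum_le_sum_cover) (use V fin w0 in \<open>auto split: if_splits\<close>)
        also have "\<dots> \<le> (\<Sum>\<sigma>\<in>sat. weight_degree V u \<sigma> / (L * \<tau>))"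
        proof (rule sum_mono)
          fix \<sigma> assume "\<sigma> \<in> sat"
          hence \<sigma>: "\<sigma> \<noteq> {}" "\<sigma> \<subseteq> V" "card \<sigma> \<le> q" "L * D * \<tau> ^ card \<sigma> / N \<le> weight_degree V u \<sigma>"
            by (auto simp: sat_def)
          have "card \<sigma> = Suc (card \<sigma> - 1)"
            using \<sigma> V finite_subset[of \<sigma> V] by (simp add: card_gt_0_iff)
          hence pow: "\<tau> ^ card \<sigma> = \<tau> * \<tau> ^ (card \<sigma> - 1)" by (metis power_Suc)
          have "sum ?k {S \<in> Pow V. \<sigma> \<subseteq> S} \<le> weight_degree V w \<sigma>"
            unfolding weight_degree_def using w0 by (intro sum_mono) auto
          also have "\<dots> \<le> D * \<tau> ^ (card \<sigma> - 1) / N" using wdeg[OF \<sigma>(1,2)] \<sigma>(3) by simp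
          also have "\<dots> = (L * D * \<tau> ^ card \<sigma> / N) / (L * \<tau>)" unfolding pow using L \<tau> by simp
          also have "\<dots> \<le> weight_degree V u \<sigma> / (L * \<tau>)"
            using \<sigma>(4) L \<tau> by (intro divide_right_mono) auto
          finally show "sum ?k {S \<in> Pow V. \<sigma> \<subseteq> S} \<le> weight_degree V u \<sigma> / (L * \<tau>)" .
        qed
        also have "\<dots> = (\<Sum>\<sigma>\<in>sat. weight_degree V u \<sigma>) / (L * \<tau>)" by (simp add: sum_divide_distrib)
        also have "\<dots> \<le> 2 ^ q * sum u (Pow V) / (L * \<tau>)"
          using L \<tau> by (intro divide_right_mono sum_weight_degree_le[OF V(1) u0 usupp]) (auto simp: sat_def)
        also have "\<dots> \<le> 2 ^ q * (D * \<tau>) / (L * \<tau>)"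
        proof (intro divide_right_mono mult_left_mono)
          have "(real b - real j) * D / N \<le> real b * D / N" using D N by (intro divide_right_mono mult_right_mono) auto
          thus "sum u (Pow V) \<le> D * \<tau>" using umass_le by (simp add: \<tau>_def N_def mult.commute)
        qed (use L \<tau> in auto)
        also have "\<dots> = 1 / 8" using \<tau> D by (simp add: lam)
        finally show ?thesis by simp
      qed
      finally have "1 / 4 \<le> card (V - U) * (D / N)" by linarith
      hence "N / (4 * D) \<le> card (V - U)" using N D by (simp add: field_simps)
      moreover have "\<delta> * N \<le> 1 / (4 * D) * N" using \<delta> N by (intro mult_right_mono) auto
      moreover have "real (card (V - U)) = N - card U"
        unfolding N_def using U V finU by (simp add: card_Diff_subset card_mono of_nat_diff)
      ultimately have "card U \<le> (1 - \<delta>) * card V" by (simp add: N_def left_diff_distrib)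
      thus ?thesis unfolding has_containers_def
        by (intro exI[of _ "\<lambda>_. U"] conjI allI impI exI[of _ "{}"]) (use U in auto)
    qed
  qed
qed

text \<open>Induction on the uniformity. A round either ends with a small set U or yields a weight
  of uniformity one less that is again spread, with \<open>2 * (L + 1) * D\<close> in place of D.
  Each round adds at most b elements to the fingerprint, and \<delta> depends on D and r
  alone.\<close>

theorem hypergraph_containers:
  assumes "D \<ge> 1"
  shows "\<exists>\<delta>>0. \<delta> < 1 \<and> (\<forall>(V :: 'b set) b w. finite V \<longrightarrow> V \<noteq> {} \<longrightarrow> b \<ge> 1 \<longrightarrow> spread_weight V b r D w \<longrightarrow>
    has_containers V V (r * b) \<delta> (\<lambda>I. \<forall>S\<subseteq>I. w S = 0))"
  using assms
proof (induction r arbitrary: D)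
  case 0
  show ?case
  proof (intro exI[of _ "1 / 2"] conjI allI impI)
    fix V :: "'b set" and b and w :: "'b set \<Rightarrow> real"
    assume V: "finite V" and w: "spread_weight V b 0 D w"
    \<comment> \<open>In uniformity 0 all weight sits on the empty set, which lies in every I; no I
      is independent and the claim about fingerprints is vacuous.\<close>
    have "S = {}" if "w S \<noteq> 0" for S
      using w that V finite_subset[of S V] by (auto simp: spread_weight_def)
    hence "sum w (Pow V) = sum w {{}}" using V by (intro sum.mono_neutral_right) auto
    hence "w {} \<noteq> 0" using w by (auto simp: spread_weight_def)
    thus "has_containers V V (0 * b) (1 / 2) (\<lambda>I. \<forall>S\<subseteq>I. w S = 0)"
      unfolding has_containers_def by (intro exI[of _ "\<lambda>_. {}"]) auto
  qed auto
next
  case (Suc q)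
  define L where "L = 4 * 2 ^ Suc q * D"
  have L: "L > 0" using Suc.prems by (simp add: L_def)
  have "1 * 1 \<le> (2 * (L + 1)) * D" using L Suc.prems by (intro mult_mono) auto
  then obtain \<delta> where \<delta>: "\<delta> > 0" "\<delta> < 1" and IH: "\<And>(V :: 'b set) b w. finite V \<Longrightarrow> V \<noteq> {} \<Longrightarrow> b \<ge> 1 \<Longrightarrow>
    spread_weight V b q (2 * (L + 1) * D) w \<Longrightarrow> has_containers V V (q * b) \<delta> (\<lambda>I. \<forall>S\<subseteq>I. w S = 0)"
    using Suc.IH[of "2 * (L + 1) * D"] by auto
  define \<delta>' where "\<delta>' = min \<delta> (1 / (4 * D))"
  show ?case
  proof (intro exI[of _ \<delta>'] conjI allI impI)
    show "\<delta>' > 0" "\<delta>' < 1" using \<delta> Suc.prems by (auto simp: \<delta>'_def)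
    fix V :: "'b set" and b and w :: "'b set \<Rightarrow> real"
    assume V: "finite V" "V \<noteq> {}" and b: "b \<ge> 1" and w: "spread_weight V b (Suc q) D w"
    have "has_containers V V (b + q * b) \<delta>' (\<lambda>I. (\<forall>S\<subseteq>I. w S = 0) \<and> (\<forall>S\<subseteq>I. (\<lambda>_. 0 :: real) S = 0))"
    proof (rule container_round[OF V b Suc.prems w L_def])
      show "\<delta>' \<le> 1 / (4 * D)" by (simp add: \<delta>'_def)
      show "has_containers V V (q * b) \<delta>' (\<lambda>I. \<forall>S\<subseteq>I. u S = 0)"
        if "spread_weight V b q (2 * (L + 1) * D) u" for u
        by (rule has_containers_mono[OF IH[OF V b that]]) (auto simp: \<delta>'_def)
    qed (use L Suc.prems in \<open>auto simp: weight_degree_def\<close>)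
    thus "has_containers V V (Suc q * b) \<delta>' (\<lambda>I. \<forall>S\<subseteq>I. w S = 0)" by simp
  qed
qed

section \<open>Containers for cycle-free graphs\<close>

lemma cycles_in_memD:
  assumes "S \<in> cycles_in l V E" "l \<ge> 2"
  shows "S \<subseteq> E" "card S = 2 * l"
proof -
  obtain xs where xs: "distinct xs" "length xs = 2 * l" "S = cycle_edges xs" "cycle_edges xs \<subseteq> E"
    using assms(1) by (auto simp: cycles_in_def)
  show "S \<subseteq> E" using xs by simp
  show "card S = 2 * l" using card_cycle_edges[OF xs(1)] xs assms(2) by simp
qed

text \<open>With x = n^2/e, the sample size is (4 C x)^(l/(l-1)) rounded up, the least allowed by
  the density hypothesis of \<open>spread_cycle_weights\<close>; the lower bound on e ensures that
  it is at most n. Proper parts of cycles require b/e >= s/n, which gives the term n x^(1/(l-1)).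
  Full cycles require a bound on (b/e)^(2l-1), which gives the other term.\<close>

lemma cycle_containers:
  fixes l :: nat
  assumes l: "l \<ge> 2"
  shows "\<exists>A B \<delta>. A \<ge> (1::real) \<and> B \<ge> (1::real) \<and> 0 < \<delta> \<and> \<delta> < 1 \<and>
    (\<forall>(V :: 'a set) E n. finite V \<longrightarrow> n = card V \<longrightarrow> E \<subseteq> all_edges V \<longrightarrow> E \<noteq> {} \<longrightarrow>
      A * real n powr (1 + 1 / l) \<le> card E \<longrightarrow>
      (\<exists>t. real t \<le> B * (n * ((real n)\<^sup>2 / card E) powr (1 / (real l - 1)) + real n powr (1 + 1 / (2 * real l - 1))) \<and>
        has_containers E E t \<delta> (\<lambda>I. cycles_in l V I = {})))"
proof -
  obtain C :: real where C: "C \<ge> 1" and weights: "\<forall>(V :: 'a set) E s. finite V \<longrightarrow> E \<subseteq> all_edges V \<longrightarrow>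
    2 \<le> s \<longrightarrow> s \<le> card V \<longrightarrow> E \<noteq> {} \<longrightarrow> 4 * C * (real (card V))\<^sup>2 \<le> real s powr (1 - 1 / l) * card E \<longrightarrow>
    (\<exists>w. (\<forall>S. w S \<ge> (0 :: real)) \<and> (\<forall>S. w S \<noteq> 0 \<longrightarrow> S \<in> cycles_in l V E) \<and> sum w (Pow E) \<ge> 1 \<and>
      (\<forall>\<sigma>. \<sigma> \<noteq> {} \<longrightarrow> \<sigma> \<subseteq> E \<longrightarrow> card \<sigma> < 2 * l \<longrightarrow>
         sum w {S \<in> Pow E. \<sigma> \<subseteq> S} \<le> 8 * l * (s / card V) ^ (card \<sigma> - 1) / card E) \<and>
      (\<forall>\<sigma>. \<sigma> \<subseteq> E \<longrightarrow> card \<sigma> = 2 * l \<longrightarrow>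
         sum w {S \<in> Pow E. \<sigma> \<subseteq> S} \<le> 8 * l * (s / card V) ^ (2 * l - 2)
           / (card E * real (nat \<lfloor>real s powr (1 - 1 / l)\<rfloor>))))"
    using spread_cycle_weights[OF l, where 'a = 'a] by (elim exE conjE)
  have "8 * real l \<ge> 1" using l by simp
  from hypergraph_containers[OF this, of "2 * l", where 'b = "'a set"]
  obtain \<delta> where \<delta>: "\<delta> > 0" "\<delta> < 1" and containers: "\<forall>(E :: 'a set set) b w. finite E \<longrightarrow> E \<noteq> {} \<longrightarrow>
    b \<ge> 1 \<longrightarrow> spread_weight E b (2 * l) (8 * real l) w \<longrightarrow> has_containers E E (2 * l * b) \<delta> (\<lambda>I. \<forall>S\<subseteq>I. w S = 0)"
    by (elim exE conjE)
  define \<kappa> where "\<kappa> = real l / (real l - 1)"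
  \<comment> \<open>The factor 2 pays for rounding s up to an integer.\<close>
  define G where "G = 2 * (4 * C) powr \<kappa>"
  have \<kappa>: "\<kappa> > 0" "\<kappa> - 1 = 1 / (real l - 1)" "\<kappa> * (1 - 1 / l) = 1" "\<kappa> * (2 * real l - 2) = 2 * l"
    using l by (auto simp: \<kappa>_def field_simps)
  have G: "G \<ge> 1"
  proof -
    have "(4 * C) powr \<kappa> \<ge> 1" using C \<kappa> by (intro ge_one_powr_ge_zero) auto
    thus ?thesis by (simp add: G_def)
  qed
  show ?thesis
  proof (rule exI[of _ "4 * C"], rule exI[of _ "4 * real l * G"], rule exI[of _ \<delta>], intro conjI allI impI)
    show "4 * C \<ge> 1" using C by simp
    have "4 * real l * G \<ge> 1 * 1" using G l by (intro mult_mono) auto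
    thus "4 * real l * G \<ge> 1" by simp
    show "0 < \<delta>" "\<delta> < 1" by fact+
    fix V :: "'a set" and E :: "'a set set" and n :: nat
    assume V: "finite V" "n = card V" and E: "E \<subseteq> all_edges V" "E \<noteq> {}"
      and big: "4 * C * real n powr (1 + 1 / l) \<le> card E"
    define e where "e = real (card E)"
    define x where "x = (real n)\<^sup>2 / e"
    have finE: "finite E" using E finite_all_edges[OF V(1)] finite_subset by blast
    have e: "e \<ge> 1" using finE E by (simp add: e_def Suc_leI card_gt_0_iff)
    obtain d where "d \<in> E" using E by blast
    hence "V \<noteq> {}" using E by (force simp: all_edges_def)
    hence n: "real n \<ge> 1" using V by (simp add: Suc_leI card_gt_0_iff)
    have ex: "e * x = (real n)\<^sup>2" using e by (simp add: x_def)
    have "card E \<le> n\<^sup>2"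
    proof -
      have "real (card E) \<le> adj E V V" by (rule card_edges_le_adj[OF V(1) E(1)])
      also have "\<dots> \<le> (\<Sum>x\<in>V. \<Sum>y\<in>V. 1)" unfolding adj_def by (intro sum_mono) auto
      also have "\<dots> = real (n\<^sup>2)" by (simp add: V(2) power2_eq_square)
      finally show ?thesis by (simp only: of_nat_le_iff)
    qed
    hence "e \<le> (real n)\<^sup>2" unfolding e_def by (metis of_nat_le_iff of_nat_power)
    hence x: "x \<ge> 1" using e by (simp add: x_def)
    define y where "y = (4 * C * x) powr \<kappa>"
    define s where "s = nat \<lceil>y\<rceil>"
    have "1 * 1 \<le> C * x" using C x by (intro mult_mono) auto
    hence "1 < 4 * C * x" by simp
    hence y1: "y > 1" unfolding y_def using \<kappa>(1) by (rule gr_one_powr)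
    hence "real s = of_int \<lceil>y\<rceil>" by (simp add: s_def)
    hence s: "real s \<ge> y" "real s \<le> 2 * y" using ceiling_correct[of y] y1 by linarith+
    have s2: "2 \<le> s" using s y1 by linarith
    have yG: "2 * y = G * x powr \<kappa>" using C x by (simp add: y_def G_def powr_mult)
    have ypow: "y powr (1 - 1 / l) = 4 * C * x" using C x by (simp add: y_def powr_powr \<kappa>)
    have sn: "s \<le> n"
    proof -
      have "4 * C * x * e \<le> real n powr (1 - 1 / l) * e"
      proof -
        have "4 * C * real n powr (1 + 1 / l) * real n powr (1 - 1 / l) \<le> e * real n powr (1 - 1 / l)"
          using big unfolding e_def by (rule mult_right_mono) simp
        moreover have "real n powr (1 + 1 / l) * real n powr (1 - 1 / l) = (real n)\<^sup>2"
          using n by (simp add: powr_add[symmetric] powr_numeral)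
        ultimately show ?thesis by (simp add: ex[symmetric] mult_ac)
      qed
      hence "4 * C * x \<le> real n powr (1 - 1 / l)" using e by simp
      hence "y \<le> (real n powr (1 - 1 / l)) powr \<kappa>"
        unfolding y_def using C x \<kappa> by (intro powr_mono2) auto
      also have "\<dots> = n" using n \<kappa>(3) by (simp add: powr_powr mult.commute)
      finally show ?thesis by (simp add: s_def nat_le_iff ceiling_le_iff)
    qed
    have spow: "4 * C * x \<le> real s powr (1 - 1 / l)"
      unfolding ypow[symmetric] using s y1 l by (intro powr_mono2) auto
    have "4 * C * (real (card V))\<^sup>2 \<le> real s powr (1 - 1 / l) * card E"
      using mult_right_mono[OF spow, of e] e unfolding V(2)[symmetric] e_def[symmetric]
      by (simp add: ex[symmetric] mult_ac)
    from weights[rule_format, OF V(1) E(1) s2 sn[unfolded V(2)] E(2) this, folded V(2)]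
    obtain w where w: "\<forall>S. w S \<ge> (0::real)" "\<forall>S. w S \<noteq> 0 \<longrightarrow> S \<in> cycles_in l V E" "sum w (Pow E) \<ge> 1"
      and deg: "\<forall>\<sigma>. \<sigma> \<noteq> {} \<longrightarrow> \<sigma> \<subseteq> E \<longrightarrow> card \<sigma> < 2 * l \<longrightarrow>
         sum w {S \<in> Pow E. \<sigma> \<subseteq> S} \<le> 8 * l * (s / n) ^ (card \<sigma> - 1) / card E"
      and deg_full: "\<forall>\<sigma>. \<sigma> \<subseteq> E \<longrightarrow> card \<sigma> = 2 * l \<longrightarrow>
         sum w {S \<in> Pow E. \<sigma> \<subseteq> S} \<le> 8 * l * (s / n) ^ (2 * l - 2)
           / (card E * real (nat \<lfloor>real s powr (1 - 1 / l)\<rfloor>))"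
      by (elim exE conjE)
    define \<beta> where "\<beta> = n * x powr (1 / (real l - 1)) + real n powr (1 + 1 / (2 * real l - 1))"
    define b where "b = nat \<lceil>G * \<beta>\<rceil>"
    have \<beta>: "\<beta> \<ge> 1"
    proof -
      have "real n powr (1 + 1 / (2 * real l - 1)) \<ge> 1" using n l by (intro ge_one_powr_ge_zero) auto
      thus ?thesis by (simp add: \<beta>_def add_increasing)
    qed
    have "1 * 1 \<le> G * \<beta>" using G \<beta> by (intro mult_mono) auto
    hence G\<beta>: "1 \<le> G * \<beta>" by simp
    hence "real b = of_int \<lceil>G * \<beta>\<rceil>" by (simp add: b_def)
    hence b: "real b \<ge> G * \<beta>" "real b \<le> 2 * (G * \<beta>)" using ceiling_correct[of "G * \<beta>"] G\<beta> by linarith+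
    have b1: "b \<ge> 1" using b(1) G\<beta> by linarith
    have tau: "real s / n \<le> b / e"
    proof -
      have "s * e \<le> G * x powr \<kappa> * e" using s yG e by (intro mult_right_mono) auto
      also have "x powr \<kappa> = x * x powr (1 / (real l - 1))"
        using x powr_add[of x 1 "\<kappa> - 1"] unfolding \<kappa>(2)[symmetric] by simp
      also have "G * (x * x powr (1 / (real l - 1))) * e = (e * x) * (G * x powr (1 / (real l - 1)))"
        by (simp add: mult_ac)
      also have "\<dots> = n * (G * (n * x powr (1 / (real l - 1))))"
        unfolding ex by (simp add: power2_eq_square mult_ac)
      also have "\<dots> \<le> n * (G * \<beta>)" using G by (intro mult_left_mono) (auto simp: \<beta>_def)
      also have "\<dots> \<le> real n * real b" using b(1) by (intro mult_left_mono) auto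
      finally show ?thesis using n e by (simp add: field_simps)
    qed
    define \<Delta> where "\<Delta> = real (nat \<lfloor>real s powr (1 - 1 / l)\<rfloor>)"
    \<comment> \<open>Rounding s^(1-1/l) down costs less than 1, which is absorbed by 4 C x >= x +
      1.\<close>
    have \<Delta>: "\<Delta> \<ge> x"
    proof -
      have "C * x \<ge> 1 * x" using C x by (intro mult_right_mono) auto
      hence "real s powr (1 - 1 / l) \<ge> x + 1" using spow x by linarith
      thus ?thesis unfolding \<Delta>_def by linarith
    qed
    \<comment> \<open>Up to powers of G the left side is at most x^(2l) / n^(2l-2) divided by x,
      because \<kappa> (2l - 2) = 2l. Substituting x = n^2/e gives n^(2l) / e^(2l-1), whose
      (2l-1)-th root is n^(1+1/(2l-1)) / e.\<close>
    have tau_full: "(real s / n) ^ (2 * l - 2) / \<Delta> \<le> (b / e) ^ (2 * l - 1)"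
    proof -
      have r: "real (2 * l - 1) = 2 * real l - 1" "real (2 * l - 2) = 2 * real l - 2"
        using l by (auto simp: of_nat_diff)
      have l2: "2 * l - 1 = Suc (2 * l - 2)" using l by simp
      have "(real s / n) ^ (2 * l - 2) \<le> (G * x powr \<kappa> / n) ^ (2 * l - 2)"
        using s yG n by (intro power_mono divide_right_mono) auto
      also have "\<dots> = G ^ (2 * l - 2) * x ^ (2 * l) / n ^ (2 * l - 2)"
      proof -
        have "(x powr \<kappa>) ^ (2 * l - 2) = (x powr \<kappa>) powr real (2 * l - 2)"
          using x by (intro powr_realpow[symmetric]) auto
        also have "\<dots> = x powr real (2 * l)" by (simp only: powr_powr r \<kappa>(4))
        also have "\<dots> = x ^ (2 * l)" using x by (intro powr_realpow) auto
        finally show ?thesis by (simp add: power_divide power_mult_distrib)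
      qed
      finally have "(real s / n) ^ (2 * l - 2) / \<Delta> \<le> (G ^ (2 * l - 2) * x ^ (2 * l) / n ^ (2 * l - 2)) / x"
        using \<Delta> x n G by (intro frac_le) auto
      also have "\<dots> = G ^ (2 * l - 2) * (x ^ (2 * l - 1) / n ^ (2 * l - 2))"
      proof -
        have "x ^ (2 * l) = x * x ^ (2 * l - 1)" using l by (cases "2 * l") auto
        thus ?thesis using x by simp
      qed
      also have "\<dots> \<le> G ^ (2 * l - 1) * (x ^ (2 * l - 1) / n ^ (2 * l - 2))"
        unfolding l2 using G x n by (intro mult_right_mono power_increasing) auto
      also have "\<dots> = (G * real n powr (1 + 1 / (2 * real l - 1)) / e) ^ (2 * l - 1)"
      proof -
        have "(real n powr (1 + 1 / (2 * real l - 1))) ^ (2 * l - 1) = real n powr ((1 + 1 / (2 * real l - 1)) * (2 * real l - 1))"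
          using n by (simp only: r(1)[symmetric] powr_powr[symmetric], intro powr_realpow[symmetric]) auto
        also have "(1 + 1 / (2 * real l - 1)) * (2 * real l - 1) = real (2 * l)" using l by (simp add: field_simps)
        also have "real n powr real (2 * l) = real n ^ (2 * l)" using n by (intro powr_realpow) auto
        finally have np: "(real n powr (1 + 1 / (2 * real l - 1))) ^ (2 * l - 1) = real n ^ (2 * l)" .
        have "x ^ (2 * l - 1) / n ^ (2 * l - 2) = real n ^ (2 * l) / e ^ (2 * l - 1)"
        proof -
          have "x ^ (2 * l - 1) = (real n ^ (2 * l) * real n ^ (2 * l - 2)) / e ^ (2 * l - 1)"
          proof -
            have "2 * (2 * l - 1) = 2 * l + (2 * l - 2)" using l by simp
            thus ?thesis unfolding x_def power_divide power_mult[symmetric] power_add[symmetric] by simp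
          qed
          thus ?thesis using n by simp
        qed
        thus ?thesis by (simp only: power_divide power_mult_distrib np times_divide_eq_right)
      qed
      also have "\<dots> \<le> (b / e) ^ (2 * l - 1)"
      proof (intro power_mono divide_right_mono)
        have "G * real n powr (1 + 1 / (2 * real l - 1)) \<le> G * \<beta>"
          using G by (intro mult_left_mono) (auto simp: \<beta>_def)
        thus "G * real n powr (1 + 1 / (2 * real l - 1)) \<le> b" using b by linarith
      qed (use G e in auto)
      finally show ?thesis .
    qed
    have "spread_weight E b (2 * l) (8 * real l) w"
      unfolding spread_weight_def
    proof (intro conjI allI impI)
      show "0 \<le> w S" for S using w(1) by simp
      show "S \<subseteq> E" "card S = 2 * l" if "w S \<noteq> 0" for S using cycles_in_memD[OF w(2)[rule_format, OF that] l] by auto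
      show "1 \<le> sum w (Pow E)" by (rule w(3))
      fix \<sigma> assume \<sigma>: "\<sigma> \<noteq> {}" "\<sigma> \<subseteq> E" "card \<sigma> \<le> 2 * l"
      show "weight_degree E w \<sigma> \<le> 8 * real l * (b / card E) ^ (card \<sigma> - 1) / card E"
      proof (cases "card \<sigma> < 2 * l")
        case True
        have "weight_degree E w \<sigma> \<le> 8 * l * (s / n) ^ (card \<sigma> - 1) / e"
          using deg[rule_format, OF \<sigma>(1,2) True] by (simp add: weight_degree_def e_def)
        also have "\<dots> \<le> 8 * l * (b / e) ^ (card \<sigma> - 1) / e"
          using tau n e by (intro divide_right_mono mult_left_mono power_mono) auto
        finally show ?thesis by (simp add: e_def)
      next
        case False
        hence full: "card \<sigma> = 2 * l" using \<sigma> by simp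
        have "weight_degree E w \<sigma> \<le> 8 * l * (s / n) ^ (2 * l - 2) / (e * \<Delta>)"
          using deg_full[rule_format, OF \<sigma>(2) full] by (simp add: weight_degree_def e_def \<Delta>_def)
        also have "\<dots> = 8 * l * ((s / n) ^ (2 * l - 2) / \<Delta>) / e" by simp
        also have "\<dots> \<le> 8 * l * (b / e) ^ (2 * l - 1) / e"
          using tau_full e by (intro divide_right_mono mult_left_mono) auto
        finally show ?thesis by (simp add: e_def full)
      qed
    qed
    from containers[rule_format, OF finE E(2) b1 this]
    have "has_containers E E (2 * l * b) \<delta> (\<lambda>I. cycles_in l V I = {})"
    proof (rule has_containers_mono)
      fix I assume I: "I \<subseteq> E" "cycles_in l V I = {}"
      show "\<forall>S\<subseteq>I. w S = 0"
      proof (intro allI impI, rule ccontr)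
        fix S assume S: "S \<subseteq> I" "w S \<noteq> 0"
        hence "S \<in> cycles_in l V I" using w(2)[rule_format, of S] by (auto simp: cycles_in_def)
        thus False using I by simp
      qed
    qed auto
    moreover have "real (2 * l * b) \<le> 4 * real l * G * \<beta>"
      using mult_left_mono[OF b(2), of "2 * real l"] by simp
    ultimately show "\<exists>t. real t \<le> 4 * real l * G * (n * ((real n)\<^sup>2 / card E) powr (1 / (real l - 1)) + real n powr (1 + 1 / (2 * real l - 1))) \<and>
        has_containers E E t \<delta> (\<lambda>I. cycles_in l V I = {})"
      unfolding \<beta>_def x_def e_def by blast
  qed
qed

section \<open>Covering families\<close>

text \<open>A certificate for a union bound: if a p-random subset of C contains a free set with at
  least m elements, it contains a member of the family, and W bounds the expected number of members
  it contains.\<close>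

definition coverable :: "real \<Rightarrow> ('b set \<Rightarrow> bool) \<Rightarrow> 'b set \<Rightarrow> real \<Rightarrow> real \<Rightarrow> bool" where
  "coverable p free C m W \<longleftrightarrow> (\<exists>\<S>\<subseteq>Pow C. (\<forall>I\<subseteq>C. free I \<longrightarrow> m \<le> card I \<longrightarrow> (\<exists>S\<in>\<S>. S \<subseteq> I)) \<and>
     (\<Sum>S\<in>\<S>. p ^ card S) \<le> W)"

lemma coverable_mono:
  assumes "coverable p free C m W" "m \<le> m'" "W \<le> W'"
  shows "coverable p free C m' W'"
proof -
  obtain \<S> where \<S>: "\<S> \<subseteq> Pow C" "\<forall>I\<subseteq>C. free I \<longrightarrow> m \<le> card I \<longrightarrow> (\<exists>S\<in>\<S>. S \<subseteq> I)" "(\<Sum>S\<in>\<S>. p ^ card S) \<le> W"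
    using assms(1) unfolding coverable_def by (elim exE conjE)
  have "\<exists>S\<in>\<S>. S \<subseteq> I" if "I \<subseteq> C" "free I" "m' \<le> card I" for I
    using \<S>(2)[rule_format, of I] that assms(2) by linarith
  moreover have "(\<Sum>S\<in>\<S>. p ^ card S) \<le> W'" using \<S>(3) assms(3) by linarith
  ultimately show ?thesis unfolding coverable_def using \<S>(1) by (intro exI[of _ \<S>] conjI allI impI)
qed

lemma sum_Pow_power_card:
  fixes z :: real
  assumes "finite C"
  shows "(\<Sum>S\<in>Pow C. z ^ card S) = (1 + z) ^ card C"
  using assms
proof (induction C)
  case empty
  then show ?case by simp
next
  case (insert x C)
  have disj: "Pow C \<inter> insert x ` Pow C = {}" using insert.hyps by auto
  have inj: "inj_on (insert x) (Pow C)" using insert.hyps by (auto simp: inj_on_def)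
  have "(\<Sum>S\<in>Pow (insert x C). z ^ card S) = (\<Sum>S\<in>Pow C. z ^ card S) + (\<Sum>S\<in>insert x ` Pow C. z ^ card S)"
    unfolding Pow_insert using insert.hyps by (intro sum.union_disjoint disj) auto
  also have "(\<Sum>S\<in>insert x ` Pow C. z ^ card S) = (\<Sum>S\<in>Pow C. z ^ card (insert x S))"
    by (simp add: sum.reindex[OF inj])
  also have "\<dots> = (\<Sum>S\<in>Pow C. z * z ^ card S)"
  proof (intro sum.cong refl)
    fix S assume "S \<in> Pow C"
    hence "finite S" "x \<notin> S" using insert.hyps finite_subset by auto
    thus "z ^ card (insert x S) = z * z ^ card S" by simp
  qed
  finally show ?case using insert by (simp add: sum_distrib_left[symmetric] distrib_right)
qed

lemma sum_Pow_power_card_le_exp: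
  fixes z :: real
  assumes "finite C" "0 \<le> z"
  shows "(\<Sum>S\<in>Pow C. z ^ card S) \<le> exp (z * card C)"
proof -
  have "(1 + z) ^ card C \<le> exp z ^ card C"
    using assms exp_ge_add_one_self[of z] by (intro power_mono) auto
  also have "\<dots> = exp (z * card C)" by (simp add: exp_of_nat_mult[symmetric] mult.commute)
  finally show ?thesis by (simp add: sum_Pow_power_card[OF assms(1)])
qed

text \<open>The family consists of all subsets of size \<open>nat \<lceil>M\<rceil>\<close>.
  Inserting the factor exp(|S| - M) >= 1 bounds the sum by exp(-M) times the sum of (e p)^|S| over
  all subsets of C, with e the base of the exponential.\<close>

lemma coverable_base:
  fixes p M :: real
  assumes "finite C" "0 \<le> p"
  shows "coverable p free C M (exp (exp 1 * p * card C - M))"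
proof -
  define k where "k = nat \<lceil>M\<rceil>"
  let ?\<S> = "{S \<in> Pow C. card S = k}"
  have "\<exists>S\<in>?\<S>. S \<subseteq> I" if I: "I \<subseteq> C" "M \<le> card I" for I
  proof -
    have "k \<le> card I" using I by (simp add: k_def nat_le_iff ceiling_le_iff)
    then obtain S where "S \<subseteq> I" "card S = k" by (meson obtain_subset_with_card_n)
    thus ?thesis using I by auto
  qed
  moreover have "(\<Sum>S\<in>?\<S>. p ^ card S) \<le> exp (exp 1 * p * card C - M)"
  proof -
    have "(\<Sum>S\<in>?\<S>. p ^ card S) \<le> (\<Sum>S\<in>?\<S>. exp (- M) * (p * exp 1) ^ card S)"
    proof (rule sum_mono)
      fix S assume "S \<in> ?\<S>"
      hence "M \<le> card S" by (auto simp: k_def) linarith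
      hence "1 \<le> exp (- M) * exp 1 ^ card S"
        by (simp add: exp_of_nat_mult[symmetric] exp_add[symmetric])
      hence "p ^ card S * 1 \<le> p ^ card S * (exp (- M) * exp 1 ^ card S)"
        using assms by (intro mult_left_mono) auto
      thus "p ^ card S \<le> exp (- M) * (p * exp 1) ^ card S" by (simp add: power_mult_distrib mult_ac)
    qed
    also have "\<dots> \<le> (\<Sum>S\<in>Pow C. exp (- M) * (p * exp 1) ^ card S)"
      using assms by (intro sum_mono2) auto
    also have "\<dots> = exp (- M) * (\<Sum>S\<in>Pow C. (p * exp 1) ^ card S)" by (simp add: sum_distrib_left)
    also have "\<dots> \<le> exp (- M) * exp (p * exp 1 * card C)"
      using assms by (intro mult_left_mono sum_Pow_power_card_le_exp) auto
    also have "\<dots> = exp (exp 1 * p * card C - M)" by (simp add: exp_add[symmetric] mult_ac)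
    finally show ?thesis .
  qed
  ultimately show ?thesis unfolding coverable_def by (intro exI[of _ ?\<S>]) auto
qed

lemma coverable_step:
  fixes p y W m \<delta> :: real
  assumes C: "finite C" and p: "0 \<le> p" and y: "0 < y" "y \<le> 1" and W: "0 \<le> W"
    and containers: "has_containers C C t \<delta> free"
    and down: "\<And>I J. free I \<Longrightarrow> J \<subseteq> I \<Longrightarrow> free J"
    and small: "\<And>C'. C' \<subseteq> C \<Longrightarrow> card C' \<le> (1 - \<delta>) * card C \<Longrightarrow> coverable p free C' m W"
  shows "coverable p free C (m + t) (exp (t * ln (1 / y) + y * p * card C) * W)"
proof -
  obtain F where F: "(\<forall>T. F T \<subseteq> C \<and> real (card (F T)) \<le> (1 - \<delta>) * real (card C)) \<and>
     (\<forall>I\<subseteq>C. free I \<longrightarrow> (\<exists>T\<subseteq>I. card T \<le> t \<and> (\<forall>T'. T \<subseteq> T' \<longrightarrow> T' \<subseteq> I \<longrightarrow> I \<inter> C \<subseteq> F T' \<union> T')))"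
    using containers unfolding has_containers_def ..
  have "\<forall>T. \<exists>\<S>\<subseteq>Pow (F T - T). (\<forall>I\<subseteq>F T - T. free I \<longrightarrow> m \<le> card I \<longrightarrow> (\<exists>S\<in>\<S>. S \<subseteq> I)) \<and>
     (\<Sum>S\<in>\<S>. p ^ card S) \<le> W"
  proof
    fix T
    have FT: "F T \<subseteq> C" "card (F T) \<le> (1 - \<delta>) * card C" using F by simp_all
    have "card (F T - T) \<le> card (F T)" using FT(1) C finite_subset by (intro card_mono) auto
    hence "card (F T - T) \<le> (1 - \<delta>) * card C" using FT(2) by linarith
    from small[OF _ this] FT(1)
    show "\<exists>\<S>\<subseteq>Pow (F T - T). (\<forall>I\<subseteq>F T - T. free I \<longrightarrow> m \<le> card I \<longrightarrow> (\<exists>S\<in>\<S>. S \<subseteq> I)) \<and>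
     (\<Sum>S\<in>\<S>. p ^ card S) \<le> W" unfolding coverable_def by auto
  qed
  from choice[OF this] obtain G where G: "\<forall>T. G T \<subseteq> Pow (F T - T) \<and>
     (\<forall>I\<subseteq>F T - T. free I \<longrightarrow> m \<le> card I \<longrightarrow> (\<exists>S\<in>G T. S \<subseteq> I)) \<and> (\<Sum>S\<in>G T. p ^ card S) \<le> W" ..
  hence Gsub: "G T \<subseteq> Pow (F T - T)" and GW: "(\<Sum>S\<in>G T. p ^ card S) \<le> W" for T by simp_all
  let ?\<T> = "{T \<in> Pow C. card T \<le> t}"
  let ?\<S> = "\<Union>T\<in>?\<T>. (\<union>) T ` G T"
  have fin\<T>: "finite ?\<T>" using C by simp
  have FC: "F T \<subseteq> C" for T using F by simp
  have finF: "finite (F T)" for T by (rule finite_subset[OF FC C])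
  have finG: "finite (G T)" for T by (rule finite_subset[OF Gsub]) (simp add: finF)
  have sub: "?\<S> \<subseteq> Pow C"
  proof
    fix S assume "S \<in> ?\<S>"
    then obtain T S' where "T \<in> ?\<T>" "S' \<in> G T" "S = T \<union> S'" by auto
    moreover from this have "S' \<subseteq> C" using Gsub[of T] FC[of T] by blast
    ultimately show "S \<in> Pow C" by auto
  qed
  have covers: "\<exists>S\<in>?\<S>. S \<subseteq> I" if I: "I \<subseteq> C" "free I" "m + t \<le> card I" for I
  proof -
    obtain T where T: "T \<subseteq> I" "card T \<le> t" "\<forall>T'. T \<subseteq> T' \<longrightarrow> T' \<subseteq> I \<longrightarrow> I \<inter> C \<subseteq> F T' \<union> T'"
      using conjunct2[OF F, rule_format, OF I(1,2)] by (elim exE conjE)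
    have finT: "finite T" using T(1) I(1) C by (meson finite_subset)
    have "I - T \<subseteq> F T - T" using T(3)[rule_format, OF subset_refl T(1)] I(1) by blast
    moreover have "free (I - T)" by (rule down[OF I(2)]) blast
    moreover have "m \<le> card (I - T)"
    proof -
      have "card (I - T) = card I - card T" using T(1) finT by (simp add: card_Diff_subset)
      moreover have "card T \<le> card I" using T(1) I(1) C by (meson card_mono finite_subset)
      ultimately show ?thesis using I(3) T(2) by linarith
    qed
    ultimately obtain S where S: "S \<in> G T" "S \<subseteq> I - T" using conjunct1[OF conjunct2[OF G[rule_format, of T]], rule_format, of "I - T"] by blast
    have "T \<in> ?\<T>" using T(1,2) I(1) by simp
    hence "T \<union> S \<in> ?\<S>" using S(1) by (intro UN_I[of T] imageI)
    moreover have "T \<union> S \<subseteq> I" using S(2) T(1) by blast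
    ultimately show ?thesis by (rule bexI[rotated])
  qed
  have "(\<Sum>S\<in>?\<S>. p ^ card S) \<le> (\<Sum>T\<in>?\<T>. \<Sum>S\<in>(\<union>) T ` G T. p ^ card S)"
  proof -
    have "(\<Sum>S\<in>?\<S>. p ^ card S) \<le> (\<Sum>T\<in>?\<T>. \<Sum>S\<in>{S \<in> ?\<S>. S \<in> (\<union>) T ` G T}. p ^ card S)"
      by (rule sum_le_sum_cover[OF fin\<T>]) (use p fin\<T> finG in auto)
    also have "\<dots> = (\<Sum>T\<in>?\<T>. \<Sum>S\<in>(\<union>) T ` G T. p ^ card S)"
    proof (intro sum.cong refl)
      fix T assume "T \<in> ?\<T>"
      thus "{S \<in> ?\<S>. S \<in> (\<union>) T ` G T} = (\<union>) T ` G T" by blast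
    qed
    finally show ?thesis .
  qed
  also have "\<dots> \<le> (\<Sum>T\<in>?\<T>. p ^ card T * W)"
  proof (rule sum_mono)
    fix T assume T: "T \<in> ?\<T>"
    hence finT: "finite T" using C finite_subset by auto
    have "(\<Sum>S\<in>(\<union>) T ` G T. p ^ card S) \<le> (\<Sum>S\<in>G T. p ^ card (T \<union> S))"
      using sum_image_le[of "G T" "\<lambda>S. p ^ card S" "(\<union>) T"] p finG by (simp add: o_def)
    also have "\<dots> = (\<Sum>S\<in>G T. p ^ card T * p ^ card S)"
    proof (intro sum.cong refl)
      fix S assume "S \<in> G T"
      hence "S \<subseteq> F T" "T \<inter> S = {}" using Gsub[of T] by auto
      moreover from this have "finite S" using finF finite_subset by blast
      ultimately show "p ^ card (T \<union> S) = p ^ card T * p ^ card S"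
        using finT by (simp add: card_Un_disjoint power_add)
    qed
    also have "\<dots> \<le> p ^ card T * W"
      unfolding sum_distrib_left[symmetric] using GW p by (intro mult_left_mono) auto
    finally show "(\<Sum>S\<in>(\<union>) T ` G T. p ^ card S) \<le> p ^ card T * W" .
  qed
  also have "\<dots> = (\<Sum>T\<in>?\<T>. p ^ card T) * W" by (simp add: sum_distrib_right)
  also have "\<dots> \<le> exp (t * ln (1 / y) + y * p * card C) * W"
  proof (rule mult_right_mono[OF _ W])
    have "(\<Sum>T\<in>?\<T>. p ^ card T) \<le> (\<Sum>T\<in>?\<T>. (1 / y) ^ t * (y * p) ^ card T)"
    proof (rule sum_mono)
      fix T assume "T \<in> ?\<T>"
      hence "(1 / y) ^ card T \<le> (1 / y) ^ t" using y by (intro power_increasing) auto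
      hence "(1 / y) ^ card T * (y * p) ^ card T \<le> (1 / y) ^ t * (y * p) ^ card T"
        using y p by (intro mult_right_mono) auto
      thus "p ^ card T \<le> (1 / y) ^ t * (y * p) ^ card T" using y by (simp add: power_mult_distrib[symmetric])
    qed
    also have "\<dots> \<le> (\<Sum>T\<in>Pow C. (1 / y) ^ t * (y * p) ^ card T)"
      using C y p by (intro sum_mono2) auto
    also have "\<dots> = (1 / y) ^ t * (\<Sum>T\<in>Pow C. (y * p) ^ card T)" by (simp add: sum_distrib_left)
    also have "\<dots> \<le> (1 / y) ^ t * exp (y * p * card C)"
      using C y p by (intro mult_left_mono sum_Pow_power_card_le_exp) auto
    also have "(1 / y) ^ t = exp (t * ln (1 / y))" using y by (simp add: exp_of_nat_mult)
    finally show "(\<Sum>T\<in>?\<T>. p ^ card T) \<le> exp (t * ln (1 / y) + y * p * card C)" by (simp add: exp_add)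
  qed
  finally show ?thesis unfolding coverable_def using sub covers
    by (intro exI[of _ ?\<S>] conjI allI impI)
qed

text \<open>In step \<open>i\<close> the fingerprints are counted with \<open>y = \<rho>\<^bsup>2i\<^esup>\<close>: the second term of the cost then decays
  geometrically, while the first gains only a factor \<open>i\<close>. A choice independent of \<open>i\<close> would lose a factor
  \<open>log n\<close> overall.\<close>

lemma coverable_iterate:
  fixes T :: "nat \<Rightarrow> real" and p e \<rho> M :: real
  assumes K: "finite K" and p: "0 \<le> p" and \<rho>: "0 < \<rho>" "\<rho> < 1" and e: "0 < e"
    and down: "\<And>I J. free I \<Longrightarrow> J \<subseteq> I \<Longrightarrow> free J"
    and T: "\<And>j. 0 \<le> T j"
    and containers: "\<And>C j. C \<subseteq> K \<Longrightarrow> e * (1 / \<rho>) ^ j < card C \<Longrightarrow>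
      \<exists>t. real t \<le> T j \<and> has_containers C C t (1 - \<rho>) free"
  shows "C \<subseteq> K \<Longrightarrow> card C \<le> e * (1 / \<rho>) ^ i \<Longrightarrow> coverable p free C (M + (\<Sum>j<i. T j))
    (exp ((\<Sum>j<i. 2 * real j * ln (1 / \<rho>) * T j + \<rho> ^ j / \<rho> * (p * e)) + exp 1 * (p * e) - M))"
proof (induction i arbitrary: C)
  case 0
  have finC: "finite C" using 0 K finite_subset by blast
  have "exp 1 * p * card C \<le> exp 1 * p * e" using 0 p by (intro mult_left_mono) auto
  thus ?case by (intro coverable_mono[OF coverable_base[OF finC p]]) (auto simp: mult.assoc)
next
  case (Suc i)
  \<comment> \<open>The exponent of \<open>coverable_step\<close> at level j, for y = \<rho>^(2j)
    and at most e / \<rho>^(j+1) edges; the second summand is y p times this number of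
    edges.\<close>
  define cost where "cost = (\<lambda>j. 2 * real j * ln (1 / \<rho>) * T j + \<rho> ^ j / \<rho> * (p * e))"
  have finC: "finite C" using Suc.prems K finite_subset by blast
  have lpos: "ln (1 / \<rho>) \<ge> 0" using \<rho> by simp
  have cost: "cost i \<ge> 0" using \<rho> p e T[of i] lpos by (simp add: cost_def)
  let ?W = "exp ((\<Sum>j<i. cost j) + exp 1 * (p * e) - M)"
  show ?case unfolding cost_def[symmetric]
  proof (cases "card C \<le> e * (1 / \<rho>) ^ i")
    case True
    from Suc.IH[OF Suc.prems(1) this]
    show "coverable p free C (M + sum T {..<Suc i}) (exp (sum cost {..<Suc i} + exp 1 * (p * e) - M))"
      unfolding cost_def[symmetric] by (rule coverable_mono) (use cost T[of i] in auto)
  next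
    case False
    hence "e * (1 / \<rho>) ^ i < card C" by simp
    from containers[OF Suc.prems(1) this] obtain t where t: "real t \<le> T i" "has_containers C C t (1 - \<rho>) free"
      by blast
    have "coverable p free C (M + (\<Sum>j<i. T j) + t) (exp (t * ln (1 / \<rho> ^ (2 * i)) + \<rho> ^ (2 * i) * p * card C) * ?W)"
    proof (rule coverable_step[OF finC p _ _ _ t(2) down])
      show "0 < \<rho> ^ (2 * i)" "\<rho> ^ (2 * i) \<le> 1" using \<rho> by (auto intro: power_le_one)
      fix C' assume C': "C' \<subseteq> C" "card C' \<le> (1 - (1 - \<rho>)) * card C"
      have "card C' \<le> \<rho> * (e * (1 / \<rho>) ^ Suc i)"
        using C'(2) mult_left_mono[OF Suc.prems(2), of \<rho>] \<rho> by simp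
      also have "\<dots> = e * (1 / \<rho>) ^ i" using \<rho> by simp
      finally show "coverable p free C' (M + (\<Sum>j<i. T j)) ?W"
        using Suc.IH[of C'] C'(1) Suc.prems(1) unfolding cost_def[symmetric] by auto
    qed auto
    thus "coverable p free C (M + sum T {..<Suc i}) (exp (sum cost {..<Suc i} + exp 1 * (p * e) - M))"
    proof (rule coverable_mono)
      show "M + (\<Sum>j<i. T j) + t \<le> M + sum T {..<Suc i}" using t(1) by simp
      have "t * ln (1 / \<rho> ^ (2 * i)) = 2 * i * ln (1 / \<rho>) * t"
        using \<rho> by (simp add: ln_div ln_realpow)
      also have "\<dots> \<le> 2 * i * ln (1 / \<rho>) * T i" using t(1) lpos by (intro mult_left_mono) auto
      finally have 1: "t * ln (1 / \<rho> ^ (2 * i)) \<le> 2 * i * ln (1 / \<rho>) * T i" .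
      have "\<rho> ^ (2 * i) * p * card C \<le> \<rho> ^ (2 * i) * p * (e * (1 / \<rho>) ^ Suc i)"
        using Suc.prems(2) \<rho> p by (intro mult_left_mono) auto
      also have "\<dots> = \<rho> ^ i / \<rho> * (p * e)"
        using \<rho> by (simp add: mult_2 power_add power_divide)
      finally have 2: "\<rho> ^ (2 * i) * p * card C \<le> \<rho> ^ i / \<rho> * (p * e)" .
      show "exp (t * ln (1 / \<rho> ^ (2 * i)) + \<rho> ^ (2 * i) * p * card C) * ?W
          \<le> exp (sum cost {..<Suc i} + exp 1 * (p * e) - M)"
        using 1 2 by (simp add: exp_add[symmetric] cost_def)
    qed
  qed
qed

section \<open>The random graph\<close>

lemma sum_le_sums:
  fixes f :: "nat \<Rightarrow> real"
  assumes "f sums S" "\<And>j. 0 \<le> f j"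
  shows "(\<Sum>j<L. f j) \<le> S"
  using sum_le_suminf[of f "{..<L}"] assms by (simp add: sums_iff)

lemma card_all_edges_le:
  assumes "finite V"
  shows "card (all_edges V) \<le> (card V)\<^sup>2"
proof -
  have "card (all_edges V) = (card V choose 2)"
    unfolding all_edges_def using n_subsets[OF assms] by simp
  also have "\<dots> \<le> (card V)\<^sup>2"
    by (cases "2 \<le> card V") (simp_all add: binomial_le_pow binomial_eq_0)
  finally show ?thesis .
qed

text \<open>Stopping at e = A \<mu> / p edges keeps every contribution of order \<mu>. The base
  family costs a multiple of p e = A \<mu>; the decaying part of the fingerprint bound starts below
  \<mu>; and the constant part \<nu> = n^(1+1/(2l-1)), weighted by j over about ln n levels, costs a
  multiple of \<nu> (ln n)^2, which is at most \<mu> by hypothesis.\<close>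

lemma coverable_cycle_free:
  fixes l :: nat
  assumes l: "l \<ge> 2"
  shows "\<exists>C>0. \<forall>n p \<mu>. 3 \<le> n \<longrightarrow> 0 < p \<longrightarrow> p \<le> 1 \<longrightarrow> \<mu> = p powr (1 / l) * real n powr (1 + 1 / l) \<longrightarrow>
    real n powr (1 + 1 / (2 * real l - 1)) * (ln n)\<^sup>2 \<le> \<mu> \<longrightarrow>
    coverable p (\<lambda>I. cycles_in l {..<n} I = {}) (all_edges {..<n}) (C * \<mu>) (exp (- \<mu>))"
proof -
  obtain A B \<delta> :: real where A: "A \<ge> 1" and B: "B \<ge> 1" and \<delta>: "0 < \<delta>" "\<delta> < 1"
    and containers: "\<forall>(V :: nat set) E n. finite V \<longrightarrow> n = card V \<longrightarrow> E \<subseteq> all_edges V \<longrightarrow> E \<noteq> {} \<longrightarrow>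
      A * real n powr (1 + 1 / l) \<le> card E \<longrightarrow>
      (\<exists>t. real t \<le> B * (n * ((real n)\<^sup>2 / card E) powr (1 / (real l - 1)) + real n powr (1 + 1 / (2 * real l - 1))) \<and>
        has_containers E E t \<delta> (\<lambda>I. cycles_in l V I = {}))"
    using cycle_containers[OF l, where 'a = nat] by (elim exE conjE)
  define \<rho> where "\<rho> = 1 - \<delta>"
  \<comment> \<open>The factor by which the decaying part of the fingerprint bound shrinks when the
    number of edges grows by 1/\<rho>.\<close>
  define r where "r = \<rho> powr (1 / (real l - 1))"
  define \<Lambda> where "\<Lambda> = ln (1 / \<rho>)"
  \<comment> \<open>\<open>g * ln n\<close> bounds the number L of levels; ln n >= 1, true for n >=
    3, covers the rounding.\<close>
  define g where "g = 2 / \<Lambda> + 1"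
  define R1 where "R1 = 1 / (1 - r)"
  define R2 where "R2 = 1 / (1 - r)\<^sup>2"
  define R3 where "R3 = 1 / (1 - \<rho>)"
  \<comment> \<open>c1 collects the exponents of all levels and c2 the fingerprint sizes. The
    summands \<open>exp 1 * A\<close> and 1 of the final constant pay for the base family and for
    the remaining exponent -\<mu>.\<close>
  define c1 where "c1 = 2 * \<Lambda> * B * (R2 + g\<^sup>2) + A * R3 / \<rho>"
  define c2 where "c2 = B * (R1 + g)"
  have \<rho>: "0 < \<rho>" "\<rho> < 1" using \<delta> by (auto simp: \<rho>_def)
  have r: "0 < r" "r < 1" using \<rho> l powr_less_mono2[of "1 / (real l - 1)" \<rho> 1] by (auto simp: r_def)
  have \<Lambda>: "\<Lambda> > 0" using \<rho> by (simp add: \<Lambda>_def)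
  have g: "g > 0" using \<Lambda> by (simp add: g_def add_pos_pos)
  have R: "R1 > 0" "R2 > 0" "R3 > 0" using r \<rho> by (auto simp: R1_def R2_def R3_def)
  have c: "c1 > 0" "c2 > 0" using R g \<Lambda> A B \<rho> by (auto simp: c1_def c2_def intro!: add_pos_pos mult_pos_pos)
  have S1: "(\<Sum>j<L. r ^ j) \<le> R1" for L
    unfolding R1_def using r by (intro sum_le_sums geometric_sums) auto
  have S3: "(\<Sum>j<L. \<rho> ^ j) \<le> R3" for L
    unfolding R3_def using \<rho> by (intro sum_le_sums geometric_sums) auto
  have S2: "(\<Sum>j<L. j * r ^ j) \<le> R2" for L
  proof -
    have "(\<Sum>j<L. j * r ^ j) \<le> (\<Sum>j<L. of_nat (Suc j) * r ^ j)"
      using r by (intro sum_mono mult_right_mono) auto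
    also have "\<dots> \<le> R2" unfolding R2_def using r by (intro sum_le_sums geometric_deriv_sums) auto
    finally show ?thesis .
  qed
  show ?thesis
  proof (rule exI[of _ "c1 + exp 1 * A + 1 + c2"], intro conjI allI impI)
    show "0 < c1 + exp 1 * A + 1 + c2" using c A by (intro add_pos_pos mult_pos_pos) auto
    fix n :: nat and p \<mu> :: real
    assume n: "3 \<le> n" and p: "0 < p" "p \<le> 1" and \<mu>: "\<mu> = p powr (1 / l) * real n powr (1 + 1 / l)"
      and \<nu>\<mu>: "real n powr (1 + 1 / (2 * real l - 1)) * (ln n)\<^sup>2 \<le> \<mu>"
    define \<nu> where "\<nu> = real n powr (1 + 1 / (2 * real l - 1))"
    let ?free = "\<lambda>I. cycles_in l {..<n} I = {}" and ?K = "all_edges {..<n}"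
    have ln1: "ln n \<ge> 1"
    proof -
      have "exp 1 \<le> real n" using exp_le n by linarith
      thus ?thesis using n by (subst ln_ge_iff) auto
    qed
    have \<mu>0: "\<mu> > 0" unfolding \<mu> using p n by simp
    have \<nu>0: "\<nu> > 0" unfolding \<nu>_def using n by simp
    have \<nu>2: "\<nu> * (ln n)\<^sup>2 \<le> \<mu>" using \<nu>\<mu> by (simp add: \<nu>_def)
    have "ln n \<le> (ln n)\<^sup>2" using ln1 by (simp add: power2_eq_square)
    hence \<nu>1: "\<nu> * ln n \<le> \<mu>" using \<nu>2 \<nu>0 mult_left_mono[of "ln n" "(ln n)\<^sup>2" \<nu>] by linarith
    define e where "e = A * \<mu> / p"
    have pe: "p * e = A * \<mu>" using p by (simp add: e_def)
    have \<mu>p: "\<mu> / p \<ge> real n powr (1 + 1 / l)"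
    proof -
      have "p powr 1 \<le> p powr (1 / l)" using p l by (intro powr_mono') auto
      hence "p * real n powr (1 + 1 / l) \<le> \<mu>" unfolding \<mu> using p by (intro mult_right_mono) auto
      thus ?thesis using p by (simp add: field_simps)
    qed
    have en: "A * real n powr (1 + 1 / l) \<le> e"
      using mult_left_mono[OF \<mu>p, of A] A by (simp add: e_def)
    have "1 * 1 \<le> A * real n powr (1 + 1 / l)"
      using A n l by (intro mult_mono ge_one_powr_ge_zero) auto
    hence e1: "e \<ge> 1" using en by linarith
    have \<mu>l: "\<mu> ^ l = p * real n ^ (l + 1)"
    proof -
      have "(p powr (1 / l)) ^ l = p" using p l by (simp add: powr_realpow[symmetric] powr_powr)
      moreover have "(real n powr (1 + 1 / l)) ^ l = real n powr real (l + 1)"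
        using n l by (simp add: powr_realpow[symmetric] powr_powr distrib_right del: of_nat_add) (simp add: add.commute)
      moreover have "real n powr real (l + 1) = real n ^ (l + 1)" using n by (intro powr_realpow) auto
      ultimately show ?thesis unfolding \<mu> by (simp add: power_mult_distrib)
    qed
    \<comment> \<open>Equality would hold with \<mu>/p in place of e: \<mu>^l = p n^(l+1) is the
      same as n^2 p / \<mu> = (\<mu>/n)^(l-1).\<close>
    have ne: "n * ((real n)\<^sup>2 / e) powr (1 / (real l - 1)) \<le> \<mu>"
    proof -
      have "(real n)\<^sup>2 / e \<le> (real n)\<^sup>2 / (\<mu> / p)"
      proof (rule divide_left_mono)
        show "\<mu> / p \<le> e" using A \<mu>0 p by (simp add: e_def divide_right_mono)
      qed (use e1 \<mu>0 p in auto)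
      also have "\<dots> = (\<mu> / n) ^ (l - 1)"
      proof -
        have "\<mu> * (\<mu> ^ (l - 1) * 1) = (p * (real n)\<^sup>2) * real n ^ (l - 1)"
        proof -
          have "\<mu> ^ l = \<mu> * \<mu> ^ (l - 1)" using l by (cases l) auto
          moreover have "real n ^ (l + 1) = (real n)\<^sup>2 * real n ^ (l - 1)"
            using l by (simp add: power_add[symmetric])
          ultimately show ?thesis using \<mu>l by simp
        qed
        thus ?thesis using \<mu>0 p n by (simp add: power_divide field_simps)
      qed
      finally have "((real n)\<^sup>2 / e) powr (1 / (real l - 1)) \<le> ((\<mu> / n) ^ (l - 1)) powr (1 / (real l - 1))"
        using e1 l by (intro powr_mono2) auto
      also have "\<dots> = \<mu> / n"
      proof -
        have "(\<mu> / n) ^ (l - 1) = (\<mu> / n) powr real (l - 1)"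
          using \<mu>0 n by (intro powr_realpow[symmetric]) auto
        moreover have "real (l - 1) = real l - 1" using l by (simp add: of_nat_diff)
        ultimately show ?thesis using l \<mu>0 n by (simp add: powr_powr)
      qed
      finally show ?thesis using n by (simp add: field_simps)
    qed
    define T where "T = (\<lambda>j :: nat. B * (\<mu> * r ^ j + \<nu>))"
    have T0: "0 \<le> T j" for j using B \<mu>0 \<nu>0 r by (simp add: T_def)
    have conts: "\<exists>t. real t \<le> T j \<and> has_containers C C t (1 - \<rho>) ?free"
      if C: "C \<subseteq> ?K" "e * (1 / \<rho>) ^ j < card C" for C j
    proof -
      have "1 \<le> (1 / \<rho>) ^ j" using \<rho> by (intro one_le_power) auto
      hence "e * 1 \<le> e * (1 / \<rho>) ^ j" using e1 by (intro mult_left_mono) auto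
      hence eC: "e \<le> card C" using C(2) by linarith
      hence "C \<noteq> {}" "A * real n powr (1 + 1 / l) \<le> card C" using e1 en by auto
      with containers[rule_format, of "{..<n}" n C] C(1)
      obtain t where t: "real t \<le> B * (n * ((real n)\<^sup>2 / card C) powr (1 / (real l - 1)) + \<nu>)"
        "has_containers C C t \<delta> ?free" by (auto simp: \<nu>_def)
      have "((real n)\<^sup>2 / card C) powr (1 / (real l - 1)) \<le> ((real n)\<^sup>2 / (e * (1 / \<rho>) ^ j)) powr (1 / (real l - 1))"
      proof (intro powr_mono2 divide_left_mono)
        show "e * (1 / \<rho>) ^ j \<le> card C" using C by simp
        show "0 < real (card C) * (e * (1 / \<rho>) ^ j)" using eC e1 \<rho> by (intro mult_pos_pos) auto
      qed (use l in auto)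
      also have "(real n)\<^sup>2 / (e * (1 / \<rho>) ^ j) = ((real n)\<^sup>2 / e) * \<rho> ^ j" by (simp add: power_divide)
      also have "\<dots> powr (1 / (real l - 1)) = ((real n)\<^sup>2 / e) powr (1 / (real l - 1)) * r ^ j"
      proof -
        have "(\<rho> ^ j) powr (1 / (real l - 1)) = r ^ j"
          unfolding r_def using \<rho> by (simp add: powr_realpow[symmetric] powr_powr mult.commute)
        thus ?thesis using \<rho> e1 by (subst powr_mult) auto
      qed
      finally have "n * ((real n)\<^sup>2 / card C) powr (1 / (real l - 1))
          \<le> n * (((real n)\<^sup>2 / e) powr (1 / (real l - 1)) * r ^ j)" by (rule mult_left_mono) simp
      also have "\<dots> = (n * ((real n)\<^sup>2 / e) powr (1 / (real l - 1))) * r ^ j" by simp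
      also have "\<dots> \<le> \<mu> * r ^ j" using ne r by (intro mult_right_mono) auto
      finally have "B * (n * ((real n)\<^sup>2 / card C) powr (1 / (real l - 1)) + \<nu>) \<le> T j"
        unfolding T_def using B by (intro mult_left_mono) auto
      hence "real t \<le> T j" using t(1) by linarith
      moreover have "1 - \<rho> = \<delta>" by (simp add: \<rho>_def)
      ultimately show ?thesis using t(2) by (intro exI[of _ t]) simp
    qed
    define L where "L = nat \<lceil>2 * ln n / \<Lambda>\<rceil>"
    have "real L = of_int \<lceil>2 * ln n / \<Lambda>\<rceil>" using ln1 \<Lambda> by (simp add: L_def)
    hence L: "2 * ln n / \<Lambda> \<le> L" "L \<le> 2 * ln n / \<Lambda> + 1"
      using ceiling_correct[of "2 * ln n / \<Lambda>"] by linarith+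
    have Lg: "L \<le> g * ln n" using L(2) ln1 by (simp add: g_def distrib_right)
    have finK: "finite ?K" by (rule finite_all_edges) simp
    have cardK: "card ?K \<le> e * (1 / \<rho>) ^ L"
    proof -
      have "real (card ?K) \<le> (real n)\<^sup>2"
        using card_all_edges_le[of "{..<n}"] by (simp flip: of_nat_power)
      also have "\<dots> = exp (2 * ln n)" using n by (simp add: exp_double power2_eq_square exp_ln flip: exp_add)
      also have "\<dots> \<le> exp (L * \<Lambda>)" using L(1) \<Lambda> by (simp add: field_simps)
      also have "\<dots> = (1 / \<rho>) ^ L" using \<rho> by (simp add: exp_of_nat_mult \<Lambda>_def)
      also have "\<dots> \<le> e * (1 / \<rho>) ^ L" using e1 \<rho> by simp
      finally show ?thesis .
    qed
    define M where "M = (c1 + exp 1 * A + 1) * \<mu>"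
    have cover: "coverable p ?free ?K (M + (\<Sum>j<L. T j))
      (exp ((\<Sum>j<L. 2 * real j * ln (1 / \<rho>) * T j + \<rho> ^ j / \<rho> * (p * e)) + exp 1 * (p * e) - M))"
    proof (rule coverable_iterate[OF finK _ \<rho> _ _ T0 conts subset_refl cardK])
      show "cycles_in l {..<n} J = {}" if "cycles_in l {..<n} I = {}" "J \<subseteq> I" for I J
        using cycles_in_mono[OF subset_refl that(2), of l "{..<n}"] that(1) by blast
    qed (use p e1 in auto)
    show "coverable p ?free ?K ((c1 + exp 1 * A + 1 + c2) * \<mu>) (exp (- \<mu>))"
    proof (rule coverable_mono[OF cover])
      have "(\<Sum>j<L. T j) = B * (\<mu> * (\<Sum>j<L. r ^ j) + L * \<nu>)"
        by (simp add: T_def sum_distrib_left[symmetric] sum.distrib)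
      also have "\<dots> \<le> B * (\<mu> * R1 + g * \<mu>)"
      proof (intro mult_left_mono add_mono S1)
        have "L * \<nu> \<le> (g * ln n) * \<nu>" using Lg \<nu>0 by (intro mult_right_mono) auto
        also have "\<dots> \<le> g * \<mu>" using mult_left_mono[OF \<nu>1, of g] g by (simp add: mult_ac)
        finally show "L * \<nu> \<le> g * \<mu>" .
      qed (use \<mu>0 B in auto)
      also have "\<dots> = c2 * \<mu>" by (simp add: c2_def algebra_simps)
      finally show "M + (\<Sum>j<L. T j) \<le> (c1 + exp 1 * A + 1 + c2) * \<mu>" by (simp add: M_def distrib_right)
      have "(\<Sum>j<L. 2 * real j * ln (1 / \<rho>) * T j + \<rho> ^ j / \<rho> * (p * e))
          = 2 * \<Lambda> * B * (\<mu> * (\<Sum>j<L. j * r ^ j) + \<nu> * (\<Sum>j<L. real j)) + A * \<mu> / \<rho> * (\<Sum>j<L. \<rho> ^ j)"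
        unfolding T_def \<Lambda>_def[symmetric] pe sum.distrib sum_distrib_left distrib_left
        by (simp add: mult_ac)
      also have "\<dots> \<le> 2 * \<Lambda> * B * (\<mu> * R2 + g\<^sup>2 * \<mu>) + A * \<mu> / \<rho> * R3"
      proof (intro add_mono mult_left_mono S2 S3)
        have "(\<Sum>j<L. real j) \<le> (\<Sum>j<L. real L)" by (intro sum_mono) auto
        hence "(\<Sum>j<L. real j) \<le> (real L)\<^sup>2" by (simp add: power2_eq_square)
        also have "\<dots> \<le> (g * ln n)\<^sup>2" using Lg by (intro power_mono) auto
        finally have "\<nu> * (\<Sum>j<L. real j) \<le> \<nu> * (g * ln n)\<^sup>2" using \<nu>0 by (intro mult_left_mono) auto
        also have "\<dots> = g\<^sup>2 * (\<nu> * (ln n)\<^sup>2)" by (simp add: power_mult_distrib)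
        also have "\<dots> \<le> g\<^sup>2 * \<mu>" using \<nu>2 by (intro mult_left_mono) auto
        finally show "\<nu> * (\<Sum>j<L. real j) \<le> g\<^sup>2 * \<mu>" .
      qed (use \<mu>0 A B \<Lambda> \<rho> in auto)
      also have "\<dots> = c1 * \<mu>" by (simp add: c1_def algebra_simps)
      finally have "(\<Sum>j<L. 2 * real j * ln (1 / \<rho>) * T j + \<rho> ^ j / \<rho> * (p * e)) \<le> c1 * \<mu>" .
      moreover have "M = c1 * \<mu> + exp 1 * (p * e) + \<mu>" unfolding M_def pe by (simp add: algebra_simps)
      ultimately show "exp ((\<Sum>j<L. 2 * real j * ln (1 / \<rho>) * T j + \<rho> ^ j / \<rho> * (p * e)) + exp 1 * (p * e) - M) \<le> exp (- \<mu>)"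
        by simp
    qed
  qed
qed

section \<open>From covering families to G(n,p)\<close>

lemma prob_random_graph_contains:
  assumes "0 \<le> p" "p \<le> 1" "S \<subseteq> all_edges {..<n}"
  shows "measure_pmf.prob (random_graph n p) {G. S \<subseteq> edges G} = p ^ card S"
proof -
  let ?K = "all_edges {..<n}"
  have fin: "finite ?K" by (rule finite_all_edges) simp
  have "measure_pmf.prob (random_graph n p) {G. S \<subseteq> edges G}
      = measure_pmf.prob (Pi_pmf ?K False (\<lambda>_. bernoulli_pmf p)) (Pi ?K (\<lambda>e. if e \<in> S then {True} else UNIV))"
    unfolding random_graph_def measure_map_pmf using assms(3)
    by (intro arg_cong[where f = "measure_pmf.prob _"]) (auto simp: Pi_def split: if_splits)
  also have "\<dots> = (\<Prod>e\<in>?K. measure_pmf.prob (bernoulli_pmf p) (if e \<in> S then {True} else UNIV))"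
    by (rule measure_Pi_pmf_Pi[OF fin])
  also have "\<dots> = (\<Prod>e\<in>?K. if e \<in> S then p else 1)"
    using assms by (intro prod.cong refl) (auto simp: measure_pmf_single)
  also have "\<dots> = (\<Prod>e\<in>{e \<in> ?K. e \<in> S}. p)" by (rule prod.inter_filter[OF fin, symmetric])
  also have "{e \<in> ?K. e \<in> S} = S" using assms(3) by auto
  finally show ?thesis by simp
qed

text \<open>Bridges the maximum over subgraphs in \<open>ex_num\<close> and the formulation by edge
  sets. A subgraph may have fewer vertices than its host, but contains the vertices of its own
  edges, hence those of every cycle formed by them.\<close>

lemma ex_num_cycle_le:
  fixes n :: nat and m :: real
  assumes l: "l \<ge> 2" and E: "E \<subseteq> all_edges {..<n}" and m: "0 \<le> m"
    and free: "\<And>I. I \<subseteq> E \<Longrightarrow> cycles_in l {..<n} I = {} \<Longrightarrow> card I \<le> m"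
  shows "real (ex_num ({..<n}, E) (cycle_graph (2 * l))) \<le> m"
proof -
  let ?X = "{card (edges H) | H. subgraph H ({..<n}, E) \<and> \<not> contains_copy H (cycle_graph (2 * l))}"
  have finE: "finite E" by (rule finite_subset[OF E finite_all_edges]) simp
  have "?X \<subseteq> {..card E}" using finE by (auto simp: subgraph_def intro: card_mono)
  hence "finite ?X" by (rule finite_subset) simp
  \<comment> \<open>The empty graph shows that the maximum is taken over a nonempty set; it contains
    no copy because the cycle has vertices.\<close>
  moreover have "\<not> contains_copy ({}, {}) (cycle_graph (2 * l))"
    using l by (auto simp: contains_copy_def cycle_graph_def lessThan_empty_iff bot_nat_def)
  hence "card (edges ({}, {})) \<in> ?X" by (intro CollectI exI[of _ "({}, {})"]) (auto simp: subgraph_def simple_graph_def)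
  ultimately have "Max ?X \<in> ?X" by (intro Max_in) auto
  then obtain H where H: "subgraph H ({..<n}, E)" "\<not> contains_copy H (cycle_graph (2 * l))"
    and max: "Max ?X = card (edges H)" by blast
  have HE: "edges H \<subseteq> E" "edges H \<subseteq> all_edges (verts H)" using H(1) by (auto simp: subgraph_def simple_graph_def)
  have "cycles_in l {..<n} (edges H) = {}"
  proof (rule ccontr)
    assume "\<not> ?thesis"
    then obtain xs where xs: "distinct xs" "length xs = 2 * l" "cycle_edges xs \<subseteq> edges H"
      by (auto simp: cycles_in_def)
    have "contains_copy H (cycle_graph (2 * l))"
      unfolding contains_copy_def
    proof (intro exI[of _ "(!) xs"] conjI ballI)
      show "inj_on ((!) xs) (verts (cycle_graph (2 * l)))"
        using xs by (intro inj_on_nth) (auto simp: cycle_graph_def)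
      have "set xs = \<Union> (cycle_edges xs)" by (rule Union_cycle_edges[symmetric])
      also have "\<dots> \<subseteq> verts H" using xs(3) HE(2) by (force simp: all_edges_def)
      finally show "(!) xs ` verts (cycle_graph (2 * l)) \<subseteq> verts H"
        using xs(2) by (auto simp: cycle_graph_def)
      fix e assume "e \<in> edges (cycle_graph (2 * l))"
      then obtain i where "i < 2 * l" "e = {i, Suc i mod (2 * l)}" by (auto simp: cycle_graph_def)
      hence "(!) xs ` e \<in> cycle_edges xs" using xs(2) by (auto simp: cycle_edges_def)
      thus "(!) xs ` e \<in> edges H" using xs(3) by blast
    qed
    with H(2) show False by contradiction
  qed
  from free[OF HE(1) this] show ?thesis unfolding ex_num_def max .
qed

text \<open>Monotonicity enters only through \<open>p ^ card S \<le> P ^ card S\<close>: a cover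
  built for P bounds the failure probability for every smaller p, and no coupling of random graphs
  is required.\<close>

lemma prob_ex_num_le:
  assumes l: "l \<ge> 2" and p: "0 \<le> p" "p \<le> P" "p \<le> 1" and m: "0 \<le> m"
    and cover: "coverable P (\<lambda>I. cycles_in l {..<n} I = {}) (all_edges {..<n}) m W"
  shows "1 - W \<le> measure_pmf.prob (random_graph n p) {G. real (ex_num G (cycle_graph (2 * l))) \<le> m}"
proof -
  let ?K = "all_edges {..<n}" and ?R = "random_graph n p"
  let ?good = "{G. real (ex_num G (cycle_graph (2 * l))) \<le> m}"
  have finK: "finite ?K" by (rule finite_all_edges) simp
  obtain \<S> where S: "\<S> \<subseteq> Pow ?K" "\<forall>I\<subseteq>?K. cycles_in l {..<n} I = {} \<longrightarrow> m \<le> card I \<longrightarrow> (\<exists>S\<in>\<S>. S \<subseteq> I)"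
    "(\<Sum>S\<in>\<S>. P ^ card S) \<le> W"
    using cover unfolding coverable_def by (elim exE conjE)
  have fin\<S>: "finite \<S>" by (rule finite_subset[OF S(1)]) (simp add: finK)
  have "- ?good \<inter> set_pmf ?R \<subseteq> (\<Union>S\<in>\<S>. {G. S \<subseteq> edges G})"
  proof
    fix G assume G: "G \<in> - ?good \<inter> set_pmf ?R"
    then obtain E where E: "G = ({..<n}, E)" "E \<subseteq> ?K" by (auto simp: random_graph_def)
    show "G \<in> (\<Union>S\<in>\<S>. {G. S \<subseteq> edges G})"
    proof (rule ccontr)
      assume no: "G \<notin> (\<Union>S\<in>\<S>. {G. S \<subseteq> edges G})"
      have "card I \<le> m" if I: "I \<subseteq> E" "cycles_in l {..<n} I = {}" for I
      proof (rule ccontr)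
        assume "\<not> ?thesis"
        then obtain T where "T \<in> \<S>" "T \<subseteq> I" using S(2)[rule_format, of I] I E(2) by auto
        thus False using no I(1) E(1) by auto
      qed
      from ex_num_cycle_le[OF l E(2) m this] G E(1) show False by simp
    qed
  qed
  hence "measure_pmf.prob ?R (- ?good \<inter> set_pmf ?R) \<le> measure_pmf.prob ?R (\<Union>S\<in>\<S>. {G. S \<subseteq> edges G})"
    by (intro measure_pmf.finite_measure_mono) auto
  also have "\<dots> \<le> (\<Sum>S\<in>\<S>. measure_pmf.prob ?R {G. S \<subseteq> edges G})"
    by (rule measure_pmf.finite_measure_subadditive_finite[OF fin\<S>]) auto
  also have "\<dots> \<le> (\<Sum>S\<in>\<S>. P ^ card S)"
  proof (rule sum_mono)
    fix T assume "T \<in> \<S>"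
    hence "measure_pmf.prob ?R {G. T \<subseteq> edges G} = p ^ card T"
      using S(1) p by (intro prob_random_graph_contains) auto
    also have "\<dots> \<le> P ^ card T" using p by (intro power_mono)
    finally show "measure_pmf.prob ?R {G. T \<subseteq> edges G} \<le> P ^ card T" .
  qed
  finally have "measure_pmf.prob ?R (- ?good) \<le> W" using S(3) by (simp add: measure_Int_set_pmf)
  moreover have "measure_pmf.prob ?R (- ?good) = 1 - measure_pmf.prob ?R ?good"
    using measure_pmf.prob_compl[of ?good ?R] by (simp add: Compl_eq_Diff_UNIV)
  ultimately show ?thesis by linarith
qed

theorem theorem1p8:
  fixes l :: nat
  assumes "l \<ge> 2"
  shows "\<exists>C::real. C > 0 \<and>
    (\<forall>p :: nat \<Rightarrow> real. (\<forall>n. 0 \<le> p n \<and> p n \<le> 1) \<longrightarrow>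
      (\<lambda>n. measure_pmf.prob (random_graph n (p n))
         {G. real (ex_num G (cycle_graph (2 * l))) \<le>
             (if p n \<le> real n powr (- ((real l - 1) / (2 * real l - 1))) * ln (real n) ^ (2 * l)
              then C * real n powr (1 + 1 / (2 * real l - 1)) * (ln (real n))\<^sup>2
              else C * p n powr (1 / real l) * real n powr (1 + 1 / real l))})
      \<longlonglongrightarrow> 1)"
proof -
  obtain C :: real where C: "C > 0" and cover: "\<forall>n p \<mu>. 3 \<le> n \<longrightarrow> 0 < p \<longrightarrow> p \<le> 1 \<longrightarrow>
    \<mu> = p powr (1 / l) * real n powr (1 + 1 / l) \<longrightarrow>
    real n powr (1 + 1 / (2 * real l - 1)) * (ln n)\<^sup>2 \<le> \<mu> \<longrightarrow>
    coverable p (\<lambda>I. cycles_in l {..<n} I = {}) (all_edges {..<n}) (C * \<mu>) (exp (- \<mu>))"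
    using coverable_cycle_free[OF assms] by (elim exE conjE)
  define a where "a = (real l - 1) / (2 * real l - 1)"
  \<comment> \<open>The threshold, at which both bounds agree: with \<mu> as below, \<mu>(q) =
    n^(1+1/(2l-1)) (ln n)^2. Both cases of the claim are therefore C \<mu>(max p q).\<close>
  define q where "q = (\<lambda>n. real n powr (- a) * ln (real n) ^ (2 * l))"
  have a: "a > 0" using assms by (simp add: a_def)
  have "q \<longlonglongrightarrow> 0" unfolding q_def using a by real_asymp
  hence q1: "\<forall>\<^sub>F n in sequentially. q n < 1" by (rule order_tendstoD) simp
  show ?thesis
  proof (rule exI[of _ C], intro conjI allI impI)
    show "C > 0" by fact
    fix p :: "nat \<Rightarrow> real" assume p: "\<forall>n. 0 \<le> p n \<and> p n \<le> 1"
    let ?bound = "\<lambda>n. if p n \<le> real n powr (- ((real l - 1) / (2 * real l - 1))) * ln (real n) ^ (2 * l)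
              then C * real n powr (1 + 1 / (2 * real l - 1)) * (ln (real n))\<^sup>2
              else C * p n powr (1 / real l) * real n powr (1 + 1 / real l)"
    let ?prob = "\<lambda>n. measure_pmf.prob (random_graph n (p n)) {G. real (ex_num G (cycle_graph (2 * l))) \<le> ?bound n}"
    have lower: "1 - exp (- real n) \<le> ?prob n" if n: "3 \<le> n" and qn: "q n < 1" for n
    proof -
      define P where "P = max (p n) (q n)"
      define \<mu> where "\<mu> = (\<lambda>x. x powr (1 / l) * real n powr (1 + 1 / l))"
      have "exp 1 \<le> real n" using exp_le n by linarith
      hence ln1: "ln n \<ge> 1" using n by (subst ln_ge_iff) auto
      have q0: "q n > 0" unfolding q_def using n ln1 by (intro mult_pos_pos zero_less_power) auto
      have \<mu>q: "\<mu> (q n) = real n powr (1 + 1 / (2 * real l - 1)) * (ln n)\<^sup>2"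
      proof -
        have "(ln (real n) ^ (2 * l)) powr (1 / l) = (ln n)\<^sup>2"
        proof -
          have "ln (real n) ^ (2 * l) = (ln n) powr real (2 * l)" using ln1 by (intro powr_realpow[symmetric]) auto
          hence "(ln (real n) ^ (2 * l)) powr (1 / l) = ln n powr 2" using assms by (simp add: powr_powr)
          thus ?thesis using ln1 by (simp add: powr_numeral)
        qed
        moreover have "(real n powr (- a)) powr (1 / l) * real n powr (1 + 1 / l) = real n powr (1 + 1 / (2 * real l - 1))"
        proof -
          have "- a * (1 / l) + (1 + 1 / l) = 1 + 1 / (2 * real l - 1)"
            using assms by (simp add: a_def field_simps)
          thus ?thesis by (simp only: powr_powr powr_add[symmetric])
        qed
        ultimately show ?thesis unfolding \<mu>_def q_def using n ln1 by (simp add: powr_mult mult_ac)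
      qed
      have P: "0 < P" "P \<le> 1" "p n \<le> P" using q0 qn p by (auto simp: P_def max_def)
      have \<mu>P: "real n powr (1 + 1 / (2 * real l - 1)) * (ln n)\<^sup>2 \<le> \<mu> P"
        unfolding \<mu>q[symmetric] \<mu>_def using q0 by (intro mult_right_mono powr_mono2) (auto simp: P_def)
      \<comment> \<open>Since \<mu>(P) is at least n, the failure probability is at most exp(-n),
        whatever the function p.\<close>
      have "real n * 1 \<le> real n powr (1 + 1 / (2 * real l - 1)) * (ln n)\<^sup>2"
      proof (intro mult_mono)
        have "real n powr 1 \<le> real n powr (1 + 1 / (2 * real l - 1))" using n assms by (intro powr_mono) auto
        thus "real n \<le> real n powr (1 + 1 / (2 * real l - 1))" by simp
        show "1 \<le> (ln n)\<^sup>2" using ln1 by (simp add: one_le_power)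
      qed auto
      hence "exp (- \<mu> P) \<le> exp (- real n)" using \<mu>P by simp
      moreover have bound: "C * \<mu> P = ?bound n"
      proof (cases "p n \<le> q n")
        case True
        hence "C * \<mu> P = C * \<mu> (q n)" by (simp add: P_def max_def)
        thus ?thesis using True unfolding \<mu>q by (simp add: q_def a_def)
      next
        case False
        hence "C * \<mu> P = C * \<mu> (p n)" by (simp add: P_def max_def)
        thus ?thesis using False by (simp add: q_def a_def \<mu>_def)
      qed
      moreover have "1 - exp (- \<mu> P) \<le> ?prob n"
        unfolding bound[symmetric]
      proof (rule prob_ex_num_le[OF assms])
        show "coverable P (\<lambda>I. cycles_in l {..<n} I = {}) (all_edges {..<n}) (C * \<mu> P) (exp (- \<mu> P))"
          using cover[rule_format, OF n P(1,2) _ \<mu>P] by (simp add: \<mu>_def)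
        show "0 \<le> C * \<mu> P" using C by (simp add: \<mu>_def)
      qed (use p P in auto)
      ultimately show ?thesis by linarith
    qed
    show "?prob \<longlonglongrightarrow> 1"
    proof (rule tendsto_sandwich)
      show "\<forall>\<^sub>F n in sequentially. 1 - exp (- real n) \<le> ?prob n"
        using q1 eventually_ge_at_top[of 3] by eventually_elim (rule lower)
      show "\<forall>\<^sub>F n in sequentially. ?prob n \<le> 1" by simp
      show "(\<lambda>n. 1 - exp (- real n)) \<longlonglongrightarrow> 1" by real_asymp
    qed simp
  qed
qed

end
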